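(* Let $n\ge 2$, and let $\mathcal{P}_n=GL(n,\mathbb{R})\times\mathbb{R}^n$ with its usual topology. Let $\mathcal{A}_n\subset\mathcal{P}_n$ be the Anosov-realizable locus, $\mathcal{H}_n\subset\mathcal{P}_n$ the hyperbolic locus, and $\mathcal{D}_n^{reg}\subset\mathcal{P}_n$ the set of regular drift pairs. Then $\mathcal{A}_n$ is dense in $\mathcal{P}_n$ and $$\operatorname{Int}_{\mathcal{P}_n}(\mathcal{A}_n)=\mathcal{H}_n\cup\mathcal{D}_n^{reg}.$$ Equivalently, for $(A,v)\in\mathcal{A}_n$ with $A$ not hyperbolic, $(A,v)$ is an interior point of $\mathcal{A}_n$ if and only if $1$ is an algebraically simple eigenvalue of $A$, $1$ is the only eigenvalue of $A$ on the unit circle, and $x\mapsto Ax+v$ has no fixed point. Therefore $$\partial_{\mathcal{P}_n}\mathcal{A}_n=\mathcal{P}_n\setminus(\mathcal{H}_n\cup\mathcal{D}_n^{reg}).$$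
   Context: For $(A,v)\in\mathcal{P}_n$ write $f_{A,v}(x)=Ax+v$ on $\mathbb{R}^n$. $\mathbb{S}^1=\{z\in\mathbb{C}:|z|=1\}$; $A$ is hyperbolic if $\operatorname{Spec}(A)\cap\mathbb{S}^1=\varnothing$. Definitions: $\mathcal{A}_n=\{(A,v)\in\mathcal{P}_n: f_{A,v}$ is Anosov with respect to some complete Riemannian metric on $\mathbb{R}^n\}$; $\mathcal{H}_n=\{(A,v)\in\mathcal{P}_n: A \text{ is hyperbolic}\}$; $(A,v)\in\mathcal{P}_n$ is a regular drift pair if (1) $\operatorname{Spec}(A)\cap\mathbb{S}^1=\{1\}$, (2) the eigenvalue $1$ of $A$ is algebraically simple, (3) $v\notin\operatorname{Im}(I-A)$ (equivalently $f_{A,v}$ has no fixed point); $\mathcal{D}_n^{reg}$ is the set of regular drift pairs. $\operatorname{Int}_{\mathcal{P}_n}$ and $\partial_{\mathcal{P}_n}$ denote topological interior and boundary in $\mathcal{P}_n$. A diffeomorphism $f$ of a smooth manifold $M$ is Anosov with respect to a Riemannian metric $\rho$ if there are a continuous $Df$-invariant splitting $TM=E^s\oplus E^u$ (possibly trivial: $E^s=\{0\}$ or $E^u=\{0\}$ allowed) and constants $C\ge 1$, $\lambda\in(0,1)$ such that for all integers $m\ge 0$: $\|Df^m(w)\|_\rho\le C\lambda^m\|w\|_\rho$ for $w\in E^s$ and $\|Df^{-m}(w)\|_\rho\le C\lambda^m\|w\|_\rho$ for $w\in E^u$. *)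

theory Defs
  imports
    "HOL-Analysis.Analysis"
    "HOL-Computational_Algebra.Polynomial"
begin

text \<open>
  A map is \<open>C\<^sup>k\<^sup>+\<^sup>1\<close> iff it is differentiable and each of its directional derivatives is \<open>C\<^sup>k\<close>;
  in finite dimension this is the usual notion.
\<close>

primrec Ck :: "nat \<Rightarrow> ('a::euclidean_space \<Rightarrow> 'b::real_normed_vector) \<Rightarrow> bool" where
  "Ck 0 f \<longleftrightarrow> continuous_on UNIV f"
| "Ck (Suc k) f \<longleftrightarrow>
     (\<forall>x. f differentiable (at x)) \<and> (\<forall>v. Ck k (\<lambda>x. frechet_derivative f (at x) v))"

definition smooth_map :: "('a::euclidean_space \<Rightarrow> 'b::real_normed_vector) \<Rightarrow> bool" where
  "smooth_map f \<longleftrightarrow> (\<forall>k. Ck k f)"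

definition diffeomorphism :: "('a::euclidean_space \<Rightarrow> 'a) \<Rightarrow> bool" where
  "diffeomorphism f \<longleftrightarrow> bij f \<and> smooth_map f \<and> smooth_map (inv f)"

text \<open>
  All tangent spaces are identified with the ambient space, so \<open>g x\<close> is the inner product on the
  tangent space at \<open>x\<close>.
\<close>

definition riemannian_metric :: "('a::euclidean_space \<Rightarrow> 'a \<Rightarrow> 'a \<Rightarrow> real) \<Rightarrow> bool" where
  "riemannian_metric g \<longleftrightarrow>
     (\<forall>x. bilinear (g x) \<and> (\<forall>v w. g x v w = g x w v) \<and> (\<forall>v. v \<noteq> 0 \<longrightarrow> g x v v > 0)) \<and>
     (\<forall>v w. smooth_map (\<lambda>x. g x v w))"

definition rnorm :: "('a::euclidean_space \<Rightarrow> 'a \<Rightarrow> 'a \<Rightarrow> real) \<Rightarrow> 'a \<Rightarrow> 'a \<Rightarrow> real" where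
  "rnorm g x v = sqrt (g x v v)"

text \<open>
  The infimum of the lengths of piecewise \<open>C\<^sup>1\<close> curves. The derivative of a \<^const>\<open>valid_path\<close> may
  blow up at its finitely many break points; requiring the speed to have an integral
  selects the curves of finite length, so that no curve of infinite length is assigned the default
  value of a divergent integral. The infimum is that over the usual piecewise \<open>C\<^sup>1\<close> curves.
\<close>

definition riemannian_dist :: "('a::euclidean_space \<Rightarrow> 'a \<Rightarrow> 'a \<Rightarrow> real) \<Rightarrow> 'a \<Rightarrow> 'a \<Rightarrow> real" where
  "riemannian_dist g x y =
     Inf {L. \<exists>\<gamma>. valid_path \<gamma> \<and> pathstart \<gamma> = x \<and> pathfinish \<gamma> = y \<and>
               ((\<lambda>t. rnorm g (\<gamma> t) (vector_derivative \<gamma> (at t))) has_integral L) {0..1}}"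

definition complete_riemannian_metric :: "('a::euclidean_space \<Rightarrow> 'a \<Rightarrow> 'a \<Rightarrow> real) \<Rightarrow> bool" where
  "complete_riemannian_metric g \<longleftrightarrow>
     riemannian_metric g \<and> Metric_space.mcomplete UNIV (riemannian_dist g)"

text \<open>
  A continuous subbundle of the tangent bundle: near every point the fibres have a basis consisting of
  continuous vector fields (a local frame \<open>B\<close>, empty for the zero bundle).
\<close>

definition continuous_subbundle :: "('a::euclidean_space \<Rightarrow> 'a set) \<Rightarrow> bool" where
  "continuous_subbundle E \<longleftrightarrow>
     (\<forall>x. \<exists>U B. open U \<and> x \<in> U \<and> finite B \<and> (\<forall>X\<in>B. continuous_on U X) \<and>
        (\<forall>y\<in>U. inj_on (\<lambda>X. X y) B \<and> independent ((\<lambda>X. X y) ` B) \<and>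
               span ((\<lambda>X. X y) ` B) = E y))"

definition continuous_splitting ::
    "('a::euclidean_space \<Rightarrow> 'a set) \<Rightarrow> ('a \<Rightarrow> 'a set) \<Rightarrow> bool" where
  "continuous_splitting Es Eu \<longleftrightarrow>
     continuous_subbundle Es \<and> continuous_subbundle Eu \<and>
     (\<forall>x. Es x \<inter> Eu x = {0} \<and> {a + b | a b. a \<in> Es x \<and> b \<in> Eu x} = UNIV)"

definition invariant_bundle :: "('a::euclidean_space \<Rightarrow> 'a) \<Rightarrow> ('a \<Rightarrow> 'a set) \<Rightarrow> bool" where
  "invariant_bundle f E \<longleftrightarrow> (\<forall>x. frechet_derivative f (at x) ` E x = E (f x))"

definition anosov_wrt ::
    "('a::euclidean_space \<Rightarrow> 'a) \<Rightarrow> ('a \<Rightarrow> 'a \<Rightarrow> 'a \<Rightarrow> real) \<Rightarrow> bool" where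
  "anosov_wrt f g \<longleftrightarrow>
     diffeomorphism f \<and> riemannian_metric g \<and>
     (\<exists>Es Eu C r. continuous_splitting Es Eu \<and> invariant_bundle f Es \<and> invariant_bundle f Eu \<and>
        C \<ge> 1 \<and> 0 < r \<and> r < 1 \<and>
        (\<forall>m x w. w \<in> Es x \<longrightarrow>
           rnorm g ((f ^^ m) x) (frechet_derivative (f ^^ m) (at x) w) \<le> C * r ^ m * rnorm g x w) \<and>
        (\<forall>m x w. w \<in> Eu x \<longrightarrow>
           rnorm g ((inv f ^^ m) x) (frechet_derivative (inv f ^^ m) (at x) w)
             \<le> C * r ^ m * rnorm g x w))"

definition complexify :: "real^'n^'n \<Rightarrow> complex^'n^'n" where
  "complexify A = map_matrix complex_of_real A"

definition Spec :: "real^'n^'n \<Rightarrow> complex set" where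
  "Spec A = {z. \<exists>w. w \<noteq> 0 \<and> complexify A *v w = z *s w}"

definition charpoly :: "complex^'n^'n \<Rightarrow> complex poly" where
  "charpoly A = det (mat [:0, 1:] - map_matrix (\<lambda>a. [:a:]) A)"

definition alg_mult :: "real^'n^'n \<Rightarrow> complex \<Rightarrow> nat" where
  "alg_mult A z = order z (charpoly (complexify A))"

definition algebraically_simple_eigenvalue :: "real^'n^'n \<Rightarrow> complex \<Rightarrow> bool" where
  "algebraically_simple_eigenvalue A z \<longleftrightarrow> z \<in> Spec A \<and> alg_mult A z = 1"

definition hyperbolic :: "real^'n^'n \<Rightarrow> bool" where
  "hyperbolic A \<longleftrightarrow> Spec A \<inter> sphere 0 1 = {}"

type_synonym 'n param = "(real^'n^'n) \<times> (real^'n)"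

definition affine_map :: "real^'n^'n \<Rightarrow> real^'n \<Rightarrow> real^'n \<Rightarrow> real^'n" where
  "affine_map A v = (\<lambda>x. A *v x + v)"

definition param_space :: "'n::finite param set" where
  "param_space = {A. invertible A} \<times> UNIV"

definition anosov_locus :: "'n::finite param set" where
  "anosov_locus =
     {(A, v) \<in> param_space. \<exists>g. complete_riemannian_metric g \<and> anosov_wrt (affine_map A v) g}"

definition hyperbolic_locus :: "'n::finite param set" where
  "hyperbolic_locus = {(A, v) \<in> param_space. hyperbolic A}"

definition regular_drift_pairs :: "'n::finite param set" where
  "regular_drift_pairs =
     {(A, v) \<in> param_space.
        Spec A \<inter> sphere 0 1 = {1} \<and>
        algebraically_simple_eigenvalue A 1 \<and>
        v \<notin> range (\<lambda>x. (mat 1 - A) *v x)}"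

end

theory Submission
  imports Defs "HOL-Computational_Algebra.Fundamental_Theorem_Algebra"
begin

text \<open>
  The affine map \<open>f x = A x + v\<close> is Anosov for some complete metric iff \<open>A\<close> is hyperbolic or \<open>f\<close> has no
  fixed point. At a fixed point the hyperbolic splitting of the tangent space forces \<open>A\<close> to be
  hyperbolic, and for hyperbolic \<open>A\<close> the Euclidean metric works. If \<open>f\<close> has no fixed point, there is a
  functional \<open>\<phi>\<close> with \<open>\<phi> \<circ> A = \<phi>\<close> and \<open>\<phi> v = 2\<close>. Along \<open>s = \<phi> x\<close> one moves a vector \<open>e s\<close> and a covector
  \<open>w s\<close> equivariantly, with \<open>w s (e s) > 0\<close>, such that \<open>e s\<close> lies in the kernel of \<open>\<phi>\<close> for odd \<open>s\<close> and
  \<open>w s = \<phi>\<close> for even \<open>s\<close>. Then \<open>E\<^sup>s = span (e s)\<close> and \<open>E\<^sup>u = ker (w s)\<close> are contracted and expanded by a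
  metric with weights exponential in \<open>s\<close>, whatever the spectrum of \<open>A\<close>. The metric is complete: the
  direction that is cheap at one end of the \<open>s\<close>-axis is tangent to infinitely many levels of \<open>\<phi>\<close> there,
  so that crossing each of these levels costs a fixed length.

  What remains is linear algebra. Having at most one eigenvalue on the unit circle, counted with
  multiplicity, is an open condition, and such an eigenvalue near \<open>1\<close> is real, hence equal to \<open>1\<close>.
  Conversely, a circle eigenvalue other than \<open>1\<close>, or one obtained by splitting a multiple eigenvalue
  \<open>1\<close> into a conjugate pair, survives a perturbation that removes the eigenvalue \<open>1\<close>; the perturbed
  map has a fixed point without being hyperbolic.
\<close>

section \<open>Smooth functions and a flat step\<close>

text \<open>The obstacle is completeness of the metric. A fixed-point free \<open>f\<close> raises
  the height \<open>\<phi> x\<close> by a constant, so weights exponential in the height can enforce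
  contraction and expansion at any prescribed rate. But the weight on the stable bundle decays
  towards height +infinity and that on the unstable bundle towards -infinity: if the stable
  direction stayed transverse to the levels of \<open>\<phi>\<close>, a curve following it would
  reach infinite height within finite length. So the splitting has to turn. In every period the
  stable line must once lie in the kernel of \<open>\<phi>\<close>, and the unstable hyperplane must
  once be that kernel; since \<open>\<phi> \<circ> A = \<phi>\<close>, \<open>f\<close> carries each
  such alignment to the next period. The normalisation \<open>\<phi> v = 2\<close> gives a period
  two integer nodes, one for each alignment. A nonzero stable vector inside the kernel of
  \<open>\<phi>\<close> exists because n is at least 2. Of \<open>A\<close> only a norm bound for
  its inverse enters, and it is absorbed by the exponent \<open>\<Lambda>\<close> of the unstable
  weight.\<close>

lemma Ck_has_derivative:
  assumes "\<And>x. (f has_derivative f' x) (at x)" and "\<And>v. Ck k (\<lambda>x. f' x v)"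
  shows "Ck (Suc k) f"
proof -
  have "frechet_derivative f (at x) = f' x" for x
    by (rule frechet_derivative_at[symmetric, OF assms(1)])
  then show ?thesis
    using assms by (auto simp: differentiable_def)
qed

lemma Ck_frechet_derivative: "Ck (Suc k) f \<Longrightarrow> Ck k (\<lambda>x. frechet_derivative f (at x) v)"
  by simp

lemma Ck_imp_has_derivative:
  assumes "Ck (Suc k) f"
  shows "(f has_derivative frechet_derivative f (at x)) (at x)"
  using assms frechet_derivative_works by auto

lemma Ck_const [intro, simp]: "Ck k (\<lambda>x. c)"
proof (induction k arbitrary: c)
  case (Suc k)
  show ?case by (rule Ck_has_derivative[where f' = "\<lambda>_ _. 0"]) (auto simp: Suc)
qed auto

lemma Ck_Suc_imp_Ck: "Ck (Suc k) f \<Longrightarrow> Ck k f"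
proof (induction k arbitrary: f)
  case 0
  then show ?case
    by (auto simp: continuous_on_eq_continuous_at dest!: differentiable_imp_continuous_within)
next
  case (Suc k)
  then show ?case by (metis Ck.simps(2))
qed

declare Ck.simps(2) [simp del]

lemma Ck_imp_continuous_on: "Ck k f \<Longrightarrow> continuous_on UNIV f"
proof (induction k)
  case (Suc k)
  then show ?case using Ck_Suc_imp_Ck by blast
qed simp

lemma Ck_add:
  assumes "Ck k f" "Ck k g" shows "Ck k (\<lambda>x. f x + g x)"
  using assms
proof (induction k arbitrary: f g)
  case 0 then show ?case by (auto intro: continuous_on_add)
next
  case (Suc k)
  show ?case
    by (rule Ck_has_derivative[OF has_derivative_add[OF Ck_imp_has_derivative[OF Suc.prems(1)]
            Ck_imp_has_derivative[OF Suc.prems(2)]]]) (intro Suc.IH Ck_frechet_derivative Suc.prems)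
qed

lemma Ck_bilinear:
  assumes "bounded_bilinear bop" "Ck k f" "Ck k g"
  shows "Ck k (\<lambda>x. bop (f x) (g x))"
  using assms(2,3)
proof (induction k arbitrary: f g)
  case 0 then show ?case by (auto intro: bounded_bilinear.continuous_on[OF assms(1)])
next
  case (Suc k)
  note d = Ck_imp_has_derivative[OF Suc.prems(1)] Ck_imp_has_derivative[OF Suc.prems(2)]
  show ?case
    by (rule Ck_has_derivative[OF bounded_bilinear.FDERIV[OF assms(1) d]])
      (intro Ck_add Suc.IH Ck_frechet_derivative Suc.prems Ck_Suc_imp_Ck)
qed

lemmas Ck_scaleR = Ck_bilinear[OF bounded_bilinear_scaleR]
lemmas Ck_inner = Ck_bilinear[OF bounded_bilinear_inner]
lemmas Ck_mult = Ck_bilinear[OF bounded_bilinear_mult]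

lemma Ck_minus: "Ck k f \<Longrightarrow> Ck k (\<lambda>x. - f x)"
  using Ck_scaleR[OF Ck_const[of k "-1"], of f] by simp

lemma Ck_diff: "Ck k f \<Longrightarrow> Ck k g \<Longrightarrow> Ck k (\<lambda>x. f x - g x)"
  using Ck_add[of k f "\<lambda>x. - g x"] Ck_minus by auto

lemma Ck_linear_comp:
  assumes "Ck k f" "bounded_linear L"
  shows "Ck k (\<lambda>x. f (L x + c))"
  using assms(1)
proof (induction k arbitrary: f)
  case 0
  have "continuous_on UNIV (\<lambda>x. L x + c)"
    by (intro continuous_intros linear_continuous_on assms(2))
  then show ?case
    using 0 continuous_on_compose2[of UNIV f UNIV "\<lambda>x. L x + c"] by simp
next
  case (Suc k)
  show ?case
  proof (rule Ck_has_derivative)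
    fix x
    have "((\<lambda>x. L x + c) has_derivative L) (at x)"
      using bounded_linear_imp_has_derivative[OF assms(2)] by (auto intro!: derivative_eq_intros)
    from has_derivative_compose[OF this Ck_imp_has_derivative[OF Suc.prems]]
    show "((\<lambda>x. f (L x + c)) has_derivative (\<lambda>v. frechet_derivative f (at (L x + c)) (L v))) (at x)"
      by simp
  qed (intro Suc.IH Ck_frechet_derivative Suc.prems)
qed

lemma Ck_vector_derivative:
  fixes f :: "real \<Rightarrow> 'b::real_normed_vector"
  assumes "\<And>x. (f has_vector_derivative f' x) (at x)" "Ck k f'"
  shows "Ck (Suc k) f"
  by (rule Ck_has_derivative[of f "\<lambda>x h. h *\<^sub>R f' x"])
    (use assms in \<open>auto simp: has_vector_derivative_def intro!: Ck_scaleR\<close>)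

text \<open>\<open>Ck\<close> speaks about functions on the whole space, so local smoothness is
  expressed by agreement near each point with a globally smooth function. This serves the
  interpolants below, which are given by different formulas on different intervals.\<close>

lemma Ck_local:
  assumes "\<And>x. \<exists>U h. open U \<and> x \<in> U \<and> Ck k h \<and> (\<forall>y\<in>U. f y = h y)"
  shows "Ck k f"
  using assms
proof (induction k arbitrary: f)
  case 0
  have "isCont f x" for x
  proof -
    obtain U h where *: "open U" "x \<in> U" "Ck 0 h" "\<forall>y\<in>U. f y = h y"
      using 0 by blast
    then have "continuous_on U f"
      using continuous_on_cong[of U U f h] by (auto intro: continuous_on_subset)
    then show ?thesis
      using * continuous_on_eq_continuous_at by blast
  qed
  then show ?case
    using continuous_at_imp_continuous_on[of UNIV f] by simp
next
  case (Suc k)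
  have *: "\<exists>U h. open U \<and> x \<in> U \<and> Ck (Suc k) h
      \<and> (\<forall>y\<in>U. (f has_derivative frechet_derivative h (at y)) (at y))" for x
  proof -
    obtain U h where *: "open U" "x \<in> U" "Ck (Suc k) h" "\<forall>y\<in>U. f y = h y"
      using Suc.prems[of x] by blast
    then have "(f has_derivative frechet_derivative h (at y)) (at y)" if "y \<in> U" for y
      using has_derivative_transform_within_open[OF Ck_imp_has_derivative[OF *(3)] *(1) that] by auto
    then show ?thesis using * by blast
  qed
  show ?case
  proof (rule Ck_has_derivative)
    show "(f has_derivative frechet_derivative f (at x)) (at x)" for x
      using * frechet_derivative_at by metis
    show "Ck k (\<lambda>x. frechet_derivative f (at x) v)" for v
    proof (rule Suc.IH)
      fix x
      obtain U h where U: "open U" "x \<in> U" "Ck (Suc k) h"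
        "\<forall>y\<in>U. (f has_derivative frechet_derivative h (at y)) (at y)"
        using * by blast
      then have "\<forall>y\<in>U. frechet_derivative f (at y) v = frechet_derivative h (at y) v"
        using frechet_derivative_at by metis
      then show "\<exists>U h. open U \<and> x \<in> U \<and> Ck k h \<and> (\<forall>y\<in>U. frechet_derivative f (at y) v = h y)"
        using U by (intro exI[of _ U] exI[of _ "\<lambda>y. frechet_derivative h (at y) v"])
          (auto intro: Ck_frechet_derivative)
    qed
  qed
qed

lemma Ck_exp: "Ck k (\<lambda>x::real. exp (c * x) :: real)"
proof (induction k)
  case (Suc k)
  then show ?case
    by (intro Ck_vector_derivative[where f' = "\<lambda>x. c * exp (c * x)"])
      (auto intro!: derivative_eq_intros Ck_mult simp flip: has_real_derivative_iff_has_vector_derivative)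
qed (auto intro!: continuous_intros)

text \<open>The powers of \<open>1 / x\<close> make the family closed under differentiation, so that
  smoothness follows by induction for all \<open>m\<close> at once.\<close>

definition flat_exp :: "nat \<Rightarrow> real \<Rightarrow> real" where
  "flat_exp m x = (if x \<le> 0 then 0 else (1 / x) ^ m * exp (- (1 / x)))"

lemma flat_exp_tendsto_0: "(flat_exp m \<longlongrightarrow> 0) (at 0)"
proof -
  have "((\<lambda>x::real. x ^ m / exp x) \<longlongrightarrow> 0) at_top"
    by (rule tendsto_power_div_exp_0)
  then have "((\<lambda>x::real. inverse x ^ m / exp (inverse x)) \<longlongrightarrow> 0) (at_right 0)"
    by (rule filterlim_compose[OF _ filterlim_inverse_at_top_right])
  then have "(flat_exp m \<longlongrightarrow> 0) (at_right 0)"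
    by (rule Lim_transform_eventually)
      (auto simp: eventually_at_right_field flat_exp_def exp_minus inverse_eq_divide intro!: exI[of _ 1])
  moreover have "(flat_exp m \<longlongrightarrow> 0) (at_left 0)"
    by (rule Lim_transform_eventually[OF tendsto_const])
      (auto simp: eventually_at_left_field flat_exp_def intro!: exI[of _ "-1"])
  ultimately show ?thesis
    using filterlim_split_at by blast
qed

lemma flat_exp_has_derivative:
  "(flat_exp m has_real_derivative flat_exp (m + 2) x - real m * flat_exp (m + 1) x) (at x)"
proof (cases x "0::real" rule: linorder_cases)
  case less
  show ?thesis
    by (rule has_field_derivative_transform_within_open[of "\<lambda>_. 0" _ _ "{..<0}"])
      (use less in \<open>auto simp: flat_exp_def\<close>)
next
  case equal
  \<comment> \<open>The difference quotient of \<open>flat_exp m\<close> at \<open>0\<close> is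
    \<open>flat_exp (m + 1)\<close>, which tends to \<open>0\<close>.\<close>
  have "(flat_exp m has_real_derivative 0) (at 0)"
    unfolding has_field_derivative_iff
    by (rule Lim_transform_eventually[OF flat_exp_tendsto_0[of "m + 1"]])
      (auto simp: eventually_at_filter flat_exp_def field_simps)
  then show ?thesis using equal by (simp add: flat_exp_def)
next
  case greater
  have inv: "((\<lambda>x. 1 / x) has_real_derivative - ((1 / x)\<^sup>2)) (at x)"
    using greater by (auto intro!: derivative_eq_intros simp: power2_eq_square)
  have "((\<lambda>x. (1 / x) ^ m * exp (- (1 / x))) has_real_derivative
      (1 / x) ^ (m + 2) * exp (- (1 / x)) - real m * ((1 / x) ^ (m + 1) * exp (- (1 / x)))) (at x)"
    by (rule derivative_eq_intros inv refl)+ (cases m; simp add: algebra_simps power2_eq_square)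
  then have "(flat_exp m has_real_derivative
      (1 / x) ^ (m + 2) * exp (- (1 / x)) - real m * ((1 / x) ^ (m + 1) * exp (- (1 / x)))) (at x)"
    by (rule has_field_derivative_transform_within_open[of _ _ _ "{0<..}"])
      (use greater in \<open>auto simp: flat_exp_def\<close>)
  then show ?thesis using greater by (simp add: flat_exp_def)
qed

lemma Ck_flat_exp: "Ck k (flat_exp m)"
proof (induction k arbitrary: m)
  case 0
  have "continuous_on UNIV (flat_exp m)"
    by (rule DERIV_continuous_on) (rule flat_exp_has_derivative)
  then show ?case by simp
next
  case (Suc k)
  show ?case
    by (rule Ck_vector_derivative[OF flat_exp_has_derivative
          [unfolded has_real_derivative_iff_has_vector_derivative]])
      (intro Ck_diff Ck_mult Ck_const Suc)
qed

text \<open>The step is constant near \<open>0\<close> and \<open>1\<close>, so that the interpolants below are smooth at their nodes.\<close>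

lemma smooth_step_exists:
  "\<exists>\<sigma> \<sigma>' :: real \<Rightarrow> real. (\<forall>k. Ck k \<sigma>) \<and> (\<forall>x. (\<sigma> has_real_derivative \<sigma>' x) (at x)) \<and>
     (\<exists>M. \<forall>x. \<bar>\<sigma>' x\<bar> \<le> M) \<and> (\<forall>x. 0 \<le> \<sigma> x \<and> \<sigma> x \<le> 1) \<and>
     (\<forall>x\<le>1/4. \<sigma> x = 0) \<and> (\<forall>x\<ge>3/4. \<sigma> x = 1)"
proof -
  \<comment> \<open>A bump that is positive exactly between \<open>1/4\<close> and
    \<open>3/4\<close>; the step is its normalised primitive.\<close>
  define b where "b x = flat_exp 0 (x - 1/4) * flat_exp 0 (3/4 - x)" for x :: real
  have Ckb: "Ck k b" for k
  proof -
    have "Ck k (\<lambda>x. flat_exp 0 (x - 1/4))"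
      using Ck_linear_comp[OF Ck_flat_exp bounded_linear_ident, of k 0 "-1/4"] by simp
    moreover have "Ck k (\<lambda>x. flat_exp 0 (3/4 - x))"
      using Ck_linear_comp[OF Ck_flat_exp bounded_linear_minus[OF bounded_linear_ident], of k 0 "3/4"] 
      by simp
    ultimately show ?thesis unfolding b_def by (intro Ck_mult)
  qed
  then have cb: "continuous_on S b" for S
    using Ck_imp_continuous_on continuous_on_subset by blast
  have b_nonneg: "b x \<ge> 0" for x by (simp add: b_def flat_exp_def)
  have b_zero: "b x = 0" if "x \<le> 1/4 \<or> x \<ge> 3/4" for x using that by (auto simp: b_def flat_exp_def)
  define I where "I = integral {0..1} b"
  have "I > 0"
  proof -
    have "I \<ge> 0" unfolding I_def by (simp add: b_nonneg integral_nonneg cb integrable_continuous_real)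
    moreover have "I \<noteq> 0"
    proof
      assume "I = 0"
      then have "(b has_integral 0) (cbox 0 1)"
        using integrable_integral[OF integrable_continuous_real[OF cb], of 0 1] by (simp add: I_def)
      then have "b (1/2) = 0"
        using has_integral_0_cbox_imp_0[of 0 1 b "1/2"] cb b_nonneg by auto
      then show False by (simp add: b_def flat_exp_def)
    qed
    ultimately show ?thesis by simp
  qed
  define \<sigma> where "\<sigma> x = (if x \<ge> 0 then integral {0..x} b / I else 0)" for x
  have \<sigma>_le: "\<sigma> x = 0" if "x \<le> 1/4" for x
    using that b_zero integral_cong[of "{0..x}" b "\<lambda>_. 0"] by (auto simp: \<sigma>_def)
  have \<sigma>_ge: "\<sigma> x = 1" if "x \<ge> 3/4" for x
  proof -
    have "integral {0..y} b = integral {0..3/4} b" if "y \<ge> 3/4" for y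
    proof -
      have "integral {0..3/4} b + integral {3/4..y} b = integral {0..y} b"
        by (rule Henstock_Kurzweil_Integration.integral_combine)
          (use that in \<open>auto intro: integrable_continuous_real cb\<close>)
      moreover have "integral {3/4..y} b = integral {3/4..y} (\<lambda>_. 0)"
        by (rule integral_cong) (auto simp: b_zero)
      ultimately show ?thesis by simp
    qed
    from this[OF that] this[of 1] show ?thesis
      using that \<open>I > 0\<close> by (auto simp: \<sigma>_def I_def)
  qed
  have der: "(\<sigma> has_real_derivative b x / I) (at x)" for x
  proof (cases "x > 0")
    case True
    have "((\<lambda>u. integral {0..u} b) has_vector_derivative b x) (at x within {0..x+1})"
      by (rule integral_has_vector_derivative) (use True cb in auto)
    then have "((\<lambda>u. integral {0..u} b) has_real_derivative b x) (at x)"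
      using True at_within_interior[of x "{0..x+1}"]
      by (auto simp: has_real_derivative_iff_has_vector_derivative)
    then have "((\<lambda>u. integral {0..u} b / I) has_real_derivative b x / I) (at x)"
      by (rule DERIV_cdivide)
    then show ?thesis
      by (rule has_field_derivative_transform_within_open[of _ _ _ "{0<..}"])
        (use True in \<open>auto simp: \<sigma>_def\<close>)
  next
    case False
    have "((\<lambda>_. 0) has_real_derivative 0) (at x)" by simp
    then have "(\<sigma> has_real_derivative 0) (at x)"
      by (rule has_field_derivative_transform_within_open[of _ _ _ "{..<1/4}"])
        (use False \<sigma>_le in auto)
    then show ?thesis using False b_zero by auto
  qed
  have Ck\<sigma>: "Ck k \<sigma>" for k
  proof -
    have "Ck (Suc k) \<sigma>"
      by (rule Ck_vector_derivative[OF der[unfolded has_real_derivative_iff_has_vector_derivative]])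
        (use Ck_mult[OF Ckb[of k] Ck_const[of k "1/I"]] in simp)
    then show ?thesis by (rule Ck_Suc_imp_Ck)
  qed
  have mono: "mono \<sigma>"
  proof (rule monoI)
    fix x y :: real assume "x \<le> y"
    then show "\<sigma> x \<le> \<sigma> y"
      by (rule DERIV_nonneg_imp_nondecreasing)
        (metis der b_nonneg \<open>I > 0\<close> divide_nonneg_pos)
  qed
  have bnd: "0 \<le> \<sigma> x \<and> \<sigma> x \<le> 1" for x
    using monoD[OF mono, of "min x 0" x] monoD[OF mono, of x "max x 1"] \<sigma>_le[of "min x 0"]
      \<sigma>_ge[of "max x 1"] by auto
  have "\<exists>M. \<forall>x. \<bar>b x / I\<bar> \<le> M"
  proof -
    have "compact (b ` {0..1})" by (intro compact_continuous_image cb) auto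
    then obtain M where "\<forall>y\<in>b ` {0..1}. norm y \<le> M"
      using compact_imp_bounded[of "b ` {0..1}"] unfolding bounded_iff by blast
    then have M: "\<And>y. y \<in> b ` {0..1} \<Longrightarrow> \<bar>y\<bar> \<le> M" by auto
    have "\<bar>b x / I\<bar> \<le> M / I" for x
    proof (cases "x \<in> {0..1}")
      case True
      then show ?thesis using M[of "b x"] \<open>I > 0\<close> by (auto simp: divide_simps)
    next
      case False
      then have "b x = 0" using b_zero[of x] by auto
      moreover have "0 \<le> M" using M[of "b 0"] by fastforce
      ultimately show ?thesis using \<open>I > 0\<close> by simp
    qed
    then show ?thesis by blast
  qed
  then show ?thesis
    using Ck\<sigma> der bnd \<sigma>_le \<sigma>_ge by (intro exI[of _ \<sigma>] exI[of _ "\<lambda>x. b x / I"]) blast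
qed

section \<open>Completeness of Riemannian metrics\<close>

definition curve_length ::
    "('a::euclidean_space \<Rightarrow> 'a \<Rightarrow> 'a \<Rightarrow> real) \<Rightarrow> (real \<Rightarrow> 'a) \<Rightarrow> real \<Rightarrow> bool" where
  "curve_length g \<gamma> L \<longleftrightarrow> valid_path \<gamma> \<and>
     ((\<lambda>t. rnorm g (\<gamma> t) (vector_derivative \<gamma> (at t))) has_integral L) {0..1}"

lemma riemannian_dist_altdef:
  "riemannian_dist g x y = Inf {L. \<exists>\<gamma>. curve_length g \<gamma> L \<and> pathstart \<gamma> = x \<and> pathfinish \<gamma> = y}"
  unfolding riemannian_dist_def curve_length_def by meson

context
  fixes g :: "'a::euclidean_space \<Rightarrow> 'a \<Rightarrow> 'a \<Rightarrow> real"
  assumes g: "riemannian_metric g"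
begin

lemma metric_bilinear: "bilinear (g x)"
  and metric_pos: "v \<noteq> 0 \<Longrightarrow> g x v v > 0"
  and metric_smooth: "Ck k (\<lambda>x. g x v w)"
  using g by (auto simp: riemannian_metric_def smooth_map_def)

lemma metric_nonneg: "g x v v \<ge> 0"
  by (cases "v = 0") (auto simp: less_imp_le metric_pos bilinear_lzero[OF metric_bilinear])

lemma rnorm_nonneg: "rnorm g x v \<ge> 0"
  by (simp add: rnorm_def metric_nonneg)

lemma rnorm_scale: "rnorm g x (c *\<^sub>R v) = \<bar>c\<bar> * rnorm g x v"
  by (simp add: rnorm_def bilinear_lmul[OF metric_bilinear] bilinear_rmul[OF metric_bilinear]
      real_sqrt_mult flip: power2_eq_square mult.assoc)

lemma continuous_on_metric:
  assumes "continuous_on S p" "continuous_on S v"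
  shows "continuous_on S (\<lambda>s. g (p s) (v s) (v s))"
proof -
  have "g x w w = (\<Sum>i\<in>Basis. \<Sum>j\<in>Basis. (w \<bullet> i) * (w \<bullet> j) * g x i j)" for x w
  proof -
    have "g x w w = g x (\<Sum>i\<in>Basis. (w \<bullet> i) *\<^sub>R i) (\<Sum>j\<in>Basis. (w \<bullet> j) *\<^sub>R j)"
      by (simp add: euclidean_representation)
    also have "\<dots> = (\<Sum>i\<in>Basis. \<Sum>j\<in>Basis. (w \<bullet> i) * (w \<bullet> j) * g x i j)"
      by (simp only: bilinear_sum[OF metric_bilinear] bilinear_lmul[OF metric_bilinear]
          bilinear_rmul[OF metric_bilinear] real_scaleR_def mult.assoc mult.left_commute
          sum.cartesian_product finite_Basis)
    finally show ?thesis .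
  qed
  moreover have "continuous_on S (\<lambda>s. g (p s) i j)" for i j
    using continuous_on_compose2[OF Ck_imp_continuous_on[OF metric_smooth[of 0 i j]] assms(1)]
    by simp
  ultimately show ?thesis
    using assms by (auto intro!: continuous_intros)
qed

text \<open>The Riemannian norm is continuous and positive on the compact product of
  \<open>K\<close> with the unit sphere; homogeneity carries its extrema over to all
  vectors.\<close>

lemma rnorm_bounds_compact:
  assumes "compact K"
  shows "\<exists>c C. 0 < c \<and> 0 < C \<and> (\<forall>x\<in>K. \<forall>v. c * norm v \<le> rnorm g x v \<and> rnorm g x v \<le> C * norm v)"
proof (cases "K = {} \<or> (sphere 0 1 :: 'a set) = {}")
  case True
  then show ?thesis
  proof
    assume "(sphere 0 1 :: 'a set) = {}"
    then have "v = 0" for v :: 'a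
      using sphere_eq_empty[of "0::'a" 1] by simp
    then show ?thesis
      by (intro exI[of _ 1]) (metis mult.right_neutral norm_zero rnorm_scale scale_zero_left
          abs_zero mult_zero_left mult_zero_right order_refl zero_less_one)
  qed (auto intro: exI[of _ 1])
next
  case False
  let ?h = "\<lambda>z. g (fst z) (snd z) (snd z)"
  have comp: "compact (K \<times> (sphere 0 1 :: 'a set))"
    using assms by (simp add: compact_Times)
  have cont: "continuous_on (K \<times> (sphere 0 1 :: 'a set)) (\<lambda>z. sqrt (?h z))"
    by (intro continuous_intros continuous_on_metric)
  have ne: "K \<times> (sphere 0 1 :: 'a set) \<noteq> {}" using False by auto
  obtain z1 where z1: "z1 \<in> K \<times> sphere 0 1" "\<forall>z\<in>K \<times> sphere 0 1. sqrt (?h z1) \<le> sqrt (?h z)"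
    using continuous_attains_inf[OF comp ne cont] by blast
  obtain z2 where z2: "z2 \<in> K \<times> sphere 0 1" "\<forall>z\<in>K \<times> sphere 0 1. sqrt (?h z) \<le> sqrt (?h z2)"
    using continuous_attains_sup[OF comp ne cont] by blast
  have pos: "sqrt (?h z) > 0" if "z \<in> K \<times> sphere 0 1" for z
  proof -
    from that have "snd z \<noteq> 0" by (auto simp: mem_Times_iff)
    then show ?thesis using metric_pos by simp
  qed
  have "sqrt (?h z1) * norm v \<le> rnorm g x v \<and> rnorm g x v \<le> sqrt (?h z2) * norm v"
    if "x \<in> K" for x v
  proof (cases "v = 0")
    case True
    then show ?thesis using rnorm_scale[of x 0 v] by simp
  next
    case False
    define u where "u = (1 / norm v) *\<^sub>R v"
    have u: "(x, u) \<in> K \<times> sphere 0 1" "v = norm v *\<^sub>R u"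
      using False that by (auto simp: u_def)
    have "rnorm g x v = norm v * rnorm g x u"
      by (subst u(2)) (simp only: rnorm_scale abs_norm_cancel)
    moreover have "sqrt (?h z1) \<le> rnorm g x u" "rnorm g x u \<le> sqrt (?h z2)"
      using z1(2) z2(2) u(1) by (auto simp: rnorm_def)
    ultimately show ?thesis
      by (simp add: mult.commute mult_left_mono)
  qed
  then show ?thesis using pos[OF z1(1)] pos[OF z2(1)] by blast
qed

lemma curve_length_nonneg: "curve_length g \<gamma> L \<Longrightarrow> L \<ge> 0"
  unfolding curve_length_def by (auto intro: has_integral_nonneg rnorm_nonneg)

lemma bdd_below_lengths: "bdd_below {L. \<exists>\<gamma>. curve_length g \<gamma> L \<and> P \<gamma>}"
  by (intro bdd_belowI[of _ 0]) (auto intro: curve_length_nonneg)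

text \<open>The fundamental theorem of calculus along the curve. The slope is bounded only at points
  of the curve, so that a curve can first be confined by one function and then measured by another;
  \<open>s\<close> is arbitrary because confinement concerns every point, not only the end.\<close>

lemma curve_length_bound:
  fixes \<psi> :: "'a \<Rightarrow> 'b::euclidean_space"
  assumes len: "curve_length g \<gamma> L"
    and der: "\<And>x. (\<psi> has_derivative \<psi>' x) (at x)"
    and bound: "\<And>t w. t \<in> {0..1} \<Longrightarrow> norm (\<psi>' (\<gamma> t) w) \<le> K * rnorm g (\<gamma> t) w"
    and "K \<ge> 0" and s: "s \<in> {0..1}"
  shows "norm (\<psi> (\<gamma> s) - \<psi> (\<gamma> 0)) \<le> K * L"
proof -
  let ?v = "\<lambda>t. vector_derivative \<gamma> (at t)"
  let ?r = "\<lambda>t. K * rnorm g (\<gamma> t) (?v t)"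
  obtain S where S: "continuous_on {0..1} \<gamma>" "finite S"
      "\<gamma> C1_differentiable_on ({0..1} - S)"
    using len by (auto simp: curve_length_def valid_path_def piecewise_C1_differentiable_on_def)
  have I: "(?r has_integral K * L) {0..1}"
    using len unfolding curve_length_def by (intro has_integral_mult_right) auto
  have cont: "continuous_on {0..s} (\<lambda>t. \<psi> (\<gamma> t))"
  proof -
    have "continuous_on UNIV \<psi>"
      using der has_derivative_continuous by (blast intro: continuous_at_imp_continuous_on)
    then show ?thesis
      using continuous_on_compose2[of UNIV \<psi> "{0..s}" \<gamma>] continuous_on_subset[OF S(1)] s by auto
  qed
  have "((\<lambda>t. \<psi>' (\<gamma> t) (?v t)) has_integral \<psi> (\<gamma> s) - \<psi> (\<gamma> 0)) {0..s}"
  proof (rule fundamental_theorem_of_calculus_interior_strong[OF S(2)])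
    fix t assume t: "t \<in> {0<..<s} - S"
    have "(\<gamma> has_vector_derivative ?v t) (at t)"
      using S(3) t s by (auto simp: C1_differentiable_on_eq vector_derivative_works)
    from vector_derivative_diff_chain_within[of \<gamma> "?v t" t UNIV, OF _ has_derivative_at_withinI[OF der]]
    show "((\<lambda>t. \<psi> (\<gamma> t)) has_vector_derivative \<psi>' (\<gamma> t) (?v t)) (at t)"
      using \<open>(\<gamma> has_vector_derivative ?v t) (at t)\<close> by (simp add: o_def)
  qed (use s cont in auto)
  then have i1: "norm (\<psi> (\<gamma> s) - \<psi> (\<gamma> 0)) = norm (integral {0..s} (\<lambda>t. \<psi>' (\<gamma> t) (?v t)))"
    and i2: "(\<lambda>t. \<psi>' (\<gamma> t) (?v t)) integrable_on {0..s}"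
    by (auto simp: has_integral_iff)
  have r: "?r integrable_on {0..s}"
    by (rule integrable_on_subinterval[OF has_integral_integrable[OF I]]) (use s in auto)
  have "norm (\<psi> (\<gamma> s) - \<psi> (\<gamma> 0)) \<le> integral {0..s} ?r"
    unfolding i1 by (rule integral_norm_bound_integral[OF i2 r], rule bound) (use s in simp)
  also have "\<dots> \<le> integral {0..1} ?r"
    by (rule integral_subset_le[OF _ r has_integral_integrable[OF I]])
      (use s \<open>K \<ge> 0\<close> in \<open>auto intro: mult_nonneg_nonneg simp: rnorm_nonneg\<close>)
  also have "\<dots> = K * L"
    using I by (rule integral_unique)
  finally show ?thesis .
qed

lemma curve_length_reversepath:
  assumes "curve_length g \<gamma> L"
  shows "curve_length g (reversepath \<gamma>) L"
proof -
  let ?f = "\<lambda>t. rnorm g (\<gamma> t) (vector_derivative \<gamma> (at t))"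
  obtain S where S: "finite S" "\<gamma> C1_differentiable_on ({0..1} - S)"
    using assms by (auto simp: curve_length_def valid_path_def piecewise_C1_differentiable_on_def)
  have "(?f has_integral L) {0..1}"
    using assms by (simp add: curve_length_def)
  then have I: "((\<lambda>t. ?f (1 - t)) has_integral L) {0..1}"
    using has_integral_affinity01[of ?f L "-1" 1] by simp
  have eq: "rnorm g (reversepath \<gamma> t) (vector_derivative (reversepath \<gamma>) (at t)) = ?f (1 - t)"
    if "t \<in> {0..1} - (\<lambda>t. 1 - t) ` S" for t
  proof -
    have "1 - t \<notin> S" using that by (metis DiffD2 diff_diff_eq2 add_diff_cancel_left' image_eqI diff_add_cancel)
    then have d: "(\<gamma> has_vector_derivative vector_derivative \<gamma> (at (1 - t))) (at (1 - t))"
      using S(2) that by (auto simp: C1_differentiable_on_eq vector_derivative_works)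
    have "(\<gamma> \<circ> (\<lambda>x. 1 - x) has_vector_derivative -1 *\<^sub>R vector_derivative \<gamma> (at (1 - t))) (at t)"
      by (intro vector_diff_chain_within has_vector_derivative_at_within[OF d] derivative_eq_intros | simp)+
    then have "vector_derivative (reversepath \<gamma>) (at t) = -1 *\<^sub>R vector_derivative \<gamma> (at (1 - t))"
      by (intro vector_derivative_at) (simp add: o_def reversepath_def)
    then show ?thesis
      using rnorm_scale[of _ "-1"] by (simp add: reversepath_def)
  qed
  have "((\<lambda>t. rnorm g (reversepath \<gamma> t) (vector_derivative (reversepath \<gamma>) (at t)))
      has_integral L) {0..1}"
    by (rule has_integral_spike_finite[OF _ eq I]) (use S(1) in auto)
  then show ?thesis
    using assms valid_path_imp_reverse unfolding curve_length_def by blast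
qed

lemma curve_length_join:
  assumes "curve_length g \<gamma>1 L1" "curve_length g \<gamma>2 L2" "pathfinish \<gamma>1 = pathstart \<gamma>2"
  shows "curve_length g (\<gamma>1 +++ \<gamma>2) (L1 + L2)"
proof -
  let ?f = "\<lambda>\<gamma> t. rnorm g (\<gamma> t) (vector_derivative \<gamma> (at t))"
  obtain S1 S2 where S1: "finite S1" "\<forall>t\<in>{0..1} - S1. \<gamma>1 differentiable at t"
    and S2: "finite S2" "\<forall>t\<in>{0..1} - S2. \<gamma>2 differentiable at t"
    using assms by (auto simp: curve_length_def valid_path_def piecewise_C1_differentiable_on_def
        C1_differentiable_on_eq)
  have "(?f \<gamma>1 has_integral L1) {0..1}" "(?f \<gamma>2 has_integral L2) {0..1}"
    using assms by (auto simp: curve_length_def)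
  note I = this[THEN has_integral_affinity01]
  have I1: "((\<lambda>t. 2 * ?f \<gamma>1 (2 * t)) has_integral L1) {0..1/2}"
    using has_integral_mult_right[OF I(1)[of 2 0], of 2]
    by (simp add: image_affinity_atLeastAtMost_div_diff)
  have eq1: "?f (\<gamma>1 +++ \<gamma>2) t = 2 * ?f \<gamma>1 (2 * t)"
    if "t \<in> {0..1/2} - insert (1/2) ((\<lambda>t. 2 * t) -` S1)" for t
  proof -
    have t: "0 \<le> t" "t < 1/2" "2 * t \<notin> S1"
      using that by (auto simp: less_le)
    have "(\<gamma>1 has_vector_derivative vector_derivative \<gamma>1 (at (2 * t))) (at (2 * t))"
      using S1 t by (auto simp: vector_derivative_works)
    moreover have "((*) 2 has_vector_derivative 2) (at t)"
      by (auto intro!: derivative_eq_intros)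
    ultimately have "((\<lambda>t. \<gamma>1 (2 * t)) has_vector_derivative 2 *\<^sub>R vector_derivative \<gamma>1 (at (2 * t))) (at t)"
      by (intro vector_diff_chain_at[simplified o_def])
    then have "((\<gamma>1 +++ \<gamma>2) has_vector_derivative 2 *\<^sub>R vector_derivative \<gamma>1 (at (2 * t))) (at t)"
      by (rule has_vector_derivative_transform_within_open[of _ _ _ "{..<1/2}"])
        (use t in \<open>auto simp: joinpaths_def\<close>)
    from vector_derivative_at[OF this] show ?thesis
      using t rnorm_scale[of _ 2] by (simp add: joinpaths_def)
  qed
  have fin1: "finite (insert (1/2) ((\<lambda>t. 2 * t) -` S1))"
    using S1(1) by (simp add: finite_vimageI inj_def)
  have J1: "(?f (\<gamma>1 +++ \<gamma>2) has_integral L1) {0..1/2}"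
    by (rule has_integral_spike_finite[OF fin1 eq1 I1])
  have I2: "((\<lambda>t. 2 * ?f \<gamma>2 (2 * t - 1)) has_integral L2) {1/2..1}"
    using has_integral_mult_right[OF I(2)[of 2 "-1"], of 2]
    by (simp add: image_affinity_atLeastAtMost_div)
  have eq2: "?f (\<gamma>1 +++ \<gamma>2) t = 2 * ?f \<gamma>2 (2 * t - 1)"
    if "t \<in> {1/2..1} - insert (1/2) ((\<lambda>t. 2 * t - 1) -` S2)" for t
  proof -
    have t: "t \<le> 1" "1/2 < t" "2 * t - 1 \<notin> S2"
      using that by (auto simp: less_le)
    have "(\<gamma>2 has_vector_derivative vector_derivative \<gamma>2 (at (2 * t - 1))) (at (2 * t - 1))"
      using S2 t by (auto simp: vector_derivative_works)
    moreover have "((\<lambda>t. 2 * t - 1) has_vector_derivative 2) (at t)"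
      by (auto intro!: derivative_eq_intros)
    ultimately have "((\<lambda>t. \<gamma>2 (2 * t - 1)) has_vector_derivative
        2 *\<^sub>R vector_derivative \<gamma>2 (at (2 * t - 1))) (at t)"
      by (intro vector_diff_chain_at[simplified o_def])
    then have "((\<gamma>1 +++ \<gamma>2) has_vector_derivative 2 *\<^sub>R vector_derivative \<gamma>2 (at (2 * t - 1))) (at t)"
      by (rule has_vector_derivative_transform_within_open[of _ _ _ "{1/2<..}"])
        (use t in \<open>auto simp: joinpaths_def\<close>)
    from vector_derivative_at[OF this] show ?thesis
      using t rnorm_scale[of _ 2] by (simp add: joinpaths_def)
  qed
  have fin2: "finite (insert (1/2) ((\<lambda>t. 2 * t - 1) -` S2))"
    using S2(1) by (simp add: finite_vimageI inj_def)
  have J2: "(?f (\<gamma>1 +++ \<gamma>2) has_integral L2) {1/2..1}"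
    by (rule has_integral_spike_finite[OF fin2 eq2 I2])
  have "(?f (\<gamma>1 +++ \<gamma>2) has_integral L1 + L2) {0..1}"
    by (rule has_integral_combine[OF _ _ J1 J2]) auto
  then show ?thesis
    using assms by (auto simp: curve_length_def valid_path_join)
qed

lemma curve_length_linepath:
  assumes "\<And>z v. z \<in> closed_segment x y \<Longrightarrow> rnorm g z v \<le> C * norm v"
  shows "\<exists>L. curve_length g (linepath x y) L \<and> L \<le> C * norm (x - y)"
proof -
  let ?f = "\<lambda>t. rnorm g (linepath x y t) (vector_derivative (linepath x y) (at t))"
  have "continuous_on {0..1} ?f"
    unfolding rnorm_def vector_derivative_linepath_at
    by (intro continuous_intros continuous_on_metric)
  then have I: "(?f has_integral integral {0..1} ?f) {0..1}"
    by (intro integrable_integral integrable_continuous_real)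
  moreover have "integral {0..1} ?f \<le> C * norm (x - y)"
  proof (rule has_integral_le[OF I])
    show "((\<lambda>_. C * norm (x - y)) has_integral C * norm (x - y)) {0..1::real}"
      using has_integral_const_real[of "C * norm (x - y)" 0 1] by simp
    show "?f t \<le> C * norm (x - y)" if "t \<in> {0..1}" for t
      using assms[OF linepath_in_path[OF that], of "y - x"]
      by (simp add: vector_derivative_linepath_at norm_minus_commute)
  qed
  ultimately show ?thesis
    by (auto simp: curve_length_def valid_path_linepath)
qed

section \<open>The Riemannian distance as a metric\<close>

lemma riemannian_dist_le:
  "curve_length g \<gamma> L \<Longrightarrow> pathstart \<gamma> = x \<Longrightarrow> pathfinish \<gamma> = y \<Longrightarrow> riemannian_dist g x y \<le> L"
  unfolding riemannian_dist_altdef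
  by (rule cInf_lower) (use bdd_below_lengths in \<open>auto simp: conj_assoc\<close>)

lemma riemannian_dist_le_norm:
  assumes "compact K"
  shows "\<exists>C>0. \<forall>x y. closed_segment x y \<subseteq> K \<longrightarrow> riemannian_dist g x y \<le> C * norm (x - y)"
proof -
  obtain C where "C > 0" "\<forall>x\<in>K. \<forall>v. rnorm g x v \<le> C * norm v"
    using rnorm_bounds_compact[OF assms] by meson
  moreover from this have "riemannian_dist g x y \<le> C * norm (x - y)" if xy: "closed_segment x y \<subseteq> K" for x y
  proof -
    obtain L where "curve_length g (linepath x y) L" "L \<le> C * norm (x - y)"
      using curve_length_linepath[of x y C] calculation xy by blast
    then show ?thesis using riemannian_dist_le[of "linepath x y" L x y] by auto
  qed
  ultimately show ?thesis by blast
qed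

lemma curve_exists: "\<exists>\<gamma> L. curve_length g \<gamma> L \<and> pathstart \<gamma> = x \<and> pathfinish \<gamma> = y"
proof -
  obtain C where "\<forall>z\<in>closed_segment x y. \<forall>v. rnorm g z v \<le> C * norm v"
    using rnorm_bounds_compact[OF compact_segment] by meson
  then show ?thesis
    using curve_length_linepath[of x y C] by (metis pathstart_linepath pathfinish_linepath)
qed

lemma near_optimal_curve:
  assumes "riemannian_dist g x y < L"
  shows "\<exists>\<gamma> L'. curve_length g \<gamma> L' \<and> pathstart \<gamma> = x \<and> pathfinish \<gamma> = y \<and> L' < L"
  using assms cInf_lessD[of "{L. \<exists>\<gamma>. curve_length g \<gamma> L \<and> pathstart \<gamma> = x \<and> pathfinish \<gamma> = y}" L]
    curve_exists[of x y]
  unfolding riemannian_dist_altdef by blast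

lemma riemannian_dist_nonneg: "riemannian_dist g x y \<ge> 0"
  unfolding riemannian_dist_altdef
  by (rule cInf_greatest) (use curve_exists[of x y] curve_length_nonneg in auto)

lemma riemannian_dist_sym: "riemannian_dist g x y = riemannian_dist g y x"
proof -
  have "{L. \<exists>\<gamma>. curve_length g \<gamma> L \<and> pathstart \<gamma> = x \<and> pathfinish \<gamma> = y}
      \<subseteq> {L. \<exists>\<gamma>. curve_length g \<gamma> L \<and> pathstart \<gamma> = y \<and> pathfinish \<gamma> = x}" for x y
    using curve_length_reversepath pathfinish_reversepath pathstart_reversepath by blast
  from subset_antisym[OF this[of x y] this[of y x]] show ?thesis
    unfolding riemannian_dist_altdef by (rule arg_cong)
qed

lemma riemannian_dist_triangle:
  "riemannian_dist g x z \<le> riemannian_dist g x y + riemannian_dist g y z"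
proof (rule field_le_epsilon)
  fix e :: real assume "e > 0"
  then obtain \<gamma>1 L1 \<gamma>2 L2 where
    1: "curve_length g \<gamma>1 L1" "pathstart \<gamma>1 = x" "pathfinish \<gamma>1 = y" "L1 < riemannian_dist g x y + e / 2" and
    2: "curve_length g \<gamma>2 L2" "pathstart \<gamma>2 = y" "pathfinish \<gamma>2 = z" "L2 < riemannian_dist g y z + e / 2"
    using near_optimal_curve[of x y "riemannian_dist g x y + e / 2"]
      near_optimal_curve[of y z "riemannian_dist g y z + e / 2"] by auto
  have "riemannian_dist g x z \<le> L1 + L2"
    using 1 2 by (intro riemannian_dist_le[OF curve_length_join]) auto
  then show "riemannian_dist g x z \<le> riemannian_dist g x y + riemannian_dist g y z + e"
    using 1 2 by linarith
qed

text \<open>Instead of cutting a curve where it leaves the ball of radius \<open>r\<close> around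
  \<open>x\<close>, the proof follows a function \<open>h\<close> that vanishes outside this ball;
  the square makes the truncation \<open>m\<close> differentiable. Along a curve from
  \<open>x\<close> to \<open>y\<close>, \<open>h\<close> falls from \<open>r ^ 4\<close> to
  \<open>0\<close>, and its slope is at most \<open>4 * r ^ 3 / c\<close> times the Riemannian norm,
  so the length is at least \<open>c * r / 4\<close>.\<close>

lemma riemannian_dist_pos:
  assumes "x \<noteq> y" shows "riemannian_dist g x y > 0"
proof -
  define r where "r = norm (x - y)"
  have "r > 0" using assms by (simp add: r_def)
  obtain c where c: "c > 0" "\<forall>z\<in>cball x r. \<forall>v. c * norm v \<le> rnorm g z v"
    using rnorm_bounds_compact[OF compact_cball] by meson
  define m where "m u = max 0 u" for u :: real
  define h where "h z = (m (r\<^sup>2 - (z - x) \<bullet> (z - x)))\<^sup>2" for z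
  define h' where "h' z v = - 4 * m (r\<^sup>2 - (z - x) \<bullet> (z - x)) * ((z - x) \<bullet> v)" for z v
  have m: "((\<lambda>u. (m u)\<^sup>2) has_real_derivative 2 * m u) (at u)" for u
  proof (cases u "0::real" rule: linorder_cases)
    case less
    show ?thesis
      by (rule has_field_derivative_transform_within_open[of "\<lambda>_. 0" _ _ "{..<0}"])
        (use less in \<open>auto simp: m_def\<close>)
  next
    case greater
    have "((\<lambda>u. u\<^sup>2) has_real_derivative 2 * m u) (at u)"
      using greater by (auto intro!: derivative_eq_intros simp: m_def)
    then show ?thesis
      by (rule has_field_derivative_transform_within_open[of _ _ _ "{0<..}"])
        (use greater in \<open>auto simp: m_def\<close>)
  next
    case equal
    have "((\<lambda>u. (m u)\<^sup>2 / u) \<longlongrightarrow> 0) (at 0)"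
    proof (rule Lim_null_comparison)
      show "\<forall>\<^sub>F u in at 0. norm ((m u)\<^sup>2 / u) \<le> \<bar>u\<bar>"
        by (auto simp: eventually_at_filter m_def power2_eq_square max_def)
      show "((\<lambda>u. \<bar>u\<bar>) \<longlongrightarrow> 0) (at (0::real))"
        by (intro tendsto_eq_intros) auto
    qed
    then show ?thesis
      using equal by (simp add: has_field_derivative_iff m_def)
  qed
  have der: "(h has_derivative h' z) (at z)" for z
  proof -
    have 1: "((\<lambda>z. r\<^sup>2 - (z - x) \<bullet> (z - x)) has_derivative (\<lambda>v. - 2 * ((z - x) \<bullet> v))) (at z)"
      by (auto intro!: derivative_eq_intros simp: inner_commute)
    from has_derivative_compose[OF 1 m[unfolded has_field_derivative_def]]
    show ?thesis unfolding h_def h'_def by (simp add: algebra_simps)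
  qed
  have bound: "norm (h' z w) \<le> (4 * r ^ 3 / c) * rnorm g z w" for z w
  proof (cases "norm (z - x) \<le> r")
    case True
    have "m (r\<^sup>2 - (z - x) \<bullet> (z - x)) \<le> r\<^sup>2" "m (r\<^sup>2 - (z - x) \<bullet> (z - x)) \<ge> 0"
      by (auto simp: m_def)
    moreover have "\<bar>(z - x) \<bullet> w\<bar> \<le> r * norm w"
      using Cauchy_Schwarz_ineq2[of "z - x" w] True mult_right_mono[OF True norm_ge_zero[of w]] by linarith
    ultimately have "m (r\<^sup>2 - (z - x) \<bullet> (z - x)) * \<bar>(z - x) \<bullet> w\<bar> \<le> r\<^sup>2 * (r * norm w)"
      by (intro mult_mono) auto
    moreover have "norm (h' z w) = 4 * (m (r\<^sup>2 - (z - x) \<bullet> (z - x)) * \<bar>(z - x) \<bullet> w\<bar>)"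
      using \<open>0 \<le> m _\<close> by (simp add: h'_def abs_mult)
    ultimately have "norm (h' z w) \<le> 4 * (r\<^sup>2 * (r * norm w))" by simp
    then have "norm (h' z w) \<le> 4 * r ^ 3 * norm w"
      by (simp add: power2_eq_square power3_eq_cube mult.assoc)
    also have "norm w \<le> rnorm g z w / c"
      using c True by (auto simp: field_simps dist_norm norm_minus_commute)
    then have "4 * r ^ 3 * norm w \<le> 4 * r ^ 3 * (rnorm g z w / c)"
      using \<open>r > 0\<close> by (intro mult_left_mono) auto
    finally show ?thesis by simp
  next
    case False
    then have "r\<^sup>2 \<le> (norm (z - x))\<^sup>2" using \<open>r > 0\<close> by (intro power_mono) auto
    then have "h' z w = 0" by (simp add: h'_def m_def power2_norm_eq_inner)
    then show ?thesis using \<open>r > 0\<close> \<open>c > 0\<close> rnorm_nonneg by simp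
  qed
  have "c * r / 4 \<le> L" if "curve_length g \<gamma> L" "pathstart \<gamma> = x" "pathfinish \<gamma> = y" for \<gamma> L
  proof -
    have "norm (h (\<gamma> 1) - h (\<gamma> 0)) \<le> 4 * r ^ 3 / c * L"
      by (rule curve_length_bound[OF that(1) der bound]) (use \<open>r > 0\<close> \<open>c > 0\<close> in auto)
    moreover have "h (\<gamma> 0) = r ^ 4"
      using that by (simp add: pathstart_def h_def m_def flip: power_mult)
    moreover have "h (\<gamma> 1) = 0"
      using that by (simp add: pathfinish_def h_def m_def r_def norm_minus_commute
          flip: power2_norm_eq_inner)
    ultimately have "r ^ 4 \<le> 4 * r ^ 3 / c * L" by simp
    then have "r ^ 3 * (c * r) \<le> r ^ 3 * (4 * L)"
      using \<open>c > 0\<close> by (simp add: field_simps power_def eval_nat_numeral)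
    then show ?thesis
      using \<open>r > 0\<close> by simp
  qed
  then have "c * r / 4 \<le> riemannian_dist g x y"
    unfolding riemannian_dist_altdef using curve_exists[of x y] by (intro cInf_greatest) auto
  then show ?thesis using \<open>c > 0\<close> \<open>r > 0\<close> by (smt (verit) divide_pos_pos mult_pos_pos)
qed

lemma riemannian_dist_refl: "riemannian_dist g x x = 0"
proof -
  obtain C where "\<forall>u v. closed_segment u v \<subseteq> {x} \<longrightarrow> riemannian_dist g u v \<le> C * norm (u - v)"
    using riemannian_dist_le_norm[of "{x}"] by auto
  then have "riemannian_dist g x x \<le> C * norm (x - x)"
    by (metis closed_segment_idem subset_refl)
  then show ?thesis using riemannian_dist_nonneg[of x x] by simp
qed

lemma Metric_space_riemannian_dist: "Metric_space UNIV (riemannian_dist g)"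
proof
  show "riemannian_dist g x y = 0 \<longleftrightarrow> x = y" for x y
    using riemannian_dist_pos[of x y] riemannian_dist_refl by force
qed (rule riemannian_dist_nonneg riemannian_dist_sym riemannian_dist_triangle)+

text \<open>One direction of Hopf-Rinow. A Cauchy sequence stays in a ball, so a subsequence
  converges in the Euclidean sense; near its limit the Riemannian distance is at most a multiple of
  the Euclidean one, so the subsequence also converges in the metric, and the Cauchy sequence with
  it.\<close>

lemma complete_riemannian_metricI:
  assumes "\<And>R. bounded {y. riemannian_dist g 0 y \<le> R}"
  shows "complete_riemannian_metric g"
proof -
  interpret Metric_space UNIV "riemannian_dist g"
    by (rule Metric_space_riemannian_dist)
  have "\<exists>l. limitin mtopology s l sequentially" if s: "MCauchy s" for s
  proof -
    obtain R where R: "\<And>n. riemannian_dist g 0 (s n) \<le> R"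
    proof -
      obtain c B where "range s \<subseteq> mcball c B"
        using MCauchy_imp_mbounded[OF s] unfolding mbounded_def by blast
      then have "riemannian_dist g 0 (s n) \<le> riemannian_dist g 0 c + B" for n
      proof -
        have "s n \<in> mcball c B" using \<open>range s \<subseteq> mcball c B\<close> by blast
        then show ?thesis using triangle[of 0 c "s n"] by simp
      qed
      then show ?thesis by (rule that)
    qed
    have "compact (closure {y. riemannian_dist g 0 y \<le> R})"
      using assms[of R] by (simp add: compact_closure)
    moreover have "\<forall>n. s n \<in> closure {y. riemannian_dist g 0 y \<le> R}"
      using R closure_subset by (metis (mono_tags) in_mono mem_Collect_eq)
    ultimately obtain l r where r: "strict_mono r" "(s \<circ> r) \<longlonglongrightarrow> l"
      unfolding compact_def by metis
    obtain C where C: "C > 0"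
      "\<forall>x y. closed_segment x y \<subseteq> cball l 1 \<longrightarrow> riemannian_dist g x y \<le> C * norm (x - y)"
      using riemannian_dist_le_norm[OF compact_cball, of l 1] by blast
    have "limitin mtopology (s \<circ> r) l sequentially"
      unfolding limit_metric_sequentially
    proof (intro conjI allI impI)
      fix e :: real assume "e > 0"
      have "\<forall>\<^sub>F n in sequentially. dist ((s \<circ> r) n) l < min 1 (e / C)"
        using \<open>e > 0\<close> \<open>C > 0\<close> by (intro tendstoD[OF r(2)]) simp
      then obtain N where N: "\<And>n. n \<ge> N \<Longrightarrow> dist ((s \<circ> r) n) l < min 1 (e / C)"
        by (auto simp: eventually_sequentially)
      have "riemannian_dist g ((s \<circ> r) n) l < e" if "n \<ge> N" for n
      proof -
        have "closed_segment ((s \<circ> r) n) l \<subseteq> cball l 1"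
          using N[OF that] by (intro closed_segment_subset) (auto simp: dist_commute)
        then have "riemannian_dist g ((s \<circ> r) n) l \<le> C * norm ((s \<circ> r) n - l)"
          using C by blast
        also have "\<dots> < e"
          using N[OF that] \<open>C > 0\<close> by (simp add: dist_norm field_simps)
        finally show ?thesis .
      qed
      then show "\<exists>N. \<forall>n\<ge>N. (s \<circ> r) n \<in> UNIV \<and> riemannian_dist g ((s \<circ> r) n) l < e"
        by auto
    qed auto
    then show ?thesis
      using MCauchy_convergent_subsequence[OF s r(1)] by blast
  qed
  then show ?thesis
    using g by (auto simp: complete_riemannian_metric_def mcomplete_def)
qed

text \<open>
  The bound on the slope of \<open>\<psi>\<close> confines curves of bounded length to a sublevel set of \<open>\<psi>\<close>, where
  the metric dominates the Euclidean one; so metric balls are bounded.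
\<close>

lemma complete_riemannian_metric_barrier:
  fixes \<psi> :: "'a \<Rightarrow> real"
  assumes der: "\<And>x. (\<psi> has_derivative \<psi>' x) (at x)"
    and slope: "\<And>x w. \<bar>\<psi>' x w\<bar> \<le> K * rnorm g x w" and "K \<ge> 0"
    and sublevel: "\<And>T. \<exists>c>0. \<forall>x w. \<bar>\<psi> x\<bar> \<le> T \<longrightarrow> c * norm w \<le> rnorm g x w"
  shows "complete_riemannian_metric g"
proof (rule complete_riemannian_metricI)
  fix R
  \<comment> \<open>The extra \<open>1\<close> is room for a curve that only nearly realises the
    distance.\<close>
  define T where "T = \<bar>\<psi> 0\<bar> + K * (\<bar>R\<bar> + 1)"
  obtain c where c: "c > 0" "\<And>x w. \<bar>\<psi> x\<bar> \<le> T \<Longrightarrow> c * norm w \<le> rnorm g x w"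
    using sublevel by blast
  have "norm y \<le> (\<bar>R\<bar> + 1) / c" if y: "riemannian_dist g 0 y \<le> R" for y
  proof -
    have "riemannian_dist g 0 y < \<bar>R\<bar> + 1" using y by linarith
    then obtain \<gamma> L where \<gamma>: "curve_length g \<gamma> L" "pathstart \<gamma> = 0" "pathfinish \<gamma> = y" "L < \<bar>R\<bar> + 1"
      using near_optimal_curve by blast
    have "\<bar>\<psi> (\<gamma> t)\<bar> \<le> T" if "t \<in> {0..1}" for t
    proof -
      have "norm (\<psi> (\<gamma> t) - \<psi> (\<gamma> 0)) \<le> K * L"
        by (rule curve_length_bound[OF \<gamma>(1) der _ \<open>K \<ge> 0\<close> that]) (simp add: slope)
      also have "\<dots> \<le> K * (\<bar>R\<bar> + 1)"
        using \<gamma>(4) \<open>K \<ge> 0\<close> by (intro mult_left_mono) auto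
      finally show ?thesis
        using \<gamma>(2) by (simp add: T_def pathstart_def)
    qed
    then have "norm w \<le> (1 / c) * rnorm g (\<gamma> t) w" if "t \<in> {0..1}" for t w
      using c(2)[of "\<gamma> t" w] that c(1) by (simp add: field_simps)
    then have "norm (\<gamma> 1 - \<gamma> 0) \<le> (1 / c) * L"
      using curve_length_bound[OF \<gamma>(1) has_derivative_ident, of "1 / c" 1] c(1) by simp
    then have "norm y \<le> L / c"
      using \<gamma> by (simp add: pathstart_def pathfinish_def)
    also have "\<dots> \<le> (\<bar>R\<bar> + 1) / c"
      using \<gamma>(4) c(1) by (intro divide_right_mono) auto
    finally show ?thesis .
  qed
  then show "bounded {y. riemannian_dist g 0 y \<le> R}"
    unfolding bounded_iff by blast
qed

end

section \<open>Hyperbolic matrices\<close>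

text \<open>For linear \<open>T\<close> in finite dimension this is the sum of the generalised
  eigenspaces inside the open unit disc. Decay, unlike eigenvectors, makes sense directly for real
  matrices. Applied to the inverse map the definition yields the unstable space.\<close>

definition exp_stable :: "('a::real_normed_vector \<Rightarrow> 'a) \<Rightarrow> 'a set" where
  "exp_stable T = {x. \<exists>C r. 0 < r \<and> r < 1 \<and> (\<forall>m. norm ((T ^^ m) x) \<le> C * r ^ m)}"

lemma linear_funpow: "linear T \<Longrightarrow> linear (T ^^ m)" for T :: "'a::real_vector \<Rightarrow> 'a"
  by (induction m) (auto intro: linear_compose linear_id)

lemma exp_stableI:
  "0 < r \<Longrightarrow> r < 1 \<Longrightarrow> (\<And>m. norm ((T ^^ m) x) \<le> C * r ^ m) \<Longrightarrow> x \<in> exp_stable T"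
  unfolding exp_stable_def by blast

lemma exp_stable_tendsto_0:
  assumes "x \<in> exp_stable T"
  shows "(\<lambda>m. norm ((T ^^ m) x)) \<longlonglongrightarrow> 0"
proof -
  obtain C r where *: "0 < r" "r < 1" "\<And>m. norm ((T ^^ m) x) \<le> C * r ^ m"
    using assms unfolding exp_stable_def by blast
  have "(\<lambda>m. C * r ^ m) \<longlonglongrightarrow> 0"
    using tendsto_mult_left[OF LIMSEQ_power_zero[of r], of C] * by simp
  then show ?thesis
    by (rule Lim_null_comparison[rotated]) (use * in auto)
qed

lemma subspace_exp_stable:
  assumes "linear T" shows "subspace (exp_stable T)"
proof (rule subspaceI)
  note lin = linear_funpow[OF assms]
  show "0 \<in> exp_stable T"
    by (rule exp_stableI[of "1/2" _ _ 0]) (auto simp: linear_0[OF lin])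
  fix x y assume "x \<in> exp_stable T" "y \<in> exp_stable T"
  then obtain C r D s where *: "0 < r" "r < 1" "\<And>m. norm ((T ^^ m) x) \<le> C * r ^ m"
     "0 < s" "s < 1" "\<And>m. norm ((T ^^ m) y) \<le> D * s ^ m"
    unfolding exp_stable_def by blast
  from *(3)[of 0] *(6)[of 0] have CD: "C \<ge> 0" "D \<ge> 0"
    using order_trans[OF norm_ge_zero] by auto
  show "x + y \<in> exp_stable T"
  proof (rule exp_stableI[of "max r s"])
    fix m
    have "norm ((T ^^ m) (x + y)) \<le> norm ((T ^^ m) x) + norm ((T ^^ m) y)"
      by (simp add: linear_add[OF lin] norm_triangle_ineq)
    also have "\<dots> \<le> C * r ^ m + D * s ^ m" using * by (intro add_mono)
    also have "\<dots> \<le> C * max r s ^ m + D * max r s ^ m"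
      using * CD by (intro add_mono mult_left_mono power_mono) auto
    finally show "norm ((T ^^ m) (x + y)) \<le> (C + D) * max r s ^ m"
      by (simp add: distrib_right)
  qed (use * in auto)
next
  note lin = linear_funpow[OF assms]
  fix c :: real and x assume "x \<in> exp_stable T"
  then obtain C r where *: "0 < r" "r < 1" "\<And>m. norm ((T ^^ m) x) \<le> C * r ^ m"
    unfolding exp_stable_def by blast
  show "c *\<^sub>R x \<in> exp_stable T"
    by (rule exp_stableI[OF *(1,2), of _ _ "\<bar>c\<bar> * C"])
      (use *(3) in \<open>auto simp: linear_scale[OF lin] mult.assoc intro: mult_left_mono\<close>)
qed

lemma exp_stable_forward:
  assumes "x \<in> exp_stable T" shows "T x \<in> exp_stable T"
proof -
  obtain C r where *: "0 < r" "r < 1" "\<And>m. norm ((T ^^ m) x) \<le> C * r ^ m"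
    using assms unfolding exp_stable_def by blast
  then show ?thesis
    by (intro exp_stableI[OF *(1,2), of _ _ "C * r"])
      (metis funpow_swap1 funpow.simps(2) comp_apply mult.assoc power_Suc)
qed

lemma exp_stable_backward:
  assumes "T x \<in> exp_stable T" shows "x \<in> exp_stable T"
proof -
  obtain C r where *: "0 < r" "r < 1" "\<And>m. norm ((T ^^ m) (T x)) \<le> C * r ^ m"
    using assms unfolding exp_stable_def by blast
  show ?thesis
  proof (rule exp_stableI[OF *(1,2), of _ _ "max (norm x) (C / r)"])
    fix m show "norm ((T ^^ m) x) \<le> max (norm x) (C / r) * r ^ m"
    proof (cases m)
      case (Suc k)
      have "norm ((T ^^ m) x) \<le> C * r ^ k"
        using *(3)[of k] by (simp add: Suc funpow_swap1)
      also have "\<dots> = (C / r) * r ^ m" using *(1) by (simp add: Suc)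
      also have "\<dots> \<le> max (norm x) (C / r) * r ^ m"
        using *(1) by (intro mult_right_mono) auto
      finally show ?thesis .
    qed auto
  qed
qed

text \<open>The constants may depend on the vector, but an orthonormal basis of the stable space has
  only finitely many: take the largest rate and add up the constants.\<close>

lemma exp_stable_uniform:
  fixes T :: "'a::euclidean_space \<Rightarrow> 'a"
  assumes "linear T"
  shows "\<exists>C\<ge>1. \<exists>r. 0 < r \<and> r < 1 \<and> (\<forall>x\<in>exp_stable T. \<forall>m. norm ((T ^^ m) x) \<le> C * r ^ m * norm x)"
proof -
  obtain B where B: "B \<subseteq> exp_stable T" "pairwise orthogonal B" "\<And>x. x \<in> B \<Longrightarrow> norm x = 1"
      "independent B" "span B = exp_stable T"
    using orthonormal_basis_subspace[OF subspace_exp_stable[OF assms]] by metis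
  have fin: "finite B" using B(4) by (rule finiteI_independent)
  have "\<forall>b\<in>B. \<exists>C r. 0 < r \<and> r < 1 \<and> (\<forall>m. norm ((T ^^ m) b) \<le> C * r ^ m)"
    using B(1) unfolding exp_stable_def by blast
  then obtain C r where Cr: "\<And>b. b \<in> B \<Longrightarrow> 0 < r b \<and> r b < 1 \<and> (\<forall>m. norm ((T ^^ m) b) \<le> C b * r b ^ m)"
    by metis
  \<comment> \<open>The element \<open>1/2\<close> keeps the maximum defined when the stable space
    is trivial.\<close>
  define \<rho> where "\<rho> = Max (insert (1/2) (r ` B))"
  have \<rho>: "0 < \<rho>" "\<rho> < 1"
    using fin Cr by (auto simp: \<rho>_def Max_gr_iff)
  have r\<rho>: "r b \<le> \<rho>" if "b \<in> B" for b
    using fin that by (auto simp: \<rho>_def)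
  have C0: "C b \<ge> 0" if "b \<in> B" for b
    using Cr[OF that] norm_ge_zero[of b] by (metis funpow_0 mult.right_neutral order_trans power_0)
  have "norm ((T ^^ m) x) \<le> (1 + sum C B) * \<rho> ^ m * norm x" if "x \<in> exp_stable T" for x m
  proof -
    have x: "x = (\<Sum>b\<in>B. (x \<bullet> b) *\<^sub>R b)"
      using orthonormal_basis_expand[of B x] B fin that by auto
    have "(T ^^ m) x = (\<Sum>b\<in>B. (x \<bullet> b) *\<^sub>R (T ^^ m) b)"
      by (subst x) (simp add: linear_sum[OF linear_funpow[OF assms]] linear_scale[OF linear_funpow[OF assms]])
    also have "norm \<dots> \<le> (\<Sum>b\<in>B. norm x * (C b * \<rho> ^ m))"
    proof (rule sum_norm_le)
      fix b assume b: "b \<in> B"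
      have "\<bar>x \<bullet> b\<bar> \<le> norm x"
        using Cauchy_Schwarz_ineq2[of x b] B(3)[OF b] by simp
      moreover have "norm ((T ^^ m) b) \<le> C b * \<rho> ^ m"
      proof -
        have "C b * r b ^ m \<le> C b * \<rho> ^ m"
          using Cr[OF b] r\<rho>[OF b] C0[OF b] by (intro mult_left_mono power_mono) auto
        then show ?thesis using Cr[OF b] by (meson order_trans)
      qed
      ultimately show "norm ((x \<bullet> b) *\<^sub>R (T ^^ m) b) \<le> norm x * (C b * \<rho> ^ m)"
        by (simp add: mult_mono)
    qed
    also have "\<dots> = sum C B * \<rho> ^ m * norm x"
      by (simp add: sum_distrib_left sum_distrib_right mult_ac)
    also have "\<dots> \<le> (1 + sum C B) * \<rho> ^ m * norm x"
      using \<rho> by (intro mult_right_mono) auto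
    finally show ?thesis .
  qed
  moreover have "1 + sum C B \<ge> 1" using C0 by (simp add: sum_nonneg)
  ultimately show ?thesis using \<rho> by blast
qed

lemma linear_inj_on_subspace_surj:
  fixes L :: "'a::euclidean_space \<Rightarrow> 'a"
  assumes "linear L" "subspace V" "L ` V \<subseteq> V" "\<And>x. x \<in> V \<Longrightarrow> L x = 0 \<Longrightarrow> x = 0"
  shows "L ` V = V"
proof -
  have "inj_on L (span V)"
    using assms(4) linear_inj_on_iff_eq_0[OF assms(1) assms(2)] assms(2) by (simp add: span_eq_iff[THEN iffD2])
  then have "dim (L ` V) = dim V"
    by (rule dim_image_eq[OF assms(1)])
  then show ?thesis
    using subspace_dim_equal[OF linear_subspace_image[OF assms(1,2)] assms(2,3)] by simp
qed

section \<open>Eigenvectors and annihilating polynomials of complex linear maps\<close>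

lemma norm_vector_smult: "norm (c *s x) = cmod c * norm x" for x :: "complex^'n::finite"
  by (simp add: norm_vec_def norm_mult L2_set_right_distrib)

lemma scaleR_eq_smult: "a *\<^sub>R x = complex_of_real a *s x" for x :: "complex^'n::finite"
  by (simp add: vec_eq_iff scaleR_conv_of_real[symmetric])

lemma smult_diff: "c *s (x - y) = c *s x - c *s y" for x :: "complex^'n::finite"
  by (simp add: vec_eq_iff algebra_simps)

lemma exp_stable_smult:
  fixes T :: "complex^'n::finite \<Rightarrow> complex^'n"
  assumes "\<And>c x. T (c *s x) = c *s T x" "x \<in> exp_stable T"
  shows "c *s x \<in> exp_stable T"
proof -
  obtain C r where *: "0 < r" "r < 1" "\<And>m. norm ((T ^^ m) x) \<le> C * r ^ m"
    using assms(2) unfolding exp_stable_def by blast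
  have "(T ^^ m) (c *s x) = c *s (T ^^ m) x" for m
    by (induction m) (auto simp: assms(1))
  then show ?thesis
    by (intro exp_stableI[OF *(1,2), of _ _ "cmod c * C"])
      (use *(3) in \<open>auto simp: norm_vector_smult mult.assoc intro: mult_left_mono\<close>)
qed

lemma eigenvector_exp_stable:
  fixes T :: "complex^'n::finite \<Rightarrow> complex^'n"
  assumes "\<And>c x. T (c *s x) = c *s T x" "x \<in> exp_stable T" "T x = l *s x" "cmod l \<ge> 1"
  shows "x = 0"
proof -
  have "(T ^^ m) x = l ^ m *s x" for m
    by (induction m) (auto simp: assms(1,3) vector_smult_assoc mult.commute)
  then have "norm x \<le> norm ((T ^^ m) x)" for m
    using mult_right_mono[OF one_le_power[OF assms(4), of m] norm_ge_zero[of x]]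
    by (simp add: norm_vector_smult norm_power)
  then have "norm x \<le> 0"
    by (intro LIMSEQ_le_const[OF exp_stable_tendsto_0[OF assms(2)]]) auto
  then show ?thesis by simp
qed

text \<open>The norms \<open>a m\<close> of the iterates of \<open>z\<close> satisfy
  \<open>a (m + 1) \<le> cmod l * a m + C * r ^ m\<close>, and such a recursion decays at any rate
  above both \<open>r\<close> and \<open>cmod l\<close>.\<close>

lemma exp_stable_perturbed_eigenvector:
  fixes T :: "complex^'n::finite \<Rightarrow> complex^'n"
  assumes "linear T" "\<And>c x. T (c *s x) = c *s T x"
    and "s \<in> exp_stable T" "T z = l *s z + s" "cmod l < 1"
  shows "z \<in> exp_stable T"
proof -
  obtain C r where *: "0 < r" "r < 1" "\<And>m. norm ((T ^^ m) s) \<le> C * r ^ m"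
    using assms(3) unfolding exp_stable_def by blast
  \<comment> \<open>Strictly above both rates, so that the estimate also closes in the resonant case
    \<open>r = cmod l\<close>, where a factor \<open>m\<close> appears.\<close>
  obtain \<rho> where \<rho>: "max r (cmod l) < \<rho>" "\<rho> < 1"
    using dense[of "max r (cmod l)" 1] * assms(5) by auto
  have C: "C \<ge> 0" using *(3)[of 0] order_trans[OF norm_ge_zero] by auto
  \<comment> \<open>The smallest \<open>K\<close> for which the induction works: the first entry
    starts it, the second gives its step \<open>cmod l * K + C \<le> K * \<rho>\<close>.\<close>
  define K where "K = max (norm z) (C / (\<rho> - cmod l))"
  have K: "cmod l * K + C \<le> K * \<rho>"
  proof -
    have "C / (\<rho> - cmod l) * (\<rho> - cmod l) \<le> K * (\<rho> - cmod l)"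
      using \<rho> by (intro mult_right_mono) (auto simp: K_def)
    moreover have "C / (\<rho> - cmod l) * (\<rho> - cmod l) = C" using \<rho> by simp
    ultimately show ?thesis by (simp add: algebra_simps)
  qed
  have "norm ((T ^^ m) z) \<le> K * \<rho> ^ m" for m
  proof (induction m)
    case 0 show ?case by (simp add: K_def)
  next
    case (Suc m)
    have sm: "(T ^^ m) (c *s x) = c *s (T ^^ m) x" for c x
      by (induction m) (auto simp: assms(2))
    have "(T ^^ Suc m) z = (T ^^ m) (T z)" by (simp add: funpow_swap1)
    also have "\<dots> = l *s (T ^^ m) z + (T ^^ m) s"
      by (simp add: assms(4) linear_add[OF linear_funpow[OF assms(1)]] sm)
    also have "norm \<dots> \<le> cmod l * (K * \<rho> ^ m) + C * \<rho> ^ m"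
    proof (rule order_trans[OF norm_triangle_ineq add_mono])
      show "norm (l *s (T ^^ m) z) \<le> cmod l * (K * \<rho> ^ m)"
        using Suc by (simp add: norm_vector_smult mult_left_mono)
      have "C * r ^ m \<le> C * \<rho> ^ m" using C *(1) \<rho> by (intro mult_left_mono power_mono) auto
      then show "norm ((T ^^ m) s) \<le> C * \<rho> ^ m" using *(3)[of m] by linarith
    qed
    also have "\<dots> = (cmod l * K + C) * \<rho> ^ m" by (simp add: algebra_simps)
    also have "\<dots> \<le> K * \<rho> * \<rho> ^ m"
      using K \<rho> *(1) by (intro mult_right_mono) auto
    finally show ?case by (simp add: mult.assoc)
  qed
  then show ?thesis using \<rho> *(1) by (intro exp_stableI[of \<rho>]) auto
qed

text \<open>Sufficiently many iterates of \<open>x\<close> are linearly dependent, so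
  \<open>q(T) x = 0\<close> for some nonzero polynomial \<open>q\<close>, which splits into linear
  factors over the complex numbers. The list makes inductions possible that remove one factor
  \<open>T - l\<close> at a time, in place of a decomposition into generalised eigenspaces.\<close>

lemma annihilating_factors:
  fixes T :: "complex^'n::finite \<Rightarrow> complex^'n"
  assumes lin: "linear T" and sm: "\<And>c x. T (c *s x) = c *s T x"
  shows "\<exists>ls. fold (\<lambda>l y. T y - l *s y) ls x = 0"
proof -
  note lin' = linear_funpow[OF lin]
  \<comment> \<open>\<open>act q x\<close> is \<open>q(T) x\<close>.\<close>
  define act where "act q x = (\<Sum>i\<le>degree q. coeff q i *s (T ^^ i) x)" for q x
  have act_eq: "act q x = (\<Sum>i\<le>N. coeff q i *s (T ^^ i) x)" if "degree q \<le> N" for q x N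
    unfolding act_def using that
    by (intro sum.mono_neutral_left) (auto simp: coeff_eq_0 vec_eq_iff)
  have smp: "(T ^^ m) (c *s x) = c *s (T ^^ m) x" for m c x
    by (induction m) (auto simp: sm)
  have factor: "act ([:-z, 1:] * q) x = act q (T x - z *s x)" if "q \<noteq> 0" for q z x
  proof -
    let ?n = "degree q"
    have c: "coeff ([:-z, 1:] * q) i = coeff (pCons 0 q) i - z * coeff q i" for i
      by (simp add: algebra_simps)
    have "degree ([:-z, 1:] * q) \<le> Suc ?n"
      using degree_mult_le[of "[:-z, 1:]" q] by simp
    then have "act ([:-z, 1:] * q) x
        = (\<Sum>i\<le>Suc ?n. coeff (pCons 0 q) i *s (T ^^ i) x) - (\<Sum>i\<le>Suc ?n. (z * coeff q i) *s (T ^^ i) x)"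
      unfolding act_eq[OF \<open>degree _ \<le> _\<close>] c
      by (simp add: vector_sub_rdistrib sum_subtractf del: sum.atMost_Suc)
    also have "(\<Sum>i\<le>Suc ?n. coeff (pCons 0 q) i *s (T ^^ i) x) = (\<Sum>i\<le>?n. coeff q i *s (T ^^ i) (T x))"
      by (subst sum.atMost_Suc_shift) (simp add: funpow_swap1)
    also have "(\<Sum>i\<le>Suc ?n. (z * coeff q i) *s (T ^^ i) x) = (\<Sum>i\<le>?n. coeff q i *s (T ^^ i) (z *s x))"
      by (simp add: coeff_eq_0 smp mult.commute)
    finally show ?thesis
      unfolding act_def
      by (simp add: linear_diff[OF lin'] smult_diff sum_subtractf)
  qed
  have split: "\<exists>ls. fold (\<lambda>l y. T y - l *s y) ls x = 0" if "q \<noteq> 0" "act q x = 0" for q x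
    using that
  proof (induction "degree q" arbitrary: q x)
    case 0
    then obtain a where "q = [:a:]" "a \<noteq> 0" by (metis degree_eq_zeroE pCons_0_0)
    then have "x = 0" using 0 by (simp add: act_def vec_eq_iff)
    then show ?case by (intro exI[of _ "[]"]) simp
  next
    case (Suc n)
    then obtain z where "poly q z = 0"
      using fundamental_theorem_of_algebra[of q] constant_degree[of q] by auto
    then obtain q' where q': "q = [:-z, 1:] * q'"
      by (auto simp: poly_eq_0_iff_dvd)
    have "q' \<noteq> 0" using q' Suc.prems by auto
    moreover have "n = degree q'" 
      using Suc.hyps(2) degree_mult_eq[of "[:-z, 1:]" q'] \<open>q' \<noteq> 0\<close> q' by simp
    moreover have "act q' (T x - z *s x) = 0"
      using Suc.prems factor[OF \<open>q' \<noteq> 0\<close>] q' by simp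
    ultimately obtain ls where "fold (\<lambda>l y. T y - l *s y) ls (T x - z *s x) = 0"
      using Suc.hyps(1) by blast
    then show ?case by (intro exI[of _ "z # ls"]) simp
  qed
  \<comment> \<open>The real dimension: dependence is taken over the reals, and the coefficients are
    read as complex numbers afterwards.\<close>
  let ?N = "DIM(complex^'n)"
  have "\<exists>a::nat \<Rightarrow> real. (\<exists>i\<le>?N. a i \<noteq> 0) \<and> (\<Sum>i\<le>?N. a i *\<^sub>R (T ^^ i) x) = 0"
  proof (cases "inj_on (\<lambda>i. (T ^^ i) x) {..?N}")
    case True
    then have "dependent ((\<lambda>i. (T ^^ i) x) ` {..?N})"
      by (intro dependent_biggerset) (simp add: card_image)
    then obtain u v where u: "v \<in> (\<lambda>i. (T ^^ i) x) ` {..?N}" "u v \<noteq> 0"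
        "(\<Sum>v\<in>(\<lambda>i. (T ^^ i) x) ` {..?N}. u v *\<^sub>R v) = 0"
      by (subst (asm) dependent_finite) auto
    moreover have "(\<Sum>i\<le>?N. u ((T ^^ i) x) *\<^sub>R (T ^^ i) x) = 0"
      using u(3) unfolding sum.reindex[OF True] by (simp add: o_def)
    ultimately show ?thesis
      by (intro exI[of _ "\<lambda>i. u ((T ^^ i) x)"]) auto
  next
    case False
    \<comment> \<open>If two iterates coincide, the set of iterates is too small for a dimension
      count, but their difference is already a relation.\<close>
    then obtain i j where ij: "i \<le> ?N" "j \<le> ?N" "i \<noteq> j" "(T ^^ i) x = (T ^^ j) x"
      by (auto simp: inj_on_def)
    define a :: "nat \<Rightarrow> real" where "a k = (if k = i then 1 else 0) + (if k = j then -1 else 0)" for k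
    have "(\<Sum>k\<le>?N. a k *\<^sub>R (T ^^ k) x)
        = (\<Sum>k\<le>?N. if k = i then (T ^^ k) x else 0) + (\<Sum>k\<le>?N. if k = j then - (T ^^ k) x else 0)"
      unfolding sum.distrib[symmetric] by (intro sum.cong) (auto simp: a_def)
    also have "\<dots> = 0" using ij by simp
    finally show ?thesis using ij by (intro exI[of _ a]) (auto simp: a_def)
  qed
  then obtain a :: "nat \<Rightarrow> real" and i where
    a: "i \<le> ?N" "a i \<noteq> 0" "(\<Sum>i\<le>?N. a i *\<^sub>R (T ^^ i) x) = 0" by blast
  define q where "q = (\<Sum>i\<le>?N. monom (complex_of_real (a i)) i)"
  have q: "coeff q k = (if k \<le> ?N then complex_of_real (a k) else 0)" for k
    by (simp add: q_def coeff_sum)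
  then have "coeff q i \<noteq> 0" using a by simp
  then have "q \<noteq> 0" by auto
  moreover have "act q x = 0"
  proof -
    have "degree q \<le> ?N" by (intro degree_le) (auto simp: q)
    then show ?thesis using a(3) by (simp add: act_eq q scaleR_eq_smult)
  qed
  ultimately show ?thesis using split by blast
qed

section \<open>Stable and unstable spaces of an invertible complex map\<close>

context
  fixes T T' :: "complex^'n::finite \<Rightarrow> complex^'n"
  assumes lin: "linear T" "linear T'"
    and sm: "\<And>c x. T (c *s x) = c *s T x" "\<And>c x. T' (c *s x) = c *s T' x"
    and inv: "\<And>x. T (T' x) = x" "\<And>x. T' (T x) = x"
begin

abbreviation (input) "stab \<equiv> exp_stable T"
abbreviation (input) "unst \<equiv> exp_stable T'"

lemma unst_T: "x \<in> unst \<Longrightarrow> T x \<in> unst"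
  using exp_stable_backward[of T' "T x"] inv by simp

lemma eigenvector_unst:
  assumes "x \<in> unst" "T x = l *s x" "cmod l \<le> 1" shows "x = 0"
proof (cases "l = 0")
  case True
  then have "T' (T x) = 0" using assms linear_0[OF lin(2)] by simp
  then show ?thesis using inv by simp
next
  case False
  have "T' (T x) = l *s T' x" using assms(2) sm by simp
  then have "T' x = inverse l *s x" using False inv by (simp add: vec_eq_iff)
  moreover have "cmod (inverse l) \<ge> 1"
    using False assms(3) by (simp add: norm_inverse one_le_inverse)
  ultimately show ?thesis
    using eigenvector_exp_stable[OF sm(2) assms(1)] by blast
qed

lemma linear_shift: "linear (\<lambda>x. T x - l *s x)"
  by (intro linearI)
    (auto simp: linear_add[OF lin(1)] linear_scale[OF lin(1)] vec_eq_iff algebra_simps)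

lemma shift_stab: "x \<in> stab \<Longrightarrow> T x - l *s x \<in> stab"
  by (intro subspace_diff[OF subspace_exp_stable[OF lin(1)]] exp_stable_forward
      exp_stable_smult[OF sm(1)])

lemma shift_unst: "x \<in> unst \<Longrightarrow> T x - l *s x \<in> unst"
  by (intro subspace_diff[OF subspace_exp_stable[OF lin(2)]] unst_T
      exp_stable_smult[OF sm(2)])

text \<open>Both spaces are invariant under every \<open>T - l\<close>, so induction along an
  annihilating list reduces a common vector to a common eigenvector. It cannot decay under
  \<open>T\<close> if \<open>cmod l \<ge> 1\<close>, nor under \<open>T'\<close> if
  \<open>cmod l \<le> 1\<close>.\<close>

lemma splitting_intersection:
  assumes "x \<in> stab" "x \<in> unst" shows "x = 0"
proof -
  obtain ls where "fold (\<lambda>l y. T y - l *s y) ls x = 0"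
    using annihilating_factors[OF lin(1) sm(1)] by blast
  then show ?thesis using assms
  proof (induction ls arbitrary: x)
    case (Cons l ls)
    have "T x - l *s x = 0"
      by (rule Cons.IH) (use Cons.prems in \<open>simp_all add: shift_stab shift_unst\<close>)
    then show ?case
      using eigenvector_exp_stable[OF sm(1), of x l] eigenvector_unst[of x l] Cons.prems
      by (cases "cmod l \<le> 1") auto
  qed simp
qed

text \<open>Lifts a splitting through one factor \<open>T - l\<close>. For \<open>cmod l < 1\<close>
  this factor is bijective on the unstable space, so \<open>u\<close> can be absorbed; the rest is
  an eigenvector up to a stable error, hence stable. For \<open>cmod l > 1\<close> the same happens
  with \<open>T'\<close>. On the circle the factor is injective everywhere and maps the sum of both
  spaces onto itself, so \<open>x\<close> already lies in that sum.\<close>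

lemma splitting_shift:
  assumes y: "T x - l *s x = s + u" "s \<in> stab" "u \<in> unst"
    and hyp: "\<And>z. cmod l = 1 \<Longrightarrow> T z = l *s z \<Longrightarrow> z = 0"
  shows "\<exists>s\<in>stab. \<exists>u\<in>unst. x = s + u"
proof -
  let ?L = "\<lambda>x. T x - l *s x"
  note sub = subspace_exp_stable[OF lin(1)] subspace_exp_stable[OF lin(2)]
  consider "cmod l < 1" | "cmod l > 1" | "cmod l = 1" by linarith
  then show ?thesis
  proof cases
    case 1
    have "?L ` unst = unst"
      using shift_unst 1 eigenvector_unst[of _ l]
      by (intro linear_inj_on_subspace_surj[OF linear_shift sub(2)]) auto
    then obtain u' where u': "u' \<in> unst" "u = ?L u'" using y(3) by blast
    have "T (x - u') = l *s (x - u') + s"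
      using y(1) u'(2) by (simp add: linear_diff[OF lin(1)] smult_diff algebra_simps)
    from exp_stable_perturbed_eigenvector[OF lin(1) sm(1) y(2) this 1]
    show ?thesis using u'(1) by (intro bexI[of _ "x - u'"] bexI[of _ u']) auto
  next
    case 2
    then have l: "l \<noteq> 0" by auto
    have "?L ` stab = stab"
      using shift_stab 2 eigenvector_exp_stable[OF sm(1), of _ l]
      by (intro linear_inj_on_subspace_surj[OF linear_shift sub(1)]) auto
    then obtain s' where s': "s' \<in> stab" "s = ?L s'" using y(2) by blast
    have "T (x - s') = l *s (x - s') + u"
      using y(1) s'(2) by (simp add: linear_diff[OF lin(1)] smult_diff algebra_simps)
    then have "T' (T (x - s')) = l *s T' (x - s') + T' u"
      by (simp only: linear_add[OF lin(2)] sm)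
    then have "T' (x - s') = inverse l *s (x - s') + (- inverse l) *s T' u"
      unfolding inv using l by (simp add: vec_eq_iff field_simps) 
    moreover have "(- inverse l) *s T' u \<in> unst"
      by (intro exp_stable_smult[OF sm(2)] exp_stable_forward y(3))
    moreover have "cmod (inverse l) < 1"
      using 2 by (simp add: norm_inverse inverse_less_1_iff)
    ultimately have "x - s' \<in> unst"
      using exp_stable_perturbed_eigenvector[OF lin(2) sm(2)] by blast
    then show ?thesis using s'(1) by (intro bexI[of _ s'] bexI[of _ "x - s'"]) auto
  next
    case 3
    define V where "V = {a + b | a b. a \<in> stab \<and> b \<in> unst}"
    have "?L ` V \<subseteq> V"
    proof clarify
      fix z assume "z \<in> V"
      then obtain a b where ab: "z = a + b" "a \<in> stab" "b \<in> unst" by (auto simp: V_def)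
      then have "?L z = ?L a + ?L b" using linear_add[OF linear_shift] by blast
      then show "?L z \<in> V" using shift_stab[OF ab(2)] shift_unst[OF ab(3)] by (auto simp: V_def)
    qed
    then have "?L ` V = V"
      using hyp[OF 3] by (intro linear_inj_on_subspace_surj[OF linear_shift])
        (auto simp: V_def intro: subspace_sums[OF sub])
    moreover have "?L x \<in> V" using y by (auto simp: V_def)
    ultimately obtain x' where x': "x' \<in> V" "?L x = ?L x'" by blast
    then have "?L (x - x') = 0"
      by (simp add: linear_diff[OF lin(1)] smult_diff algebra_simps)
    then have "x = x'" using hyp[OF 3, of "x - x'"] by simp
    then show ?thesis using x'(1) by (auto simp: V_def)
  qed
qed

lemma splitting_complex:
  assumes "\<And>l z. cmod l = 1 \<Longrightarrow> T z = l *s z \<Longrightarrow> z = 0"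
  shows "\<exists>s\<in>stab. \<exists>u\<in>unst. x = s + u"
proof -
  obtain ls where "fold (\<lambda>l y. T y - l *s y) ls x = 0"
    using annihilating_factors[OF lin(1) sm(1)] by blast
  then show ?thesis
  proof (induction ls arbitrary: x)
    case Nil
    then show ?case
      using subspace_0[OF subspace_exp_stable[OF lin(1)]] subspace_0[OF subspace_exp_stable[OF lin(2)]]
      by (intro bexI[of _ 0]) auto
  next
    case (Cons l ls)
    then have "\<exists>s\<in>stab. \<exists>u\<in>unst. T x - l *s x = s + u" by simp
    then obtain s u where "T x - l *s x = s + u" "s \<in> stab" "u \<in> unst" by blast
    then show ?case using assms by (intro splitting_shift[of x l s u]) auto
  qed
qed

text \<open>The spaces are invariant and meet only in \<open>0\<close>, so both components of an
  eigenvector satisfy the eigenvector equation with the same \<open>l\<close>; on the circle this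
  forces them to vanish.\<close>

lemma no_circle_eigenvector:
  assumes "z = s + u" "s \<in> stab" "u \<in> unst" "T z = l *s z" "cmod l = 1"
  shows "z = 0"
proof -
  have "T s + T u = l *s s + l *s u"
    using assms(4) unfolding assms(1) by (simp add: linear_add[OF lin(1)] vector_add_ldistrib)
  then have "T s - l *s s = - (T u - l *s u)"
    by (simp add: algebra_simps)
  moreover have "T s - l *s s \<in> stab" "- (T u - l *s u) \<in> unst"
    using shift_stab[OF assms(2)] subspace_neg[OF subspace_exp_stable[OF lin(2)] shift_unst[OF assms(3)]]
    by auto
  ultimately have "T s - l *s s = 0" "- (T u - l *s u) = 0"
    using splitting_intersection by metis+
  then have "s = 0" "u = 0"
    using eigenvector_exp_stable[OF sm(1) assms(2), of l] eigenvector_unst[OF assms(3), of l] assms(5)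
    by auto
  then show ?thesis using assms(1) by simp
qed

end

section \<open>Transfer between real matrices and their complexifications\<close>

definition cvec :: "real^'n \<Rightarrow> complex^'n" where "cvec x = (\<chi> i. complex_of_real (x $ i))"
definition revec :: "complex^'n \<Rightarrow> real^'n" where "revec z = (\<chi> i. Re (z $ i))"
definition imvec :: "complex^'n \<Rightarrow> real^'n" where "imvec z = (\<chi> i. Im (z $ i))"

lemma cvec_nth [simp]: "cvec x $ i = complex_of_real (x $ i)" by (simp add: cvec_def)
lemma revec_nth [simp]: "revec z $ i = Re (z $ i)" by (simp add: revec_def)
lemma imvec_nth [simp]: "imvec z $ i = Im (z $ i)" by (simp add: imvec_def)

lemma complexify_nth [simp]: "complexify A $ i $ j = complex_of_real (A $ i $ j)"
  by (simp add: complexify_def map_matrix_def)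

lemma complexify_cvec: "complexify A *v cvec x = cvec (A *v x)"
  by (simp add: vec_eq_iff matrix_vector_mult_def)

lemma revec_complexify: "revec (complexify A *v z) = A *v revec z"
  by (simp add: vec_eq_iff matrix_vector_mult_def)

lemma imvec_complexify: "imvec (complexify A *v z) = A *v imvec z"
  by (simp add: vec_eq_iff matrix_vector_mult_def)

lemma cvec_revec_imvec: "z = cvec (revec z) + \<i> *s cvec (imvec z)"
  by (simp add: vec_eq_iff complex_eq_iff)

lemma norm_cvec: "norm (cvec x) = norm x"
  by (simp add: norm_vec_def)

lemma norm_revec_le: "norm (revec z) \<le> norm z"
  unfolding norm_vec_def by (intro L2_set_mono) (auto simp: abs_Re_le_cmod)

lemma cvec_eq_0_iff [simp]: "cvec x = 0 \<longleftrightarrow> x = 0"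
  by (simp add: vec_eq_iff)

lemma complexify_mult: "complexify (A ** B) = complexify A ** complexify B"
  by (simp add: vec_eq_iff matrix_matrix_mult_def)

lemma complexify_mat_1: "complexify (mat 1) = mat 1"
  by (simp add: vec_eq_iff mat_def)

lemma cvec_exp_stable:
  assumes "x \<in> exp_stable ((*v) A)" shows "cvec x \<in> exp_stable ((*v) (complexify A))"
proof -
  have "((*v) (complexify A) ^^ m) (cvec x) = cvec (((*v) A ^^ m) x)" for m
    by (induction m) (auto simp: complexify_cvec)
  then show ?thesis using assms by (simp add: exp_stable_def norm_cvec)
qed

lemma revec_exp_stable:
  assumes "z \<in> exp_stable ((*v) (complexify A))" shows "revec z \<in> exp_stable ((*v) A)"
proof -
  have *: "((*v) A ^^ m) (revec z) = revec (((*v) (complexify A) ^^ m) z)" for m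
    by (induction m) (auto simp: revec_complexify)
  obtain C r where "0 < r" "r < 1" "\<And>m. norm (((*v) (complexify A) ^^ m) z) \<le> C * r ^ m"
    using assms unfolding exp_stable_def by blast
  then show ?thesis
    by (intro exp_stableI[of r _ _ C]) (auto simp: * intro: order_trans[OF norm_revec_le])
qed

context
  fixes A B :: "real^'n^'n"
  assumes AB: "A ** B = mat 1" "B ** A = mat 1"
begin

lemma complexify_inverse:
  "complexify A *v (complexify B *v z) = z" "complexify B *v (complexify A *v z) = z"
  by (simp_all add: matrix_vector_mul_assoc AB complexify_mat_1 flip: complexify_mult)

lemma linear_complexify: "linear ((*v) (complexify M))"
  by (intro linearI) (auto simp: vec_eq_iff matrix_vector_mult_def sum.distrib algebra_simps scaleR_sum_right)

lemma exp_stable_intersection: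
  assumes "x \<in> exp_stable ((*v) A)" "x \<in> exp_stable ((*v) B)" shows "x = 0"
proof -
  have "cvec x = 0"
    by (rule splitting_intersection[OF linear_complexify linear_complexify _ _ complexify_inverse])
      (use assms in \<open>auto simp: cvec_exp_stable vector_scalar_commute\<close>)
  then show ?thesis by simp
qed

text \<open>The link between the spectrum and dynamics: an Anosov structure yields the splitting at
  a fixed point, and conversely the splitting supplies constant bundles. Forwards one takes real
  parts of a complex splitting; backwards one splits the real and imaginary parts of a circle
  eigenvector.\<close>

lemma hyperbolic_iff_splitting:
  "hyperbolic A \<longleftrightarrow> (\<forall>x. \<exists>s\<in>exp_stable ((*v) A). \<exists>u\<in>exp_stable ((*v) B). x = s + u)"
proof
  assume hyp: "hyperbolic A"
  show "\<forall>x. \<exists>s\<in>exp_stable ((*v) A). \<exists>u\<in>exp_stable ((*v) B). x = s + u"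
  proof
    fix x
    have "\<exists>s\<in>exp_stable ((*v) (complexify A)). \<exists>u\<in>exp_stable ((*v) (complexify B)). cvec x = s + u"
    proof (rule splitting_complex[OF linear_complexify linear_complexify _ _ complexify_inverse])
      fix l z assume "cmod l = 1" "complexify A *v z = l *s z"
      then show "z = 0" using hyp unfolding hyperbolic_def Spec_def by auto
    qed (auto simp: vector_scalar_commute)
    then obtain s u where su: "s \<in> exp_stable ((*v) (complexify A))" "u \<in> exp_stable ((*v) (complexify B))"
      "cvec x = s + u" by blast
    have "x = revec (cvec x)" by (simp add: vec_eq_iff)
    also have "\<dots> = revec s + revec u" unfolding su(3) by (simp add: vec_eq_iff)
    finally show "\<exists>s\<in>exp_stable ((*v) A). \<exists>u\<in>exp_stable ((*v) B). x = s + u"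
      using revec_exp_stable su by blast
  qed
next
  assume spl: "\<forall>x. \<exists>s\<in>exp_stable ((*v) A). \<exists>u\<in>exp_stable ((*v) B). x = s + u"
  have "z = 0" if z: "cmod l = 1" "complexify A *v z = l *s z" for l z
  proof -
    obtain s1 u1 s2 u2 where *: "revec z = s1 + u1" "imvec z = s2 + u2"
      "s1 \<in> exp_stable ((*v) A)" "s2 \<in> exp_stable ((*v) A)"
      "u1 \<in> exp_stable ((*v) B)" "u2 \<in> exp_stable ((*v) B)"
      using spl by metis
    have st: "cvec s + \<i> *s cvec s' \<in> exp_stable ((*v) (complexify M))"
      if "s \<in> exp_stable ((*v) M)" "s' \<in> exp_stable ((*v) M)" for M s s'
      using that by (intro subspace_add[OF subspace_exp_stable[OF linear_complexify]]
          exp_stable_smult cvec_exp_stable) (auto simp: vector_scalar_commute)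
    have "z = (cvec s1 + \<i> *s cvec s2) + (cvec u1 + \<i> *s cvec u2)"
      by (subst cvec_revec_imvec) (simp add: * vec_eq_iff complex_eq_iff)
    then show "z = 0"
      using no_circle_eigenvector[OF linear_complexify linear_complexify _ _ complexify_inverse _
          st[OF *(3,4)] st[OF *(5,6)] z(2,1)] by (auto simp: vector_scalar_commute)
  qed
  then show "hyperbolic A" unfolding hyperbolic_def Spec_def by auto
qed

end

section \<open>Affine Anosov maps\<close>

lemma Ck_ident: "Ck k (\<lambda>x. x)"
proof (cases k)
  case (Suc j)
  show ?thesis
    unfolding Suc by (rule Ck_has_derivative[OF has_derivative_ident]) simp
qed simp

lemma Ck_bounded_linear:
  fixes L :: "'a::euclidean_space \<Rightarrow> 'b::euclidean_space"
  shows "bounded_linear L \<Longrightarrow> Ck k (\<lambda>x. L x + c)"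
  by (rule Ck_linear_comp[OF Ck_ident, of L])

lemma continuous_subbundle_const:
  assumes "subspace S" shows "continuous_subbundle (\<lambda>_. S)"
proof -
  obtain B where B: "B \<subseteq> S" "independent B" "S \<subseteq> span B"
    using basis_exists[of S] by metis
  have "span B = S"
    using B assms by (simp add: span_minimal subset_antisym)
  moreover have "(\<lambda>X. X y) ` (\<lambda>b _. b) ` B = B" for y :: 'a
    by (simp add: image_image)
  moreover have "finite B" using B(2) by (rule finiteI_independent)
  moreover have "inj_on (\<lambda>X. X y) ((\<lambda>b _. b) ` B)" for y :: 'a
    by (auto simp: inj_on_def)
  ultimately show ?thesis
    using B(2) unfolding continuous_subbundle_def
    by (intro allI exI[of _ UNIV] exI[of _ "(\<lambda>b _. b) ` B"]) auto
qed

lemma affine_map_funpow: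
  "((affine_map A v ^^ m) has_derivative ((*v) A ^^ m)) (at x)"
proof (induction m)
  case (Suc m)
  have "(affine_map A v has_derivative (*v) A) (at y)" for y
    unfolding affine_map_def
    by (auto intro!: derivative_eq_intros bounded_linear_imp_has_derivative matrix_vector_mul_bounded_linear)
  from has_derivative_compose[OF Suc this] show ?case by (simp add: o_def)
qed (simp add: id_def)

lemma frechet_affine_map_funpow: "frechet_derivative (affine_map A v ^^ m) (at x) = ((*v) A ^^ m)"
  by (rule frechet_derivative_at[symmetric, OF affine_map_funpow])

lemma frechet_affine_map: "frechet_derivative (affine_map A v) (at x) = (*v) A"
  using frechet_affine_map_funpow[of 1] by simp

context
  fixes A B :: "real^'n^'n" and v :: "real^'n"
  assumes AB: "A ** B = mat 1" "B ** A = mat 1"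
begin

lemma mult_inverse: "A *v (B *v x) = x" "B *v (A *v x) = x"
  by (simp_all add: matrix_vector_mul_assoc AB)

lemma bij_affine_map: "bij (affine_map A v)"
  by (rule bij_betw_byWitness[of _ "\<lambda>x. B *v (x - v)"]) (auto simp: affine_map_def mult_inverse)

lemma inv_affine_map: "inv (affine_map A v) = affine_map B (- (B *v v))"
  by (rule inv_unique_comp)
    (auto simp: fun_eq_iff affine_map_def mult_inverse algebra_simps)

lemma diffeomorphism_affine_map: "diffeomorphism (affine_map A v)"
proof -
  have "smooth_map (affine_map M w)" for M :: "real^'n^'n" and w
    unfolding smooth_map_def affine_map_def
    by (simp add: Ck_bounded_linear[OF matrix_vector_mul_bounded_linear])
  then show ?thesis
    by (simp add: diffeomorphism_def bij_affine_map inv_affine_map)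
qed

lemma anosov_affine_mapI:
  assumes "riemannian_metric g" "continuous_splitting Es Eu"
    and "\<And>x. (*v) A ` Es x = Es (affine_map A v x)" "\<And>x. (*v) A ` Eu x = Eu (affine_map A v x)"
    and "C \<ge> 1" "0 < r" "r < 1"
    and "\<And>m x w. w \<in> Es x \<Longrightarrow>
          rnorm g ((affine_map A v ^^ m) x) (((*v) A ^^ m) w) \<le> C * r ^ m * rnorm g x w"
    and "\<And>m x w. w \<in> Eu x \<Longrightarrow>
          rnorm g ((affine_map B (- (B *v v)) ^^ m) x) (((*v) B ^^ m) w) \<le> C * r ^ m * rnorm g x w"
  shows "anosov_wrt (affine_map A v) g"
  unfolding anosov_wrt_def inv_affine_map frechet_affine_map_funpow invariant_bundle_def frechet_affine_map
  using assms diffeomorphism_affine_map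
  by (intro conjI exI[of _ Es] exI[of _ Eu] exI[of _ C] exI[of _ r]) auto

text \<open>At a fixed point all estimates are made in the single norm \<open>rnorm g p\<close>,
  which is comparable with the Euclidean one. So the fibres at \<open>p\<close> lie in the
  exponentially stable spaces of \<open>A\<close> and \<open>B\<close>, and these therefore
  span.\<close>

lemma anosov_fixed_point_hyperbolic:
  assumes "anosov_wrt (affine_map A v) g" and p: "affine_map A v p = p"
  shows "hyperbolic A"
proof -
  obtain Es Eu C r where g: "riemannian_metric g" and spl: "continuous_splitting Es Eu"
    and r: "0 < r" "r < 1" and
    s: "\<And>m x w. w \<in> Es x \<Longrightarrow>
          rnorm g ((affine_map A v ^^ m) x) (((*v) A ^^ m) w) \<le> C * r ^ m * rnorm g x w" and
    u: "\<And>m x w. w \<in> Eu x \<Longrightarrow>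
          rnorm g ((affine_map B (- (B *v v)) ^^ m) x) (((*v) B ^^ m) w) \<le> C * r ^ m * rnorm g x w"
    using assms(1) unfolding anosov_wrt_def inv_affine_map frechet_affine_map_funpow by blast
  obtain c where c: "c > 0" "\<And>w. c * norm w \<le> rnorm g p w"
    using rnorm_bounds_compact[OF g, of "{p}"] by auto
  have "affine_map B (- (B *v v)) p = p"
    using inv_affine_map p bij_affine_map by (metis bij_inv_eq_iff)
  then have fp: "(affine_map A v ^^ m) p = p" "(affine_map B (- (B *v v)) ^^ m) p = p" for m
    by (induction m) (auto simp: p)
  have st: "w \<in> exp_stable T"
    if "\<And>m. rnorm g p ((T ^^ m) w) \<le> C * r ^ m * rnorm g p w" for w T
  proof (rule exp_stableI[OF r])
    fix m show "norm ((T ^^ m) w) \<le> (C * rnorm g p w / c) * r ^ m"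
      using order_trans[OF c(2) that[of m]] c(1) by (simp add: field_simps)
  qed
  have "Es p \<subseteq> exp_stable ((*v) A)" "Eu p \<subseteq> exp_stable ((*v) B)"
    using s[of _ p] u[of _ p] unfolding fp by (auto intro!: st)
  moreover have "\<forall>x. \<exists>a\<in>Es p. \<exists>b\<in>Eu p. x = a + b"
    using spl unfolding continuous_splitting_def by blast
  ultimately show ?thesis
    unfolding hyperbolic_iff_splitting[OF AB] by (meson subsetD)
qed

lemma hyperbolic_imp_anosov:
  assumes "hyperbolic A"
  shows "\<exists>g. complete_riemannian_metric g \<and> anosov_wrt (affine_map A v) g"
proof -
  let ?g = "\<lambda>x::real^'n. (\<bullet>) :: real^'n \<Rightarrow> real^'n \<Rightarrow> real"
  let ?S = "exp_stable ((*v) A)" and ?U = "exp_stable ((*v) B)"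
  have g: "riemannian_metric ?g"
    by (auto simp: riemannian_metric_def smooth_map_def inner_commute bilinear_conv_bounded_bilinear
        bounded_bilinear_inner)
  have norm: "rnorm ?g x w = norm w" for x w
    by (simp add: rnorm_def norm_eq_sqrt_inner)
  \<comment> \<open>The zero function is a sufficient barrier, because this metric is Euclidean
    everywhere.\<close>
  have "complete_riemannian_metric ?g"
    by (rule complete_riemannian_metric_barrier[OF g has_derivative_const[of "0::real"], of 0])
      (auto simp: norm intro: exI[of _ 1])
  moreover have "anosov_wrt (affine_map A v) ?g"
  proof -
    have sub: "subspace ?S" "subspace ?U"
      by (intro subspace_exp_stable matrix_vector_mul_linear)+
    have "continuous_splitting (\<lambda>_. ?S) (\<lambda>_. ?U)"
      unfolding continuous_splitting_def
    proof (intro conjI allI continuous_subbundle_const sub)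
      show "?S \<inter> ?U = {0}"
        using exp_stable_intersection[OF AB] subspace_0[OF sub(1)] subspace_0[OF sub(2)] by blast
      show "{a + b |a b. a \<in> ?S \<and> b \<in> ?U} = UNIV"
        using hyperbolic_iff_splitting[OF AB] assms by blast
    qed
    moreover obtain C1 r1 where 1: "C1 \<ge> 1" "0 < r1" "r1 < 1"
        "\<forall>w\<in>?S. \<forall>m. norm (((*v) A ^^ m) w) \<le> C1 * r1 ^ m * norm w"
      using exp_stable_uniform[OF matrix_vector_mul_linear[of A]] by blast
    moreover obtain C2 r2 where 2: "C2 \<ge> 1" "0 < r2" "r2 < 1"
        "\<forall>w\<in>?U. \<forall>m. norm (((*v) B ^^ m) w) \<le> C2 * r2 ^ m * norm w"
      using exp_stable_uniform[OF matrix_vector_mul_linear[of B]] by blast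
    moreover have "norm (((*v) A ^^ m) w) \<le> max C1 C2 * max r1 r2 ^ m * norm w" if "w \<in> ?S" for m w
    proof -
      have "C1 * r1 ^ m * norm w \<le> max C1 C2 * max r1 r2 ^ m * norm w"
        using 1(1,2) by (intro mult_right_mono mult_mono power_mono) auto
      then show ?thesis using 1(4) that by (meson order_trans)
    qed
    moreover have "norm (((*v) B ^^ m) w) \<le> max C1 C2 * max r1 r2 ^ m * norm w" if "w \<in> ?U" for m w
    proof -
      have "C2 * r2 ^ m * norm w \<le> max C1 C2 * max r1 r2 ^ m * norm w"
        using 2(1,2) by (intro mult_right_mono mult_mono power_mono) auto
      then show ?thesis using 2(4) that by (meson order_trans)
    qed
    moreover have "(*v) A ` ?S = ?S"
    proof
      show "(*v) A ` ?S \<subseteq> ?S" using exp_stable_forward by blast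
      show "?S \<subseteq> (*v) A ` ?S"
      proof
        fix x assume "x \<in> ?S"
        then have "B *v x \<in> ?S" using exp_stable_backward[of "(*v) A" "B *v x"] by (simp add: mult_inverse)
        then show "x \<in> (*v) A ` ?S" using mult_inverse(1) by (metis image_eqI)
      qed
    qed
    moreover have "(*v) A ` ?U = ?U"
    proof
      show "(*v) A ` ?U \<subseteq> ?U"
      proof clarify
        fix x assume "x \<in> ?U"
        then show "A *v x \<in> ?U" using exp_stable_backward[of "(*v) B" "A *v x"] by (simp add: mult_inverse)
      qed
      show "?U \<subseteq> (*v) A ` ?U"
        using exp_stable_forward[of _ "(*v) B"] mult_inverse(1) by (metis image_eqI subsetI)
    qed
    ultimately show ?thesis
      by (intro anosov_affine_mapI[OF g, of "\<lambda>_. ?S" "\<lambda>_. ?U" "max C1 C2" "max r1 r2"])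
        (auto simp: norm)
  qed
  ultimately show ?thesis by blast
qed

end

section \<open>Frames and interpolation along the drift\<close>

lemma inner_matrix_vector_mult: "x \<bullet> (A *v y) = (transpose A *v x) \<bullet> y" for A :: "real^'n^'m"
  by (metis dot_lmul_matrix vector_transpose_matrix transpose_transpose)

lemma continuous_subbundle_line:
  fixes e :: "'a::euclidean_space \<Rightarrow> 'a"
  assumes "continuous_on UNIV e" "\<And>x. e x \<noteq> 0"
  shows "continuous_subbundle (\<lambda>x. span {e x})"
  unfolding continuous_subbundle_def
  by (intro allI exI[of _ UNIV] exI[of _ "{e}"]) (use assms in auto)

text \<open>
  The frame at \<open>y\<close> is the image of a basis of the fibre at \<open>x\<close> under the projection along \<open>e y\<close>.
\<close>

lemma continuous_subbundle_hyperplane: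
  fixes e w :: "'a::euclidean_space \<Rightarrow> 'a"
  assumes e: "continuous_on UNIV e" and w: "continuous_on UNIV w" and we: "\<And>x. w x \<bullet> e x \<noteq> 0"
  shows "continuous_subbundle (\<lambda>x. {a. w x \<bullet> a = 0})"
  unfolding continuous_subbundle_def
proof
  fix x
  \<comment> \<open>\<open>w y \<bullet> e y\<close> times the projection along \<open>e y\<close>
    onto the kernel of \<open>w y\<close>.\<close>
  define Q where "Q y a = (w y \<bullet> e y) *\<^sub>R a - (w y \<bullet> a) *\<^sub>R e y" for y a
  \<comment> \<open>The points where \<open>e y\<close> is transverse to the kernel of
    \<open>w x\<close>, so that projecting along \<open>e y\<close> is injective on this
    kernel.\<close>
  define U where "U = {y. w x \<bullet> e y \<noteq> 0}"
  obtain B where B: "independent B" "span B = {a. w x \<bullet> a = 0}"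
    using orthonormal_basis_subspace[OF subspace_hyperplane[of "w x"]] by metis
  have lin: "linear (Q y)" for y
    unfolding Q_def by (intro linearI) (auto simp: algebra_simps inner_add_right)
  have Q_inj: "a = 0" if "y \<in> U" "w x \<bullet> a = 0" "Q y a = 0" for y a
  proof -
    have "(w y \<bullet> e y) * (w x \<bullet> a) - (w y \<bullet> a) * (w x \<bullet> e y) = w x \<bullet> Q y a"
      by (simp add: Q_def inner_diff_right)
    then have "w y \<bullet> a = 0" using that by (auto simp: U_def)
    then show "a = 0" using that(3) we[of y] by (simp add: Q_def)
  qed
  have inj: "inj_on (Q y) (span B)" if "y \<in> U" for y
    using Q_inj[OF that] linear_inj_on_iff_eq_0[OF lin subspace_span] B(2) by blast
  have sp: "Q y ` span B = {a. w y \<bullet> a = 0}" if "y \<in> U" for y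
  proof
    show "Q y ` span B \<subseteq> {a. w y \<bullet> a = 0}" by (auto simp: Q_def inner_diff_right)
    show "{a. w y \<bullet> a = 0} \<subseteq> Q y ` span B"
    proof clarify
      fix u assume u: "w y \<bullet> u = 0"
      \<comment> \<open>The preimage of \<open>u\<close>: its projection along \<open>e y\<close>
        back into the kernel of \<open>w x\<close>, divided by the scalar factor of
        \<open>Q\<close>.\<close>
      define b where "b = (1 / (w y \<bullet> e y)) *\<^sub>R (u - ((w x \<bullet> u) / (w x \<bullet> e y)) *\<^sub>R e y)"
      have "w x \<bullet> b = 0" using that by (simp add: b_def U_def inner_diff_right)
      moreover have "Q y b = u"
        using we[of y] u by (simp add: Q_def b_def inner_diff_right algebra_simps)
      ultimately show "u \<in> Q y ` span B" using B(2) by blast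
    qed
  qed
  have "open U"
    unfolding U_def by (intro open_Collect_neq continuous_intros e)
  moreover have "x \<in> U" using we by (simp add: U_def)
  moreover have "continuous_on U (\<lambda>y. Q y b)" for b
    unfolding Q_def
    by (intro continuous_intros continuous_on_subset[OF e] continuous_on_subset[OF w]) auto
  moreover have "inj_on (\<lambda>X. X y) ((\<lambda>b y. Q y b) ` B)" if "y \<in> U" for y
    using inj_on_subset[OF inj[OF that] span_superset] by (auto simp: inj_on_def)
  moreover have "(\<lambda>X. X y) ` (\<lambda>b y. Q y b) ` B = Q y ` B" for y
    by (simp add: image_image)
  moreover have "independent (Q y ` B)" if "y \<in> U" for y
    using linear_independent_injective_image[OF lin B(1) inj[OF that]] .
  moreover have "span (Q y ` B) = {a. w y \<bullet> a = 0}" if "y \<in> U" for y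
    using linear_span_image[OF lin] sp[OF that] by metis
  moreover have "finite B" using B(1) by (rule finiteI_independent)
  ultimately show "\<exists>U F. open U \<and> x \<in> U \<and> finite F \<and> (\<forall>X\<in>F. continuous_on U X) \<and>
        (\<forall>y\<in>U. inj_on (\<lambda>X. X y) F \<and> independent ((\<lambda>X. X y) ` F) \<and>
               span ((\<lambda>X. X y) ` F) = {a. w y \<bullet> a = 0})"
    by (intro exI[of _ U] exI[of _ "(\<lambda>b y. Q y b) ` B"]) auto
qed

text \<open>These sequences serve as nodes at integer heights. Since \<open>f\<close> raises the
  height by 2, an equivariant sequence is free to start anew at an even and at an odd node.\<close>

lemma alternating_orbit_exists:
  fixes T T' :: "'a \<Rightarrow> 'a"
  assumes "\<And>x. T (T' x) = x"
  shows "\<exists>p::int \<Rightarrow> 'a. p 0 = a \<and> p 1 = b \<and> (\<forall>j. p (j + 2) = T (p j))"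
proof -
  define p where "p j = (let m = j div 2; c = if even j then a else b in
      if m \<ge> 0 then (T ^^ nat m) c else (T' ^^ nat (- m)) c)" for j :: int
  have "p (j + 2) = T (p j)" for j
  proof -
    have 1: "(j + 2) div 2 = j div 2 + 1" by simp
    consider "j div 2 \<ge> 0" | "j div 2 = -1" | "j div 2 < -1" by linarith
    then show ?thesis
    proof cases
      case 1
      then have "nat (j div 2 + 1) = Suc (nat (j div 2))" by simp
      then show ?thesis using 1 by (simp add: p_def Let_def)
    next
      case 2
      then show ?thesis by (simp add: p_def Let_def assms)
    next
      case 3
      then have "nat (- (j div 2)) = Suc (nat (- (j div 2 + 1)))" by simp
      moreover have "\<not> j \<ge> 0" using 3 by linarith
      ultimately show ?thesis using 3 by (simp add: p_def Let_def assms)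
    qed
  qed
  then show ?thesis by (intro exI[of _ p]) (auto simp: p_def)
qed

lemma int_parity_induct:
  fixes P :: "int \<Rightarrow> bool"
  assumes "\<And>j. P (j + 2) \<longleftrightarrow> P j" "P 0" "P 1"
  shows "P j"
proof -
  have "P (i + 2 * k) \<longleftrightarrow> P i" for i k :: int
  proof (induction k rule: int_induct[where k = 0])
    case (step1 k)
    then show ?case using assms(1)[of "i + 2 * k"] by (simp add: algebra_simps)
  next
    case (step2 k)
    then show ?case using assms(1)[of "i + 2 * (k - 1)"] by (simp add: algebra_simps)
  qed simp
  from this[of "j mod 2" "j div 2"] show ?thesis
    using assms(2,3) by (cases "even j") (auto simp: parity_cases odd_iff_mod_2_eq_one)
qed

section \<open>Smooth interpolation between nodes at the integers\<close>

locale flat_step =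
  fixes \<sigma> \<sigma>' :: "real \<Rightarrow> real" and M :: real
  assumes Ck_\<sigma>: "\<And>k. Ck k \<sigma>" and der_\<sigma>: "\<And>x. (\<sigma> has_real_derivative \<sigma>' x) (at x)"
    and \<sigma>'_le: "\<And>x. \<bar>\<sigma>' x\<bar> \<le> M" and \<sigma>_range: "\<And>x. 0 \<le> \<sigma> x \<and> \<sigma> x \<le> 1"
    and \<sigma>_0: "\<And>x. x \<le> 1/4 \<Longrightarrow> \<sigma> x = 0" and \<sigma>_1: "\<And>x. x \<ge> 3/4 \<Longrightarrow> \<sigma> x = 1"
begin

lemma \<sigma>'_0: "x < 1/4 \<or> x > 3/4 \<Longrightarrow> \<sigma>' x = 0"
proof -
  assume "x < 1/4 \<or> x > 3/4"
  then have "(\<sigma> has_real_derivative 0) (at x)"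
  proof
    assume "x < 1/4"
    then show ?thesis
      using \<sigma>_0 by (intro has_field_derivative_transform_within_open[OF DERIV_const[of 0], of "{..<1/4}"]) auto
  next
    assume "x > 3/4"
    then show ?thesis
      using \<sigma>_1 by (intro has_field_derivative_transform_within_open[OF DERIV_const[of 1], of "{3/4<..}"]) auto
  qed
  then show ?thesis using der_\<sigma> DERIV_unique by blast
qed

text \<open>Runs along the segments joining consecutive nodes and rests at \<open>p j\<close> within
  distance \<open>1/4\<close> of \<open>j\<close>. Being affine in the nodes, it inherits their
  equivariance under the shift by 2.\<close>

definition interp :: "(int \<Rightarrow> 'a::real_vector) \<Rightarrow> real \<Rightarrow> 'a" where
  "interp p s = p \<lfloor>s\<rfloor> + \<sigma> (s - \<lfloor>s\<rfloor>) *\<^sub>R (p (\<lfloor>s\<rfloor> + 1) - p \<lfloor>s\<rfloor>)"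

text \<open>A formula without the floor, valid on both sides of the node: one of the two steps is
  constant where the other one moves. Its right-hand side is smooth on the whole line, as
  \<open>Ck_local\<close> requires.\<close>

lemma interp_near:
  assumes "\<bar>s - of_int j\<bar> < 1"
  shows "interp p s = p j + ((1 - \<sigma> (s + (1 - of_int j))) *\<^sub>R (p (j - 1) - p j)
     + \<sigma> (s + (- of_int j)) *\<^sub>R (p (j + 1) - p j))"
proof (cases "s \<ge> of_int j")
  case True
  then have "\<lfloor>s\<rfloor> = j" using assms by (intro floor_unique) auto
  moreover have "\<sigma> (s + (1 - of_int j)) = 1" using True by (intro \<sigma>_1) auto
  ultimately show ?thesis by (simp add: interp_def)
next
  case False
  then have fl: "\<lfloor>s\<rfloor> = j - 1" using assms by (intro floor_unique) auto
  then have e: "s - of_int \<lfloor>s\<rfloor> = s + (1 - of_int j)" by simp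
  have "interp p s = p (j - 1) + \<sigma> (s + (1 - of_int j)) *\<^sub>R (p j - p (j - 1))"
    unfolding interp_def e unfolding fl by simp
  moreover have "\<sigma> (s + (- of_int j)) = 0" using False by (intro \<sigma>_0) auto
  ultimately show ?thesis by (simp add: scaleR_diff_left scaleR_diff_right)
qed

lemma Ck_interp: "Ck k (interp p)" for p :: "int \<Rightarrow> 'a::euclidean_space"
proof (rule Ck_local)
  fix s :: real
  let ?j = "\<lfloor>s\<rfloor>"
  let ?h = "\<lambda>s. p ?j + ((1 - \<sigma> (s + (1 - of_int ?j))) *\<^sub>R (p (?j - 1) - p ?j)
     + \<sigma> (s + (- of_int ?j)) *\<^sub>R (p (?j + 1) - p ?j))"
  have "Ck k ?h"
    by (intro Ck_add Ck_scaleR Ck_diff Ck_const Ck_linear_comp[OF Ck_\<sigma> bounded_linear_ident])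
  moreover have "s \<in> {of_int ?j - 1<..<of_int ?j + 1}"
    using of_int_floor_le[of s] floor_less_iff[of s "?j + 1"]
    by (auto intro: less_le_trans[of _ "of_int ?j"])
  ultimately show "\<exists>U h. open U \<and> s \<in> U \<and> Ck k h \<and> (\<forall>y\<in>U. interp p y = h y)"
    by (intro exI[of _ "{of_int ?j - 1<..<of_int ?j + 1}"] exI[of _ ?h] conjI ballI interp_near)
      auto
qed

lemma interp_plateau:
  assumes "\<bar>s - of_int j\<bar> \<le> 1/4" shows "interp p s = p j"
proof -
  have "\<sigma> (s + (1 - of_int j)) = 1" using assms by (intro \<sigma>_1) (simp only: abs_le_iff, linarith)
  moreover have "\<sigma> (s + (- of_int j)) = 0" using assms by (intro \<sigma>_0) (simp only: abs_le_iff, linarith)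
  ultimately show ?thesis using interp_near[of s j p] assms by simp
qed

lemma interp_shift: "interp p (s + 2) = interp (\<lambda>j. p (j + 2)) s"
  by (simp add: interp_def add.commute add.left_commute)

lemma interp_linear: "linear L \<Longrightarrow> interp (\<lambda>j. L (p j)) s = L (interp p s)"
  by (simp add: interp_def linear_add linear_scale linear_diff)

text \<open>Both interpolants use the same weights \<open>1 - u\<close> and \<open>u\<close>. In the
  expansion the squares of the weights multiply the positive pairings at equal nodes and do not both
  vanish; the mixed pairings only have to be nonnegative.\<close>

lemma inner_interp_pos:
  fixes p q :: "int \<Rightarrow> 'a::euclidean_space"
  assumes "\<And>j. q j \<bullet> p j > 0" "\<And>j. q j \<bullet> p (j + 1) \<ge> 0" "\<And>j. q (j + 1) \<bullet> p j \<ge> 0"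
  shows "interp q s \<bullet> interp p s > 0"
proof -
  let ?j = "\<lfloor>s\<rfloor>" and ?u = "\<sigma> (s - \<lfloor>s\<rfloor>)"
  have u: "0 \<le> ?u" "?u \<le> 1" using \<sigma>_range by auto
  have "interp q s \<bullet> interp p s = (1 - ?u)\<^sup>2 * (q ?j \<bullet> p ?j) + ?u\<^sup>2 * (q (?j + 1) \<bullet> p (?j + 1))
      + ?u * (1 - ?u) * (q ?j \<bullet> p (?j + 1) + q (?j + 1) \<bullet> p ?j)"
    by (simp add: interp_def inner_add_left inner_add_right inner_diff_left inner_diff_right
        power2_eq_square algebra_simps)
  moreover have "?u * (1 - ?u) * (q ?j \<bullet> p (?j + 1) + q (?j + 1) \<bullet> p ?j) \<ge> 0"
    using u assms(2,3)[of ?j] by (intro mult_nonneg_nonneg add_nonneg_nonneg) auto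
  moreover have "(1 - ?u)\<^sup>2 * (q ?j \<bullet> p ?j) + ?u\<^sup>2 * (q (?j + 1) \<bullet> p (?j + 1)) > 0"
  proof (cases "?u = 0")
    case False
    then show ?thesis using assms(1)[of ?j] assms(1)[of "?j + 1"]
      by (intro add_nonneg_pos mult_nonneg_nonneg mult_pos_pos) auto
  qed (use assms(1) in auto)
  ultimately show ?thesis by linarith
qed

lemma interp_has_derivative:
  fixes r :: "int \<Rightarrow> real" and s :: real
  shows "(interp r has_real_derivative \<sigma>' (s - \<lfloor>s\<rfloor>) * (r (\<lfloor>s\<rfloor> + 1) - r \<lfloor>s\<rfloor>)) (at s)"
proof -
  let ?j = "\<lfloor>s\<rfloor>"
  let ?h = "\<lambda>s. r ?j + ((1 - \<sigma> (s + (1 - of_int ?j))) *\<^sub>R (r (?j - 1) - r ?j)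
     + \<sigma> (s + (- of_int ?j)) *\<^sub>R (r (?j + 1) - r ?j))"
  have j: "of_int ?j \<le> s" "s < of_int ?j + 1" using floor_correct[of s] by simp_all
  have "(?h has_real_derivative 0 + ((0 - \<sigma>' (s + (1 - of_int ?j))) * (r (?j - 1) - r ?j)
     + \<sigma>' (s + (- of_int ?j)) * (r (?j + 1) - r ?j))) (at s)"
  proof -
    have *: "((\<lambda>s. \<sigma> (s + c)) has_real_derivative \<sigma>' (s + c)) (at s)" for c
      using DERIV_shift[of \<sigma> "\<sigma>' (s + c)" s c] der_\<sigma> by simp
    then show ?thesis unfolding real_scaleR_def
      by (intro DERIV_add DERIV_const DERIV_cmult_right DERIV_diff *)
  qed
  moreover have "\<sigma>' (s + (1 - of_int ?j)) = 0" using j by (intro \<sigma>'_0 disjI2) linarith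
  ultimately have "(?h has_real_derivative \<sigma>' (s - ?j) * (r (?j + 1) - r ?j)) (at s)" by simp
  then show ?thesis
  proof (rule has_field_derivative_transform_within_open)
    show "open {of_int ?j - 1<..<of_int ?j + 1 :: real}" by simp
    show "?h x = interp r x" if "x \<in> {of_int ?j - 1<..<of_int ?j + 1}" for x
      using that interp_near[of x ?j r] by (simp add: abs_less_iff)
  qed (use j in \<open>unfold greaterThanLessThan_iff, intro conjI; linarith\<close>)
qed

lemma interp_bounds:
  fixes r :: "int \<Rightarrow> real" and s :: real
  shows "min (r \<lfloor>s\<rfloor>) (r (\<lfloor>s\<rfloor> + 1)) \<le> interp r s" "interp r s \<le> max (r \<lfloor>s\<rfloor>) (r (\<lfloor>s\<rfloor> + 1))"
proof -
  let ?u = "\<sigma> (s - \<lfloor>s\<rfloor>)" and ?a = "r \<lfloor>s\<rfloor>" and ?b = "r (\<lfloor>s\<rfloor> + 1)"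
  have u: "0 \<le> ?u" "?u \<le> 1" using \<sigma>_range by auto
  have eq: "interp r s = (1 - ?u) * ?a + ?u * ?b" by (simp add: interp_def algebra_simps)
  have "(1 - ?u) * min ?a ?b + ?u * min ?a ?b \<le> interp r s"
    unfolding eq using u by (intro add_mono mult_left_mono) auto
  then show "min ?a ?b \<le> interp r s" by (simp add: algebra_simps)
  have "interp r s \<le> (1 - ?u) * max ?a ?b + ?u * max ?a ?b"
    unfolding eq using u by (intro add_mono mult_left_mono) auto
  then show "interp r s \<le> max ?a ?b" by (simp add: algebra_simps)
qed

end

text \<open>At integer heights \<open>p\<close> spans the stable line and the kernel of
  \<open>q\<close> is the unstable hyperplane. Even nodes make this hyperplane the kernel of
  \<open>\<phi>\<close>, odd nodes put the stable line into it. Covectors move by the transpose of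
  \<open>B\<close>, which preserves their pairing with vectors moved by \<open>A\<close>; the sign
  conditions keep line and hyperplane transverse between the nodes as well.\<close>

locale drift_frame = flat_step +
  fixes A B :: "real^'n^'n" and v \<phi> :: "real^'n" and p q :: "int \<Rightarrow> real^'n"
  assumes AB: "A ** B = mat 1" "B ** A = mat 1"
    and \<phi>_fixed: "transpose A *v \<phi> = \<phi>" and \<phi>_v: "\<phi> \<bullet> v = 2"
    and p_step: "p (j + 2) = A *v p j" and q_step: "q (j + 2) = transpose B *v q j"
    and pairing: "q j \<bullet> p j > 0" "q j \<bullet> p (j + 1) \<ge> 0" "q (j + 1) \<bullet> p j \<ge> 0"
    and q_even: "even j \<Longrightarrow> q j = \<phi>"
    and p_odd: "odd j \<Longrightarrow> \<phi> \<bullet> p j = 0" "odd j \<Longrightarrow> q j \<bullet> p j = 1"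
begin

abbreviation "f \<equiv> affine_map A v"
abbreviation "f' \<equiv> affine_map B (- (B *v v))"

definition "e = interp p"
definition "w = interp q"
definition "D s = w s \<bullet> e s"

lemma D_pos: "D s > 0"
  unfolding D_def e_def w_def by (intro inner_interp_pos pairing)

lemma e_shift: "e (s + 2) = A *v e s"
  unfolding e_def interp_shift p_step by (rule interp_linear[OF matrix_vector_mul_linear])

lemma w_shift: "w (s + 2) = transpose B *v w s"
  unfolding w_def interp_shift q_step by (rule interp_linear[OF matrix_vector_mul_linear])

lemma w_shift_inner: "w (s + 2) \<bullet> (A *v a) = w s \<bullet> a"
  by (simp only: w_shift inner_matrix_vector_mult[symmetric] mult_inverse[OF AB])

lemma D_shift: "D (s + 2) = D s"
  by (simp add: D_def e_shift w_shift_inner)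

lemma \<phi>_A: "\<phi> \<bullet> (A *v a) = \<phi> \<bullet> a"
  by (simp only: inner_matrix_vector_mult \<phi>_fixed)

lemma \<phi>_B: "\<phi> \<bullet> (B *v a) = \<phi> \<bullet> a"
  using \<phi>_A[of "B *v a"] by (simp add: mult_inverse[OF AB])

lemma \<phi>_f: "\<phi> \<bullet> f x = \<phi> \<bullet> x + 2"
  by (simp add: affine_map_def inner_add_right \<phi>_A \<phi>_v)

lemma \<phi>_f': "\<phi> \<bullet> f' x = \<phi> \<bullet> x - 2"
  by (simp add: affine_map_def inner_diff_right \<phi>_B \<phi>_v)

lemma \<phi>_nz: "\<phi> \<noteq> 0"
  using \<phi>_v by auto

definition pr :: "real \<Rightarrow> real^'n \<Rightarrow> real^'n" where
  "pr s a = D s *\<^sub>R a - (w s \<bullet> a) *\<^sub>R e s"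

text \<open>
  \<open>E\<^sup>s\<close> is spanned by \<open>e\<close> and \<open>E\<^sup>u\<close> is the kernel of \<open>w\<close>; \<open>w\<close> and \<open>pr\<close> are the two components
  of a vector, up to the factor \<open>D\<close>, which is \<open>f\<close>-invariant and spares the division.
\<close>

definition g :: "real \<Rightarrow> real^'n \<Rightarrow> real^'n \<Rightarrow> real^'n \<Rightarrow> real" where
  "g \<Lambda> x a b = exp (- 2 * (\<phi> \<bullet> x)) * ((w (\<phi> \<bullet> x) \<bullet> a) * (w (\<phi> \<bullet> x) \<bullet> b))
     + exp (2 * \<Lambda> * (\<phi> \<bullet> x)) * (pr (\<phi> \<bullet> x) a \<bullet> pr (\<phi> \<bullet> x) b)"

lemma linear_pr: "linear (pr s)"
  unfolding pr_def by (intro linearI) (auto simp: algebra_simps inner_add_right)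

lemma riemannian_metric_g: "riemannian_metric (g \<Lambda>)"
  unfolding riemannian_metric_def
proof (intro conjI allI impI)
  fix x a b
  let ?s = "\<phi> \<bullet> x"
  show "bilinear (g \<Lambda> x)"
    unfolding bilinear_def g_def
    by (intro conjI allI linearI)
      (simp_all add: linear_add[OF linear_pr] linear_scale[OF linear_pr] inner_add_left inner_add_right
        algebra_simps)
  show "g \<Lambda> x a b = g \<Lambda> x b a"
    by (simp add: g_def inner_commute mult.commute)
  show "g \<Lambda> x a a > 0" if "a \<noteq> 0"
  proof (cases "w ?s \<bullet> a = 0")
    case True
    then have "pr ?s a = D ?s *\<^sub>R a" by (simp add: pr_def)
    then have "pr ?s a \<bullet> pr ?s a > 0" using D_pos[of ?s] that by simp
    then show ?thesis by (simp add: g_def True)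
  next
    case False
    then have "(w ?s \<bullet> a) * (w ?s \<bullet> a) > 0" using not_real_square_gt_zero by blast
    from add_pos_nonneg[OF mult_pos_pos[OF exp_gt_zero this]
        mult_nonneg_nonneg[OF exp_ge_zero inner_ge_zero]]
    show ?thesis unfolding g_def .
  qed
next
  fix a b
  have Ck_e: "Ck k e" and Ck_w: "Ck k w" for k
    unfolding e_def w_def by (rule Ck_interp)+
  have Ck_pr: "Ck k (\<lambda>s. pr s a)" for k a
    unfolding pr_def D_def by (intro Ck_diff Ck_scaleR Ck_inner Ck_const Ck_e Ck_w)
  have "Ck k (\<lambda>s. exp (- 2 * s) * ((w s \<bullet> a) * (w s \<bullet> b)) + exp (2 * \<Lambda> * s) * (pr s a \<bullet> pr s b))" for k
    by (intro Ck_add Ck_mult Ck_inner Ck_const Ck_w Ck_pr Ck_exp)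
  from Ck_linear_comp[OF this bounded_linear_inner_right[of \<phi>], of _ 0]
  show "smooth_map (\<lambda>x. g \<Lambda> x a b)"
    unfolding smooth_map_def g_def by simp
qed

lemma rnorm_stable: "rnorm (g \<Lambda>) x (c *\<^sub>R e (\<phi> \<bullet> x)) = exp (- (\<phi> \<bullet> x)) * (\<bar>c\<bar> * D (\<phi> \<bullet> x))"
proof -
  let ?s = "\<phi> \<bullet> x"
  have "pr ?s (c *\<^sub>R e ?s) = 0" by (simp add: pr_def D_def)
  moreover have "w ?s \<bullet> (c *\<^sub>R e ?s) = c * D ?s" by (simp add: D_def)
  moreover have "exp (- 2 * ?s) = exp (- ?s) * exp (- ?s)" by (simp flip: exp_add)
  ultimately have "g \<Lambda> x (c *\<^sub>R e ?s) (c *\<^sub>R e ?s) = (exp (- ?s) * (c * D ?s))\<^sup>2"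
    unfolding g_def by (simp add: power2_eq_square D_def)
  then show ?thesis using D_pos[of ?s] by (simp add: rnorm_def abs_mult)
qed

lemma rnorm_unstable:
  assumes "w (\<phi> \<bullet> x) \<bullet> a = 0"
  shows "rnorm (g \<Lambda>) x a = exp (\<Lambda> * (\<phi> \<bullet> x)) * (D (\<phi> \<bullet> x) * norm a)"
proof -
  let ?s = "\<phi> \<bullet> x"
  have "exp (2 * \<Lambda> * ?s) = exp (\<Lambda> * ?s) * exp (\<Lambda> * ?s)" by (simp flip: exp_add)
  then have "g \<Lambda> x a a = (exp (\<Lambda> * ?s) * (D ?s * norm a))\<^sup>2"
    using assms by (simp add: g_def pr_def power2_eq_square flip: power2_norm_eq_inner)
  then show ?thesis using D_pos[of ?s] by (simp add: rnorm_def abs_mult)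
qed

lemma component_le_rnorm:
  "exp (- (\<phi> \<bullet> x)) * \<bar>w (\<phi> \<bullet> x) \<bullet> a\<bar> \<le> rnorm (g \<Lambda>) x a"
  "exp (\<Lambda> * (\<phi> \<bullet> x)) * norm (pr (\<phi> \<bullet> x) a) \<le> rnorm (g \<Lambda>) x a"
proof -
  let ?s = "\<phi> \<bullet> x"
  have "exp (2 * \<Lambda> * ?s) = exp (\<Lambda> * ?s) * exp (\<Lambda> * ?s)" "exp (- 2 * ?s) = exp (- ?s) * exp (- ?s)"
    by (simp_all flip: exp_add)
  then have eq: "g \<Lambda> x a a = (exp (- ?s) * \<bar>w ?s \<bullet> a\<bar>)\<^sup>2 + (exp (\<Lambda> * ?s) * norm (pr ?s a))\<^sup>2"
    by (simp add: g_def power_mult_distrib power2_eq_square flip: power2_norm_eq_inner)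
  show "exp (- ?s) * \<bar>w ?s \<bullet> a\<bar> \<le> rnorm (g \<Lambda>) x a" "exp (\<Lambda> * ?s) * norm (pr ?s a) \<le> rnorm (g \<Lambda>) x a"
    unfolding rnorm_def eq by (rule real_le_rsqrt; simp)+
qed

lemma continuous_splitting_frame:
  "continuous_splitting (\<lambda>x. span {e (\<phi> \<bullet> x)}) (\<lambda>x. {a. w (\<phi> \<bullet> x) \<bullet> a = 0})"
proof -
  have we: "w s \<bullet> e s \<noteq> 0" for s using D_pos[of s] by (simp add: D_def)
  have cont: "continuous_on UNIV (\<lambda>x. e (\<phi> \<bullet> x))" "continuous_on UNIV (\<lambda>x. w (\<phi> \<bullet> x))"
    unfolding e_def w_def
    by (intro continuous_on_compose2[OF Ck_imp_continuous_on[OF Ck_interp]] continuous_intros subset_UNIV)+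
  show ?thesis
    unfolding continuous_splitting_def
  proof (intro conjI allI continuous_subbundle_line cont
      continuous_subbundle_hyperplane[OF cont we])
    fix x
    let ?s = "\<phi> \<bullet> x"
    show "e ?s \<noteq> 0" using we[of ?s] by auto
    show "span {e ?s} \<inter> {a. w ?s \<bullet> a = 0} = {0}"
      using we[of ?s] by (auto simp: span_singleton)
    show "{a + b |a b. a \<in> span {e ?s} \<and> b \<in> {a. w ?s \<bullet> a = 0}} = UNIV"
    proof (intro set_eqI iffI UNIV_I)
      fix y
      let ?c = "(w ?s \<bullet> y) / (w ?s \<bullet> e ?s)"
      have "y = ?c *\<^sub>R e ?s + (y - ?c *\<^sub>R e ?s)" by simp
      moreover have "w ?s \<bullet> (y - ?c *\<^sub>R e ?s) = 0" using we[of ?s] by (simp add: inner_diff_right)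
      ultimately show "y \<in> {a + b |a b. a \<in> span {e ?s} \<and> b \<in> {a. w ?s \<bullet> a = 0}}"
        unfolding span_singleton by blast
    qed
  qed
qed

lemma e_shift_n: "e (s + 2 * real m) = ((*v) A ^^ m) (e s)"
proof (induction m)
  case (Suc m)
  have "e (s + 2 * real (Suc m)) = e (s + 2 * real m + 2)" by (simp add: algebra_simps)
  then show ?case by (simp add: e_shift Suc)
qed simp

lemma D_shift_n: "D (s + 2 * real m) = D s"
proof (induction m)
  case (Suc m)
  have "D (s + 2 * real (Suc m)) = D (s + 2 * real m + 2)" by (simp add: algebra_simps)
  then show ?case by (simp add: D_shift Suc)
qed simp

lemma \<phi>_f_n: "\<phi> \<bullet> (f ^^ m) x = \<phi> \<bullet> x + 2 * real m" "\<phi> \<bullet> (f' ^^ m) x = \<phi> \<bullet> x - 2 * real m"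
  by (induction m) (auto simp: \<phi>_f \<phi>_f')

lemma w_backward: "w (s - 2 * real m) \<bullet> ((*v) B ^^ m) a = w s \<bullet> a"
proof (induction m arbitrary: a)
  case (Suc m)
  have "w (s - 2 * real (Suc m)) \<bullet> ((*v) B ^^ Suc m) a = w (s - 2 * real (Suc m) + 2) \<bullet> ((*v) B ^^ m) a"
    using w_shift_inner[of "s - 2 * real (Suc m)" "B *v ((*v) B ^^ m) a"]
    by (simp only: funpow.simps o_apply mult_inverse[OF AB])
  also have "s - 2 * real (Suc m) + 2 = s - 2 * real m" by simp
  finally show ?case by (simp add: Suc)
qed simp

text \<open>The frame vector is transported exactly and \<open>D\<close> is invariant, so on the
  stable line only the weight changes, by \<open>exp (- 2)\<close> per step as the height grows by
  2. On the unstable hyperplane a backward step may stretch by \<open>\<beta>\<close> while the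
  weight shrinks by \<open>exp (- 2 * \<Lambda>)\<close>; the last assumption balances the
  two.\<close>

lemma anosov_frame:
  assumes \<beta>: "\<And>a. norm (B *v a) \<le> \<beta> * norm a" "\<beta> > 0" "\<beta> * exp (- 2 * \<Lambda>) \<le> exp (- 2)"
  shows "anosov_wrt f (g \<Lambda>)"
proof (rule anosov_affine_mapI[OF AB riemannian_metric_g continuous_splitting_frame,
      where C = 1 and r = "exp (- 2)"])
  fix x
  let ?s = "\<phi> \<bullet> x"
  show "(*v) A ` span {e ?s} = span {e (\<phi> \<bullet> f x)}"
    by (simp add: \<phi>_f e_shift flip: linear_span_image[OF matrix_vector_mul_linear])
  show "(*v) A ` {a. w ?s \<bullet> a = 0} = {a. w (\<phi> \<bullet> f x) \<bullet> a = 0}"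
  proof
    show "{a. w (\<phi> \<bullet> f x) \<bullet> a = 0} \<subseteq> (*v) A ` {a. w ?s \<bullet> a = 0}"
    proof
      fix a assume "a \<in> {a. w (\<phi> \<bullet> f x) \<bullet> a = 0}"
      then have "w ?s \<bullet> (B *v a) = 0" "a = A *v (B *v a)"
        using w_shift_inner[of ?s "B *v a"] by (auto simp: \<phi>_f mult_inverse[OF AB])
      then show "a \<in> (*v) A ` {a. w ?s \<bullet> a = 0}" by blast
    qed
  qed (auto simp: \<phi>_f w_shift_inner)
next
  fix m x a assume "a \<in> span {e (\<phi> \<bullet> x)}"
  then obtain c where c: "a = c *\<^sub>R e (\<phi> \<bullet> x)" by (auto simp: span_singleton)
  have "((*v) A ^^ m) a = c *\<^sub>R e (\<phi> \<bullet> (f ^^ m) x)"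
    by (simp add: c linear_scale[OF linear_funpow[OF matrix_vector_mul_linear]] \<phi>_f_n e_shift_n)
  then have "rnorm (g \<Lambda>) ((f ^^ m) x) (((*v) A ^^ m) a)
      = exp (- (\<phi> \<bullet> x + 2 * real m)) * (\<bar>c\<bar> * D (\<phi> \<bullet> x))"
    by (simp only: rnorm_stable) (simp add: \<phi>_f_n D_shift_n)
  also have "exp (- (\<phi> \<bullet> x + 2 * real m)) = exp (- 2) ^ m * exp (- (\<phi> \<bullet> x))"
    by (simp flip: exp_of_nat_mult exp_add)
  finally show "rnorm (g \<Lambda>) ((f ^^ m) x) (((*v) A ^^ m) a) \<le> 1 * exp (- 2) ^ m * rnorm (g \<Lambda>) x a"
    by (simp add: c rnorm_stable)
next
  fix m x a assume "a \<in> {a. w (\<phi> \<bullet> x) \<bullet> a = 0}"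
  then have a: "w (\<phi> \<bullet> x) \<bullet> a = 0" by simp
  let ?s = "\<phi> \<bullet> x"
  have B: "norm (((*v) B ^^ m) a) \<le> \<beta> ^ m * norm a"
  proof (induction m)
    case (Suc m)
    have "norm (((*v) B ^^ Suc m) a) \<le> \<beta> * norm (((*v) B ^^ m) a)" using \<beta>(1) by simp
    also have "\<dots> \<le> \<beta> * (\<beta> ^ m * norm a)" using Suc \<beta>(2) by (intro mult_left_mono) auto
    finally show ?case by (simp add: mult.assoc)
  qed simp
  have "D (?s - 2 * real m) = D ?s" using D_shift_n[of "?s - 2 * real m" m] by simp
  then have "rnorm (g \<Lambda>) ((f' ^^ m) x) (((*v) B ^^ m) a)
      = exp (\<Lambda> * (?s - 2 * real m)) * (D ?s * norm (((*v) B ^^ m) a))"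
    using w_backward[of ?s m a] a by (subst rnorm_unstable) (auto simp: \<phi>_f_n)
  also have "exp (\<Lambda> * (?s - 2 * real m)) = exp (- 2 * \<Lambda>) ^ m * exp (\<Lambda> * ?s)"
    by (simp add: algebra_simps flip: exp_of_nat_mult exp_add)
  also have "exp (- 2 * \<Lambda>) ^ m * exp (\<Lambda> * ?s) * (D ?s * norm (((*v) B ^^ m) a))
      \<le> exp (- 2 * \<Lambda>) ^ m * exp (\<Lambda> * ?s) * (D ?s * (\<beta> ^ m * norm a))"
    using B D_pos[of ?s] by (intro mult_left_mono) auto
  also have "\<dots> = (\<beta> * exp (- 2 * \<Lambda>)) ^ m * (exp (\<Lambda> * ?s) * (D ?s * norm a))"
    by (simp add: power_mult_distrib mult_ac)
  also have "\<dots> \<le> exp (- 2) ^ m * (exp (\<Lambda> * ?s) * (D ?s * norm a))"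
    using \<beta>(2,3) D_pos[of ?s] by (intro mult_right_mono power_mono) auto
  finally show "rnorm (g \<Lambda>) ((f' ^^ m) x) (((*v) B ^^ m) a) \<le> 1 * exp (- 2) ^ m * rnorm (g \<Lambda>) x a"
    using a by (simp add: rnorm_unstable)
qed auto

text \<open>
  Near odd integers \<open>e\<close> is tangent to the levels of \<open>\<phi>\<close>, near even ones \<open>w\<close> is conormal to them.
  Hence crossing an odd level is costly for \<open>\<phi> \<ge> 0\<close>, and crossing an even one for \<open>\<phi> \<le> 0\<close>.
\<close>

lemma barrier_odd:
  assumes "odd j" "\<bar>\<phi> \<bullet> x - of_int j\<bar> \<le> 1/4" "\<phi> \<bullet> x \<ge> 0" "\<Lambda> \<ge> 0"
  shows "\<bar>\<phi> \<bullet> a\<bar> \<le> norm \<phi> * rnorm (g \<Lambda>) x a"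
proof -
  let ?s = "\<phi> \<bullet> x"
  have "e ?s = p j" "w ?s = q j"
    unfolding e_def w_def using assms(2) by (auto intro: interp_plateau)
  \<comment> \<open>On an odd plateau \<open>e\<close> lies in the kernel of \<open>\<phi>\<close>
    and \<open>D = 1\<close>, so \<open>pr\<close> does not change the value of
    \<open>\<phi>\<close>.\<close>
  then have "\<phi> \<bullet> pr ?s a = \<phi> \<bullet> a"
    using p_odd[OF assms(1)] by (simp add: pr_def D_def inner_diff_right)
  then have "\<bar>\<phi> \<bullet> a\<bar> \<le> norm \<phi> * norm (pr ?s a)"
    using Cauchy_Schwarz_ineq2[of \<phi> "pr ?s a"] by simp
  moreover have "norm (pr ?s a) \<le> exp (\<Lambda> * ?s) * norm (pr ?s a)"
    using assms(3,4) by (simp add: mult_le_cancel_right1)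
  ultimately show ?thesis
    using component_le_rnorm(2)[of \<Lambda> x a] by (meson mult_left_mono norm_ge_zero order_trans)
qed

text \<open>The height is allowed up to \<open>1\<close>, since the plateau of the level
  \<open>0\<close> reaches above \<open>0\<close>; this costs the factor
  \<open>exp 1\<close>.\<close>

lemma barrier_even:
  assumes "even j" "\<bar>\<phi> \<bullet> x - of_int j\<bar> \<le> 1/4" "\<phi> \<bullet> x \<le> 1"
  shows "\<bar>\<phi> \<bullet> a\<bar> \<le> exp 1 * rnorm (g \<Lambda>) x a"
proof -
  let ?s = "\<phi> \<bullet> x"
  have "w ?s = \<phi>"
    unfolding w_def using assms(1,2) interp_plateau q_even by metis
  then have "exp (- ?s) * \<bar>\<phi> \<bullet> a\<bar> \<le> rnorm (g \<Lambda>) x a"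
    using component_le_rnorm(1)[of x a \<Lambda>] by simp
  moreover have "exp (- 1) * \<bar>\<phi> \<bullet> a\<bar> \<le> exp (- ?s) * \<bar>\<phi> \<bullet> a\<bar>"
    using assms(3) by (intro mult_right_mono) auto
  ultimately have "exp 1 * (exp (- 1) * \<bar>\<phi> \<bullet> a\<bar>) \<le> exp 1 * rnorm (g \<Lambda>) x a"
    by (intro mult_left_mono) auto
  then show ?thesis by (simp add: exp_minus field_simps)
qed

text \<open>The strip is not compact, but the metric depends on \<open>x\<close> only through
  \<open>\<phi> \<bullet> x\<close>, so a compact segment in the direction of \<open>\<phi>\<close>
  represents all its points.\<close>

lemma rnorm_ge_on_strip:
  "\<exists>c>0. \<forall>x a. \<bar>\<phi> \<bullet> x\<bar> \<le> T \<longrightarrow> c * norm a \<le> rnorm (g \<Lambda>) x a"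
proof -
  define h where "h s = (s / (\<phi> \<bullet> \<phi>)) *\<^sub>R \<phi>" for s
  have "compact (h ` {-T..T})"
    unfolding h_def by (intro compact_continuous_image continuous_intros) (use \<phi>_nz in auto)
  then obtain c where c: "c > 0" "\<forall>x\<in>h ` {-T..T}. \<forall>a. c * norm a \<le> rnorm (g \<Lambda>) x a"
    using rnorm_bounds_compact[OF riemannian_metric_g] by meson
  have eq: "rnorm (g \<Lambda>) x a = rnorm (g \<Lambda>) (h (\<phi> \<bullet> x)) a" for x a
  proof -
    have "\<phi> \<bullet> h (\<phi> \<bullet> x) = \<phi> \<bullet> x" using \<phi>_nz by (simp add: h_def)
    then show ?thesis by (simp add: rnorm_def g_def)
  qed
  have "c * norm a \<le> rnorm (g \<Lambda>) x a" if "\<bar>\<phi> \<bullet> x\<bar> \<le> T" for x a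
  proof -
    have "h (\<phi> \<bullet> x) \<in> h ` {-T..T}" using that by (intro imageI) (simp add: abs_le_iff)
    then show ?thesis using c(2) unfolding eq[of x] by blast
  qed
  then show ?thesis using c(1) by blast
qed

text \<open>The barrier is a staircase in the height that moves only near costly levels, where the
  two preceding estimates bound its slope. It climbs by one per period in both directions, so its
  sublevel sets lie in strips.\<close>

lemma complete_g:
  assumes "\<Lambda> \<ge> 0" shows "complete_riemannian_metric (g \<Lambda>)"
proof -
  \<comment> \<open>\<open>r\<close> increases exactly across the odd levels above \<open>0\<close> and the even levels up to \<open>0\<close>; the shift by
    \<open>1/2\<close> moves the transitions of the interpolant onto these levels.\<close>
  define r :: "int \<Rightarrow> real" where "r j = of_int (if j \<ge> 0 then (j + 1) div 2 else j div 2)" for j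
  define \<rho> where "\<rho> u = \<sigma>' (u - \<lfloor>u\<rfloor>) * (r (\<lfloor>u\<rfloor> + 1) - r \<lfloor>u\<rfloor>)" for u :: real
  define \<psi> where "\<psi> x = interp r (\<phi> \<bullet> x - 1/2)" for x
  have r_incr: "r (j + 1) - r j = (if j \<ge> 0 \<and> even j \<or> j < 0 \<and> odd j then 1 else 0)" for j
  proof -
    consider "j \<ge> 0" | "j = -1" | "j < -1" by linarith
    then show ?thesis
      by cases (auto simp: r_def elim!: evenE oddE)
  qed
  have r_large: "r j \<ge> j / 2" if "j \<ge> 0" for j :: int
  proof -
    have "2 * ((j + 1) div 2) \<ge> j" by linarith
    then show ?thesis using that by (simp add: r_def)
  qed
  have r_small: "r j \<le> j / 2" if "j \<le> 0" for j :: int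
  proof -
    have "2 * (j div 2) \<le> j" by linarith
    then show ?thesis using that by (cases "j = 0") (auto simp: r_def)
  qed
  have "M \<ge> 0" using \<sigma>'_le[of 0] by linarith
  have der: "(\<psi> has_derivative (\<lambda>a. \<rho> (\<phi> \<bullet> x - 1/2) * (\<phi> \<bullet> a))) (at x)" for x
  proof -
    have "((\<lambda>x. \<phi> \<bullet> x - 1/2) has_derivative (\<lambda>a. \<phi> \<bullet> a)) (at x)"
      by (auto intro!: derivative_eq_intros)
    from has_derivative_compose[OF this interp_has_derivative[unfolded has_field_derivative_def]]
    show ?thesis unfolding \<psi>_def \<rho>_def by simp
  qed
  have slope: "\<bar>\<rho> (\<phi> \<bullet> x - 1/2) * (\<phi> \<bullet> a)\<bar> \<le> M * (norm \<phi> + exp 1) * rnorm (g \<Lambda>) x a" for x a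
  proof (cases "\<rho> (\<phi> \<bullet> x - 1/2) = 0")
    case True
    then show ?thesis
      using \<open>M \<ge> 0\<close> rnorm_nonneg[OF riemannian_metric_g, of \<Lambda> x a] by simp
  next
    case False
    let ?u = "\<phi> \<bullet> x - 1/2" and ?N = "rnorm (g \<Lambda>) x a"
    let ?j = "\<lfloor>?u\<rfloor>"
    have N: "?N \<ge> 0" by (rule rnorm_nonneg[OF riemannian_metric_g])
    have "\<sigma>' (?u - ?j) \<noteq> 0" and incr: "r (?j + 1) - r ?j \<noteq> 0"
      using False by (auto simp: \<rho>_def)
    then have "\<not> ?u - ?j < 1/4" "\<not> ?u - ?j > 3/4" using \<sigma>'_0 by blast+
    \<comment> \<open>The transition of the step, between \<open>1/4\<close> and \<open>3/4\<close>,
      becomes after the shift by \<open>1/2\<close> the plateau around the level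
      \<open>?j + 1\<close>.\<close>
    then have near: "\<bar>\<phi> \<bullet> x - of_int (?j + 1)\<bar> \<le> 1/4"
      by (subst abs_le_iff) (simp only: of_int_add of_int_1, linarith)
    have \<rho>: "\<bar>\<rho> ?u\<bar> \<le> M"
      using incr \<sigma>'_le[of "?u - ?j"] unfolding \<rho>_def by (auto simp: r_incr abs_mult split: if_splits)
    have "\<bar>\<phi> \<bullet> a\<bar> \<le> (norm \<phi> + exp 1) * ?N"
    proof (cases "?j \<ge> 0")
      case True
      then have "odd (?j + 1)" using incr by (auto simp: r_incr split: if_splits)
      moreover have "\<phi> \<bullet> x \<ge> 0" using True by linarith
      ultimately have "\<bar>\<phi> \<bullet> a\<bar> \<le> norm \<phi> * ?N" by (rule barrier_odd[OF _ near _ assms])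
      then show ?thesis using N by (simp add: distrib_right add_increasing2)
    next
      case False
      then have "even (?j + 1)" using incr by (auto simp: r_incr split: if_splits)
      moreover have "\<phi> \<bullet> x \<le> 1" using False by linarith
      ultimately have "\<bar>\<phi> \<bullet> a\<bar> \<le> exp 1 * ?N" by (rule barrier_even[OF _ near])
      then show ?thesis using N by (simp add: distrib_right add_increasing)
    qed
    then have "\<bar>\<rho> ?u\<bar> * \<bar>\<phi> \<bullet> a\<bar> \<le> M * ((norm \<phi> + exp 1) * ?N)"
      using \<rho> \<open>M \<ge> 0\<close> by (intro mult_mono) auto
    then show ?thesis by (simp add: abs_mult mult.assoc)
  qed
  have strip: "\<bar>\<phi> \<bullet> x\<bar> \<le> 2 * T + 3" if "\<bar>\<psi> x\<bar> \<le> T" for x T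
  proof -
    let ?u = "\<phi> \<bullet> x - 1/2"
    let ?j = "\<lfloor>?u\<rfloor>"
    have j: "of_int ?j \<le> ?u" "?u < of_int ?j + 1" by linarith+
    have T: "T \<ge> 0" using that by linarith
    have mono: "r ?j \<le> r (?j + 1)" using r_incr[of ?j] by (auto split: if_splits)
    show ?thesis
    proof (cases "?j \<ge> 0")
      case True
      then have "?j / 2 \<le> \<psi> x"
        using r_large[OF True] interp_bounds(1)[of r ?u] mono unfolding \<psi>_def by linarith
      then show ?thesis using that j True T by linarith
    next
      case False
      then have "\<psi> x \<le> of_int (?j + 1) / 2"
        using r_small[of "?j + 1"] interp_bounds(2)[of r ?u] mono unfolding \<psi>_def by linarith
      then have "2 * \<psi> x \<le> of_int ?j + 1" by simp
      then have "\<phi> \<bullet> x \<ge> - (2 * T + 3)"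
        using abs_le_D2[OF that] j(1) by linarith
      moreover have "of_int ?j \<le> (- 1 :: real)" using False by linarith
      then have "\<phi> \<bullet> x \<le> 2 * T + 3" using j(2) T by linarith
      ultimately show ?thesis by (simp add: abs_le_iff)
    qed
  qed
  show ?thesis
  proof (rule complete_riemannian_metric_barrier[OF riemannian_metric_g der slope])
    show "M * (norm \<phi> + exp 1) \<ge> 0" using \<open>M \<ge> 0\<close> by simp
    show "\<exists>c>0. \<forall>x a. \<bar>\<psi> x\<bar> \<le> T \<longrightarrow> c * norm a \<le> rnorm (g \<Lambda>) x a" for T
      using rnorm_ge_on_strip[of "2 * T + 3"] strip by meson
  qed
qed

lemma frame_imp_anosov: "\<exists>G. complete_riemannian_metric G \<and> anosov_wrt f G"
proof -
  obtain b where b: "b > 0" "\<And>a. norm (B *v a) \<le> norm a * b"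
    using bounded_linear.pos_bounded[OF matrix_vector_mul_bounded_linear] by blast
  define \<beta> where "\<beta> = max 1 b"
  have \<beta>: "\<beta> \<ge> 1" "norm (B *v a) \<le> \<beta> * norm a" for a
    using order_trans[OF b(2) mult_left_mono[of b \<beta> "norm a"]] by (auto simp: \<beta>_def mult.commute)
  \<comment> \<open>The solution of \<open>\<beta> * exp (- 2 * \<Lambda>) = exp (- 2)\<close>;
    enlarging \<open>\<beta>\<close> to at least \<open>1\<close> keeps it nonnegative.\<close>
  define \<Lambda> where "\<Lambda> = 1 + ln \<beta> / 2"
  have "\<beta> * exp (- 2 * \<Lambda>) = \<beta> * (exp (- 2) * exp (- ln \<beta>))"
    by (simp add: \<Lambda>_def algebra_simps flip: exp_add)
  also have "\<dots> = exp (- 2)" using \<beta>(1) by (simp add: exp_minus)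
  finally have "\<beta> * exp (- 2 * \<Lambda>) \<le> exp (- 2)" by simp
  moreover have "\<Lambda> \<ge> 0" using \<beta>(1) by (simp add: \<Lambda>_def)
  ultimately show ?thesis
    using complete_g anosov_frame[OF \<beta>(2)] \<beta>(1) by (meson less_le_trans zero_less_one)
qed

end

section \<open>Construction of the frame for a fixed-point free map\<close>

lemma separating_functional:
  fixes v :: "'a::euclidean_space"
  assumes "subspace S" "v \<notin> S"
  shows "\<exists>\<phi>. (\<forall>y\<in>S. \<phi> \<bullet> y = 0) \<and> \<phi> \<bullet> v \<noteq> 0"
proof -
  obtain y z where yz: "y \<in> span S" "\<And>w. w \<in> span S \<Longrightarrow> orthogonal z w" "v = y + z"
    using orthogonal_subspace_decomp_exists[of S v] by metis
  have "span S = S" using assms(1) by (simp only: span_eq_iff)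
  then have "z \<noteq> 0" using yz(1,3) assms(2) by (metis add.right_neutral)
  then have "z \<bullet> v \<noteq> 0" using yz(2)[OF yz(1)] yz(3) by (simp add: inner_add_right orthogonal_def)
  moreover have "z \<bullet> y = 0" if "y \<in> S" for y
    using yz(2)[OF span_base[OF that]] by (simp only: orthogonal_def)
  ultimately show ?thesis by blast
qed

text \<open>Without a fixed point, \<open>v\<close> is separated from the image of
  \<open>1 - A\<close>; a functional vanishing on that image is \<open>A\<close>-invariant and can
  be scaled to the value \<open>2\<close> at \<open>v\<close>. The frame starts with the vector
  \<open>v\<close> and the covector \<open>\<phi>\<close> at node 0, and with \<open>z\<close> and
  \<open>\<zeta>\<close> at node 1.\<close>

lemma fixed_point_free_imp_anosov:
  fixes A B :: "real^'n^'n" and v :: "real^'n"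
  assumes AB: "A ** B = mat 1" "B ** A = mat 1" and dim: "CARD('n) \<ge> 2"
    and v: "v \<notin> range ((*v) (mat 1 - A))"
  shows "\<exists>g. complete_riemannian_metric g \<and> anosov_wrt (affine_map A v) g"
proof -
  let ?R = "range ((*v) (mat 1 - A))"
  have sub: "subspace ?R"
    using linear_subspace_image[OF matrix_vector_mul_linear subspace_UNIV] .
  obtain \<phi>0 where \<phi>0: "\<And>y. y \<in> ?R \<Longrightarrow> \<phi>0 \<bullet> y = 0" "\<phi>0 \<bullet> v \<noteq> 0"
    using separating_functional[OF sub v] by blast
  define \<phi> where "\<phi> = (2 / (\<phi>0 \<bullet> v)) *\<^sub>R \<phi>0"
  have \<phi>: "\<phi> \<bullet> v = 2" "\<phi> \<bullet> (A *v a) = \<phi> \<bullet> a" for a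
  proof -
    show "\<phi> \<bullet> v = 2" using \<phi>0(2) by (simp add: \<phi>_def)
    have "\<phi>0 \<bullet> ((mat 1 - A) *v a) = 0" using \<phi>0(1) by blast
    then show "\<phi> \<bullet> (A *v a) = \<phi> \<bullet> a"
      by (simp add: \<phi>_def matrix_vector_mult_diff_rdistrib inner_diff_right)
  qed
  have \<phi>A: "transpose A *v \<phi> = \<phi>"
    by (rule vector_eq_rdot[THEN iffD1], intro allI) (simp only: inner_matrix_vector_mult[symmetric] \<phi>(2))
  have \<phi>B: "transpose B *v \<phi> = \<phi>"
  proof (rule vector_eq_rdot[THEN iffD1], intro allI)
    fix a
    show "(transpose B *v \<phi>) \<bullet> a = \<phi> \<bullet> a"
      using \<phi>(2)[of "B *v a"] by (simp only: inner_matrix_vector_mult[symmetric] mult_inverse[OF AB])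
  qed
  \<comment> \<open>Here the dimension enters: the stable direction at odd nodes is a nonzero vector
    in the kernel of \<open>\<phi>\<close>.\<close>
  obtain z where z: "z \<noteq> 0" "\<phi> \<bullet> z = 0"
    using orthogonal_to_vector_exists[of \<phi>] dim by (auto simp: orthogonal_def)
  \<comment> \<open>\<open>\<phi>\<close> equals \<open>2\<close> at both \<open>v\<close> and \<open>A v\<close>, so a large multiple of it makes \<open>\<zeta>\<close> nonnegative there.\<close>
  define c where "c = \<bar>z \<bullet> v\<bar> / (z \<bullet> z) + \<bar>z \<bullet> (A *v v)\<bar> / (z \<bullet> z)"
  define \<zeta> where "\<zeta> = (1 / (z \<bullet> z)) *\<^sub>R z + c *\<^sub>R \<phi>"
  have zz: "z \<bullet> z > 0" using z(1) by simp
  have "\<zeta> \<bullet> z = 1" using z by (simp add: \<zeta>_def inner_add_left)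
  moreover have "\<zeta> \<bullet> a \<ge> 0" if "a = v \<or> a = A *v v" for a
  proof -
    have c0: "\<bar>z \<bullet> v\<bar> / (z \<bullet> z) \<ge> 0" "\<bar>z \<bullet> (A *v v)\<bar> / (z \<bullet> z) \<ge> 0" using zz by auto
    have "\<phi> \<bullet> a = 2" using that \<phi> by auto
    then have "\<zeta> \<bullet> a = (z \<bullet> a) / (z \<bullet> z) + c * 2" by (simp add: \<zeta>_def inner_add_left)
    moreover have "- (\<bar>z \<bullet> a\<bar> / (z \<bullet> z)) \<le> (z \<bullet> a) / (z \<bullet> z)"
      using divide_right_mono[of "- \<bar>z \<bullet> a\<bar>" "z \<bullet> a" "z \<bullet> z"] zz by simp
    moreover have "\<bar>z \<bullet> a\<bar> / (z \<bullet> z) \<le> c" using that c0 by (auto simp: c_def)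
    moreover have "c \<ge> 0" using c0 by (simp add: c_def)
    ultimately show ?thesis by linarith
  qed
  ultimately have \<zeta>: "\<zeta> \<bullet> z = 1" "\<zeta> \<bullet> v \<ge> 0" "\<zeta> \<bullet> (A *v v) \<ge> 0" by auto
  obtain p where p: "p 0 = v" "p 1 = z" "\<And>j::int. p (j + 2) = A *v p j"
    using alternating_orbit_exists[of "(*v) A" "(*v) B" v z] mult_inverse[OF AB] by metis
  have "transpose B ** transpose A = mat 1"
    by (simp add: AB matrix_transpose_mul[symmetric] transpose_mat)
  then have "transpose B *v (transpose A *v x) = x" for x
    by (simp only: matrix_vector_mul_assoc matrix_vector_mul_lid)
  then obtain q where q: "q 0 = \<phi>" "q 1 = \<zeta>" "\<And>j::int. q (j + 2) = transpose B *v q j"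
    using alternating_orbit_exists[of "(*v) (transpose B)" "(*v) (transpose A)" \<phi> \<zeta>] by metis
  have "transpose A ** transpose B = mat 1"
    by (simp add: AB matrix_transpose_mul[symmetric] transpose_mat)
  then have AtBt: "transpose A *v (transpose B *v x) = x" for x
    by (simp only: matrix_vector_mul_assoc matrix_vector_mul_lid)
  have inv: "(transpose B *v a) \<bullet> (A *v b) = a \<bullet> b" for a b
    by (simp only: inner_matrix_vector_mult[symmetric] mult_inverse[OF AB])
  have step: "j + 2 + 1 = (j + 1) + 2" for j :: int by simp
  have p2: "p 2 = A *v v" and q2: "q 2 = \<phi>" using p(3)[of 0] q(3)[of 0] p(1) q(1) \<phi>B by auto
  obtain \<sigma> \<sigma>' :: "real \<Rightarrow> real" and M where \<sigma>: "flat_step \<sigma> \<sigma>' M"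
    using smooth_step_exists unfolding flat_step_def by metis
  have "drift_frame \<sigma> \<sigma>' M A B v \<phi> p q"
  proof (intro drift_frame.intro \<sigma> drift_frame_axioms.intro AB \<phi>A \<phi>(1) p(3) q(3))
    fix j :: int
    \<comment> \<open>Pairings are invariant under the shift by 2, so only \<open>j = 0\<close> and
      \<open>j = 1\<close> matter. There \<open>\<phi>\<close> meets \<open>v\<close> and
      \<open>z\<close>, while \<open>\<zeta>\<close> meets \<open>v\<close>, \<open>z\<close> and
      \<open>A v\<close>.\<close>
    show "q j \<bullet> p j > 0"
      by (rule int_parity_induct[where P = "\<lambda>j. q j \<bullet> p j > 0"])
        (simp only: p(3) q(3) inv, simp_all add: p q \<phi> \<zeta>)
    show "q j \<bullet> p (j + 1) \<ge> 0"
      by (rule int_parity_induct[where P = "\<lambda>j. q j \<bullet> p (j + 1) \<ge> 0"])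
        (simp only: step p(3) q(3) inv, simp_all add: p q p2 z \<zeta>)
    show "q (j + 1) \<bullet> p j \<ge> 0"
      by (rule int_parity_induct[where P = "\<lambda>j. q (j + 1) \<bullet> p j \<ge> 0"])
        (simp only: step p(3) q(3) inv, simp_all add: p q q2 z \<zeta>)
    have "even j \<longrightarrow> q j = \<phi>"
    proof (rule int_parity_induct[where P = "\<lambda>j. even j \<longrightarrow> q j = \<phi>"])
      fix j
      have "transpose B *v q j = \<phi> \<longleftrightarrow> q j = \<phi>"
        using \<phi>A \<phi>B AtBt by metis
      then show "(even (j + 2) \<longrightarrow> q (j + 2) = \<phi>) \<longleftrightarrow> (even j \<longrightarrow> q j = \<phi>)"
        by (simp only: q(3)) simp
    qed (auto simp: q)
    then show "even j \<Longrightarrow> q j = \<phi>" by blast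
    have "odd j \<longrightarrow> \<phi> \<bullet> p j = 0"
      by (rule int_parity_induct[where P = "\<lambda>j. odd j \<longrightarrow> \<phi> \<bullet> p j = 0"]) (auto simp: p \<phi> z)
    then show "odd j \<Longrightarrow> \<phi> \<bullet> p j = 0" by blast
    have "odd j \<longrightarrow> q j \<bullet> p j = 1"
      by (rule int_parity_induct[where P = "\<lambda>j. odd j \<longrightarrow> q j \<bullet> p j = 1"])
        (simp only: p(3) q(3) inv, simp_all add: p q \<zeta>)
    then show "odd j \<Longrightarrow> q j \<bullet> p j = 1" by blast
  qed
  then show ?thesis by (rule drift_frame.frame_imp_anosov)
qed

section \<open>Simple eigenvalues\<close>

lemma det_eq_0_iff_kernel: "det M = 0 \<longleftrightarrow> (\<exists>u. u \<noteq> 0 \<and> M *v u = 0)" for M :: "'a::field^'n^'n"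
  using invertible_det_nz[of M] matrix_left_invertible_ker[of M] by (auto simp: invertible_left_inverse)

lemma poly_det: "poly (det N) z = det (\<chi> i j. poly (N $ i $ j) z)" for N :: "complex poly^'n^'n"
  by (simp add: det_def poly_sum poly_prod)

lemma poly_charpoly: "poly (charpoly M) z = det (\<chi> i j. (if i = j then z else 0) - M $ i $ j)"
  unfolding charpoly_def poly_det
  by (intro arg_cong[where f = det]) (auto simp: vec_eq_iff mat_def map_matrix_def)

lemma poly_charpoly_eq_0_iff: "poly (charpoly M) z = 0 \<longleftrightarrow> (\<exists>u. u \<noteq> 0 \<and> M *v u = z *s u)"
proof -
  have *: "(\<chi> i j. (if i = j then z else 0) - M $ i $ j) *v u = z *s u - M *v u" for u
    by (simp add: vec_eq_iff matrix_vector_mult_def left_diff_distrib sum_subtractf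
        if_distrib[of "\<lambda>x. x * _"] cong: if_cong)
  then show ?thesis
    unfolding poly_charpoly det_eq_0_iff_kernel * right_minus_eq by (simp only: eq_commute)
qed

text \<open>Otherwise every number would be an eigenvalue, even one larger than a norm bound for
  \<open>M\<close>.\<close>

lemma charpoly_nonzero: "charpoly M \<noteq> 0" for M :: "complex^'n^'n"
proof
  assume "charpoly M = 0"
  interpret bounded_linear "\<lambda>u::complex^'n. M *v u"
    by (intro linear_conv_bounded_linear[THEN iffD1] linearI)
      (auto simp: vec_eq_iff matrix_vector_mult_def sum.distrib algebra_simps scaleR_sum_right)
  obtain K where K: "\<And>u. norm (M *v u) \<le> norm u * K" using bounded by blast
  obtain u where u: "u \<noteq> 0" "M *v u = complex_of_real (\<bar>K\<bar> + 1) *s u"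
    using poly_charpoly_eq_0_iff[of M "complex_of_real (\<bar>K\<bar> + 1)"] \<open>charpoly M = 0\<close> by auto
  then have "(\<bar>K\<bar> + 1) * norm u \<le> K * norm u"
    using K[of u] by (simp add: norm_vector_smult mult.commute del: of_real_add)
  then show False using u(1) by simp
qed

lemma Spec_iff: "z \<in> Spec A \<longleftrightarrow> poly (charpoly (complexify A)) z = 0"
  by (auto simp: Spec_def poly_charpoly_eq_0_iff)

lemma finite_Spec: "finite (Spec A)"
proof -
  have "Spec A = {z. poly (charpoly (complexify A)) z = 0}"
    using Spec_iff by blast
  then show ?thesis
    using poly_roots_finite[OF charpoly_nonzero] by metis
qed

text \<open>Bilinear rather than Hermitian, so that \<open>M\<close> crosses the pairing without
  conjugation and left and right eigenvectors share their eigenvalues.\<close>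

definition bdot :: "complex^'n \<Rightarrow> complex^'n \<Rightarrow> complex" where
  "bdot x y = (\<Sum>i\<in>UNIV. x $ i * y $ i)"

lemma bdot_mult: "bdot \<phi> (M *v u) = bdot (\<phi> v* M) u"
  unfolding bdot_def matrix_vector_mult_def vector_matrix_mult_def
  by (simp add: sum_distrib_left sum_distrib_right mult_ac) (rule sum.swap)

lemma bdot_smult: "bdot (c *s x) y = c * bdot x y" "bdot x (c *s y) = c * bdot x y"
  by (simp_all add: bdot_def sum_distrib_left mult_ac)

lemma poly_charpoly_transpose: "poly (charpoly (transpose M)) z = poly (charpoly M) z"
  unfolding poly_charpoly
  by (subst det_transpose[symmetric], rule arg_cong[where f = det])
    (simp add: transpose_def vec_eq_iff)

lemma left_eigenvector_exists:
  fixes M :: "complex^'n^'n"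
  assumes "M *v u = z *s u" "u \<noteq> 0"
  shows "\<exists>\<phi>. \<phi> \<noteq> 0 \<and> \<phi> v* M = z *s \<phi>"
proof -
  obtain \<phi> where "\<phi> \<noteq> 0" "transpose M *v \<phi> = z *s \<phi>"
    using assms poly_charpoly_eq_0_iff poly_charpoly_transpose by metis
  then show ?thesis by (auto simp: vector_transpose_matrix[symmetric])
qed

text \<open>
  Replacing one row of \<open>X - M\<close> by the left eigenvector \<open>\<phi>\<close> splits off the factor \<open>X - z\<close>
  from the characteristic polynomial.
\<close>

lemma order_charpoly_eq_1_iff:
  fixes M :: "complex^'n^'n"
  assumes \<phi>: "\<phi> \<noteq> 0" "\<phi> v* M = z *s \<phi>"
  shows "order z (charpoly M) = 1 \<longleftrightarrow> \<not> (\<exists>u. u \<noteq> 0 \<and> M *v u = z *s u \<and> bdot \<phi> u = 0)"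
proof -
  obtain k where k: "\<phi> $ k \<noteq> 0" using \<phi>(1) by (auto simp: vec_eq_iff)
  \<comment> \<open>Multiplication by \<open>S\<close> from the left replaces row \<open>k\<close>
    by the combination of the rows with coefficients \<open>\<phi>\<close>; this is invertible
    because \<open>\<phi> $ k\<close> is nonzero.\<close>
  define S :: "complex^'n^'n" where "S = (\<chi> i. if i = k then \<phi> else axis i 1)"
  define N :: "complex poly^'n^'n" where
    "N = (\<chi> i j. if i = k then [:\<phi> $ j:] else (if i = j then [:0, 1:] else 0) - [:M $ i $ j:])"
  have axis: "bdot (axis i 1) u = u $ i" for i :: 'n and u
    by (simp add: bdot_def axis_def if_distrib[of "\<lambda>x. x * _"] cong: if_cong)
  have "det S \<noteq> 0"
  proof
    assume "det S = 0"
    then obtain u where u: "u \<noteq> 0" "S *v u = 0" by (auto simp: det_eq_0_iff_kernel)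
    have Su: "(S *v u) $ i = (if i = k then bdot \<phi> u else u $ i)" for i
      using axis[of i u] by (simp add: S_def matrix_vector_mult_def bdot_def)
    then have "u $ i = 0" if "i \<noteq> k" for i using u(2) that by (metis zero_index)
    moreover have "bdot \<phi> u = 0" using Su[of k] u(2) by simp
    ultimately have "\<phi> $ k * u $ k = 0"
      unfolding bdot_def by (subst (asm) sum.remove[of _ k]) auto
    then show False using u(1) k \<open>\<And>i. i \<noteq> k \<Longrightarrow> u $ i = 0\<close> by (metis mult_eq_0_iff vec_eq_iff zero_index)
  qed
  have eq: "smult (det S) (charpoly M) = [:-z, 1:] * det N"
  proof (rule poly_eq_poly_eq_iff[THEN iffD1], rule ext)
    fix x
    let ?K = "\<chi> i j. (if i = j then x else 0) - M $ i $ j"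
    have "S ** ?K = (\<chi> i. if i = k then (x - z) *s \<phi> else ?K $ i)"
    proof -
      have "(S ** ?K) $ i $ j = (\<chi> i. if i = k then (x - z) *s \<phi> else ?K $ i) $ i $ j" for i j
      proof (cases "i = k")
        case True
        have "(S ** ?K) $ i $ j = (\<Sum>l\<in>UNIV. if l = j then \<phi> $ l * x else 0) - (\<phi> v* M) $ j"
          unfolding matrix_matrix_mult_def vector_matrix_mult_def
          by (simp add: S_def True right_diff_distrib sum_subtractf if_distrib[of "\<lambda>x. _ * x"]
              mult.commute cong: if_cong)
        then show ?thesis by (simp add: True \<phi>(2) algebra_simps)
      next
        case False
        have "(S ** ?K) $ i $ j = (\<Sum>l\<in>UNIV. if l = i then ?K $ l $ j else 0)"
          unfolding matrix_matrix_mult_def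
          by (simp add: S_def False axis_def if_distrib[of "\<lambda>x. x * _"] cong: if_cong)
        then show ?thesis using False by simp
      qed
      then show ?thesis by (simp only: vec_eq_iff) blast
    qed
    then have "det S * det ?K = (x - z) * det (\<chi> i. if i = k then \<phi> else ?K $ i)"
      by (simp only: det_mul[symmetric] det_row_mul)
    also have "(\<chi> i. if i = k then \<phi> else ?K $ i) = (\<chi> i j. poly (N $ i $ j) x)"
      by (simp add: vec_eq_iff N_def)
    finally show "poly (smult (det S) (charpoly M)) x = poly ([:-z, 1:] * det N) x"
      by (simp only: poly_smult poly_mult poly_charpoly poly_det) simp
  qed
  have nz: "[:-z, 1:] * det N \<noteq> 0"
    using charpoly_nonzero[of M] \<open>det S \<noteq> 0\<close> unfolding eq[symmetric] by simp
  have "order z (charpoly M) = order z ([:-z, 1:] * det N)"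
    using order_smult[OF \<open>det S \<noteq> 0\<close>, of z "charpoly M"] eq by simp
  also have "\<dots> = 1 + order z (det N)"
    using order_mult[OF nz] order_power_n_n[of z 1] by simp
  finally have ord: "order z (charpoly M) = 1 \<longleftrightarrow> poly (det N) z \<noteq> 0"
    using order_root[of "det N" z] nz by auto
  have ker: "(\<chi> i j. poly (N $ i $ j) z) *v u = 0 \<longleftrightarrow> M *v u = z *s u \<and> bdot \<phi> u = 0" for u
  proof -
    have Nu: "((\<chi> i j. poly (N $ i $ j) z) *v u) $ i
        = (if i = k then bdot \<phi> u else z * u $ i - (M *v u) $ i)" for i
      by (simp add: N_def matrix_vector_mult_def bdot_def left_diff_distrib sum_subtractf
          if_distrib[of "\<lambda>x. poly x z"] if_distrib[of "\<lambda>x. x * _"] cong: if_cong)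
    show ?thesis
    proof
      assume 0: "(\<chi> i j. poly (N $ i $ j) z) *v u = 0"
      then have \<phi>u: "bdot \<phi> u = 0" using Nu[of k] by simp
      have d: "(z *s u - M *v u) $ i = 0" if "i \<noteq> k" for i
        using Nu[of i] 0 that by simp
      \<comment> \<open>The equation of the replaced row is recovered: \<open>\<phi>\<close>
        annihilates \<open>z *s u - M *v u\<close>, whose only possibly nonzero entry is the one at
        \<open>k\<close>.\<close>
      have "bdot \<phi> (z *s u - M *v u) = 0"
      proof -
        have "bdot \<phi> (z *s u - M *v u) = bdot \<phi> (z *s u) - bdot \<phi> (M *v u)"
          by (simp add: bdot_def right_diff_distrib sum_subtractf)
        then show ?thesis by (simp add: bdot_mult bdot_smult \<phi>(2) \<phi>u)
      qed
      then have "\<phi> $ k * (z *s u - M *v u) $ k = 0"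
        unfolding bdot_def using d by (subst (asm) sum.remove[of _ k]) auto
      then have "(z *s u - M *v u) $ i = 0" for i
        using k d by (cases "i = k") auto
      then show "M *v u = z *s u \<and> bdot \<phi> u = 0"
        using \<phi>u by (simp add: vec_eq_iff)
    next
      assume "M *v u = z *s u \<and> bdot \<phi> u = 0"
      then show "(\<chi> i j. poly (N $ i $ j) z) *v u = 0"
        by (subst vec_eq_iff, subst Nu) auto
    qed
  qed
  show ?thesis unfolding ord poly_det det_eq_0_iff_kernel ker by simp
qed

lemma bdot_cvec: "Re (bdot (cvec \<phi>) u) = \<phi> \<bullet> revec u" "Im (bdot (cvec \<phi>) u) = \<phi> \<bullet> imvec u"
  by (simp_all add: bdot_def inner_vec_def)

lemma cvec_left_mult: "cvec \<phi> v* complexify A = cvec (\<phi> v* A)"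
  by (simp add: vec_eq_iff vector_matrix_mult_def)

lemma eigenvector_real_iff:
  "complexify A *v u = u \<longleftrightarrow> A *v revec u = revec u \<and> A *v imvec u = imvec u"
  unfolding revec_complexify[symmetric] imvec_complexify[symmetric]
  by (auto simp: vec_eq_iff complex_eq_iff)

lemma cnj_Spec: "z \<in> Spec A \<Longrightarrow> cnj z \<in> Spec A"
proof -
  assume "z \<in> Spec A"
  then obtain w where w: "w \<noteq> 0" "complexify A *v w = z *s w" by (auto simp: Spec_def)
  define w' where "w' = (\<chi> i. cnj (w $ i))"
  have "(complexify A *v w') $ i = cnj ((complexify A *v w) $ i)" for i
    by (simp add: matrix_vector_mult_def w'_def)
  then have "complexify A *v w' = cnj z *s w'"
    by (simp add: w(2) vec_eq_iff w'_def)
  moreover have "w' \<noteq> 0" using w(1) by (auto simp: w'_def vec_eq_iff)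
  ultimately show ?thesis by (auto simp: Spec_def)
qed

lemma one_in_Spec_iff: "1 \<in> Spec A \<longleftrightarrow> (\<exists>x. x \<noteq> 0 \<and> A *v x = x)"
proof
  assume "1 \<in> Spec A"
  then obtain u where "u \<noteq> 0" "complexify A *v u = u" by (auto simp: Spec_def)
  then show "\<exists>x. x \<noteq> 0 \<and> A *v x = x"
    using eigenvector_real_iff[of A u] cvec_revec_imvec[of u] by (metis cvec_eq_0_iff add_0 vector_smult_rzero)
next
  assume "\<exists>x. x \<noteq> 0 \<and> A *v x = x"
  then obtain x where "x \<noteq> 0" "A *v x = x" by blast
  then show "1 \<in> Spec A"
    unfolding Spec_def by (intro CollectI exI[of _ "cvec x"]) (simp add: complexify_cvec)
qed

lemma real_left_fixed_exists:
  assumes "1 \<in> Spec A" shows "\<exists>\<phi>. \<phi> \<noteq> 0 \<and> \<phi> v* A = \<phi>"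
proof -
  obtain u where u: "u \<noteq> 0" "complexify A *v u = 1 *s u" using assms by (auto simp: Spec_def)
  obtain \<phi> where \<phi>: "\<phi> \<noteq> 0" "\<phi> v* complexify A = 1 *s \<phi>"
    using left_eigenvector_exists[OF u(2,1)] by blast
  then have "complexify (transpose A) *v \<phi> = \<phi>"
    by (simp add: vec_eq_iff matrix_vector_mult_def vector_matrix_mult_def transpose_def mult.commute)
  then have "1 \<in> Spec (transpose A)" using \<phi>(1) by (auto simp: Spec_def)
  then show ?thesis unfolding one_in_Spec_iff by (simp add: vector_transpose_matrix)
qed

text \<open>The eigenvalue and \<open>\<phi>\<close> are real, so the real and imaginary parts of a
  complex vector in the kernel criterion satisfy it separately.\<close>

lemma simple_one_iff:
  assumes "\<phi> \<noteq> 0" "\<phi> v* A = \<phi>"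
  shows "alg_mult A 1 = 1 \<longleftrightarrow> \<not> (\<exists>x. x \<noteq> 0 \<and> A *v x = x \<and> \<phi> \<bullet> x = 0)"
proof -
  have "cvec \<phi> v* complexify A = 1 *s cvec \<phi>" by (simp add: cvec_left_mult assms)
  from order_charpoly_eq_1_iff[OF _ this]
  have "alg_mult A 1 = 1 \<longleftrightarrow> \<not> (\<exists>u. u \<noteq> 0 \<and> complexify A *v u = u \<and> bdot (cvec \<phi>) u = 0)"
    using assms(1) by (simp add: alg_mult_def)
  also have "(\<exists>u. u \<noteq> 0 \<and> complexify A *v u = u \<and> bdot (cvec \<phi>) u = 0)
      \<longleftrightarrow> (\<exists>x. x \<noteq> 0 \<and> A *v x = x \<and> \<phi> \<bullet> x = 0)"
  proof
    assume "\<exists>u. u \<noteq> 0 \<and> complexify A *v u = u \<and> bdot (cvec \<phi>) u = 0"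
    then obtain u where u: "u \<noteq> 0" "complexify A *v u = u" "bdot (cvec \<phi>) u = 0" by blast
    have "revec u \<noteq> 0 \<or> imvec u \<noteq> 0"
      using u(1) cvec_revec_imvec[of u] by (metis cvec_eq_0_iff add_0 vector_smult_rzero)
    moreover have "\<phi> \<bullet> revec u = 0" "\<phi> \<bullet> imvec u = 0"
      using u(3) bdot_cvec[of \<phi> u] by auto
    ultimately show "\<exists>x. x \<noteq> 0 \<and> A *v x = x \<and> \<phi> \<bullet> x = 0"
      using u(2) unfolding eigenvector_real_iff by blast
  next
    assume "\<exists>x. x \<noteq> 0 \<and> A *v x = x \<and> \<phi> \<bullet> x = 0"
    then obtain x where x: "x \<noteq> 0" "A *v x = x" "\<phi> \<bullet> x = 0" by blast
    have "revec (cvec x) = x" "imvec (cvec x) = 0" by (simp_all add: vec_eq_iff)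
    then have "bdot (cvec \<phi>) (cvec x) = 0"
      using bdot_cvec[of \<phi> "cvec x"] x(3) by (simp add: complex_eq_iff)
    then show "\<exists>u. u \<noteq> 0 \<and> complexify A *v u = u \<and> bdot (cvec \<phi>) u = 0"
      using x by (intro exI[of _ "cvec x"]) (simp add: complexify_cvec)
  qed
  finally show ?thesis .
qed

lemma left_fixed_inner: "\<phi> v* A = \<phi> \<Longrightarrow> \<phi> \<bullet> ((mat 1 - A) *v x) = 0" for A :: "real^'n^'n"
  by (simp add: matrix_vector_mult_diff_rdistrib inner_diff_right dot_lmul_matrix[symmetric])

text \<open>\<open>1 - A\<close> maps the hyperplane orthogonal to \<open>\<phi>\<close> into itself
  and is injective there, hence onto it.\<close>

lemma range_eq_hyperplane:
  fixes A :: "real^'n^'n"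
  assumes "\<phi> v* A = \<phi>" "\<And>x. A *v x = x \<Longrightarrow> \<phi> \<bullet> x = 0 \<Longrightarrow> x = 0" "\<phi> \<bullet> v = 0"
  shows "v \<in> range ((*v) (mat 1 - A))"
proof -
  have "((*v) (mat 1 - A)) ` {x. \<phi> \<bullet> x = 0} = {x. \<phi> \<bullet> x = 0}"
  proof (rule linear_inj_on_subspace_surj[OF matrix_vector_mul_linear subspace_hyperplane])
    show "((*v) (mat 1 - A)) ` {x. \<phi> \<bullet> x = 0} \<subseteq> {x. \<phi> \<bullet> x = 0}"
      using left_fixed_inner[OF assms(1)] by auto
    show "x = 0" if "x \<in> {x. \<phi> \<bullet> x = 0}" "(mat 1 - A) *v x = 0" for x
      using that assms(2)[of x] by (simp add: matrix_vector_mult_diff_rdistrib)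
  qed
  then show ?thesis using assms(3) by blast
qed

section \<open>Perturbations\<close>

lemma fixed_point_iff: "affine_map A v x = x \<longleftrightarrow> v = (mat 1 - A) *v x"
  by (auto simp: affine_map_def matrix_vector_mult_diff_rdistrib algebra_simps)

lemma anosov_locus_iff:
  fixes A :: "real^'n^'n"
  assumes "CARD('n) \<ge> 2"
  shows "(A, v) \<in> anosov_locus \<longleftrightarrow>
    invertible A \<and> (hyperbolic A \<or> v \<notin> range ((*v) (mat 1 - A)))"
proof (cases "invertible A")
  case True
  then obtain B where AB: "A ** B = mat 1" "B ** A = mat 1" by (auto simp: invertible_def)
  have "hyperbolic A" if "anosov_wrt (affine_map A v) g" "v = (mat 1 - A) *v x" for g x
    using anosov_fixed_point_hyperbolic[OF AB that(1)] that(2) fixed_point_iff by metis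
  then show ?thesis
    using True hyperbolic_imp_anosov[OF AB] fixed_point_free_imp_anosov[OF AB assms]
    by (auto simp: anosov_locus_def param_space_def)
qed (auto simp: anosov_locus_def param_space_def)

lemma open_invertible: "open {A :: real^'n^'n. invertible A}"
  unfolding invertible_det_nz det_def by (intro open_Collect_neq continuous_intros)

text \<open>A number \<open>z\<close> on the circle is a root of the real polynomial
  \<open>X^2 - 2 (Re z) X + 1\<close>, so the real and imaginary parts of its eigenvector satisfy a
  real equation. The perturbations below are designed to keep this equation.\<close>

lemma circle_eigenvalue_real:
  assumes "z \<in> Spec A" "cmod z = 1"
  shows "\<exists>x. x \<noteq> 0 \<and> A *v (A *v x) = (2 * Re z) *\<^sub>R (A *v x) - x"
proof -
  obtain w where w: "w \<noteq> 0" "complexify A *v w = z *s w" using assms(1) by (auto simp: Spec_def)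
  have z2: "z * z = complex_of_real (2 * Re z) * z - 1"
    using assms(2) by (simp add: complex_eq_iff cmod_def power2_eq_square algebra_simps)
  have eq: "complexify A *v (complexify A *v w) = complex_of_real (2 * Re z) *s (complexify A *v w) - w"
    unfolding w(2) vector_scalar_commute using z2 by (simp add: w(2) vec_eq_iff left_diff_distrib flip: mult.assoc)
  have "revec w \<noteq> 0 \<or> imvec w \<noteq> 0"
    using w(1) cvec_revec_imvec[of w] by (metis cvec_eq_0_iff add_0 vector_smult_rzero)
  moreover have "A *v (A *v revec w) = (2 * Re z) *\<^sub>R (A *v revec w) - revec w"
    unfolding revec_complexify[symmetric] eq by (simp add: vec_eq_iff)
  moreover have "A *v (A *v imvec w) = (2 * Re z) *\<^sub>R (A *v imvec w) - imvec w"
    unfolding imvec_complexify[symmetric] eq by (simp add: vec_eq_iff)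
  ultimately show ?thesis by blast
qed

text \<open>The quadratic factors as \<open>(X - z) (X - cnj z)\<close> with \<open>z\<close> on the
  circle. Either \<open>(A - cnj z) x\<close> is an eigenvector for \<open>z\<close>, or it vanishes
  and \<open>x\<close> is one for \<open>cnj z\<close>.\<close>

lemma circle_eigenvalue_complex:
  assumes "x \<noteq> 0" "A *v (A *v x) = (2 * c) *\<^sub>R (A *v x) - x" "\<bar>c\<bar> \<le> 1"
  shows "\<not> hyperbolic A"
proof -
  define z where "z = Complex c (sqrt (1 - c\<^sup>2))"
  have "c\<^sup>2 \<le> 1" using assms(3) by (simp add: abs_square_le_1)
  then have z1: "cmod z = 1" by (simp add: z_def cmod_def)
  then have zz: "z * cnj z = 1" by (simp add: complex_norm_square[symmetric])
  have zs: "complex_of_real (2 * c) = z + cnj z" by (simp add: z_def complex_eq_iff)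
  define w where "w = complexify A *v cvec x - cnj z *s cvec x"
  have A2: "complexify A *v (complexify A *v cvec x) = (z + cnj z) *s (complexify A *v cvec x) - cvec x"
    unfolding complexify_cvec assms(2) zs[symmetric] by (simp add: vec_eq_iff)
  have "complexify A *v w = complexify A *v (complexify A *v cvec x) - cnj z *s (complexify A *v cvec x)"
    by (simp add: w_def matrix_vector_mult_diff_distrib vector_scalar_commute)
  also have "\<dots> = z *s (complexify A *v cvec x) - cvec x"
    unfolding A2 by (simp add: vec_eq_iff algebra_simps)
  also have "\<dots> = z *s w"
    using zz by (simp add: w_def vec_eq_iff algebra_simps)
  finally have Aw: "complexify A *v w = z *s w" .
  have "z \<in> Spec A \<or> cnj z \<in> Spec A"
  proof (cases "w = 0")
    case True
    then have "complexify A *v cvec x = cnj z *s cvec x" by (simp add: w_def)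
    then have "cnj z \<in> Spec A"
      unfolding Spec_def using assms(1) by (intro CollectI exI[of _ "cvec x"]) simp
    then show ?thesis ..
  next
    case False
    then show ?thesis using Aw by (auto simp: Spec_def)
  qed
  then show ?thesis
    using z1 by (auto simp: hyperbolic_def dist_norm)
qed

lemma real_eigenvalue_in_Spec: "x \<noteq> 0 \<Longrightarrow> A *v x = c *\<^sub>R x \<Longrightarrow> complex_of_real c \<in> Spec A"
  unfolding Spec_def
  by (intro CollectI exI[of _ "cvec x"]) (simp add: complexify_cvec, simp add: vec_eq_iff)

text \<open>Scaling by \<open>1 + t\<close> moves the value \<open>1 / (1 + t)\<close> to
  \<open>1\<close>; \<open>F\<close> will be the finite set of values that must not arrive
  there.\<close>

lemma small_scale_exists:
  fixes F :: "real set"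
  assumes "finite F" "d > 0"
  shows "\<exists>t. 0 < t \<and> t < d \<and> 1 / (1 + t) \<notin> F"
proof -
  have "infinite {0<..<d}" using assms(2) by (simp add: infinite_Ioo)
  moreover have "inj_on (\<lambda>t. 1 / (1 + t)) {0<..<d}"
    by (intro inj_onI) (simp add: field_simps)
  ultimately have "infinite ((\<lambda>t. 1 / (1 + t)) ` {0<..<d})"
    using finite_imageD by blast
  then obtain y where "y \<in> (\<lambda>t. 1 / (1 + t)) ` {0<..<d}" "y \<notin> F"
    using assms(1) by (meson finite_subset subsetI)
  then show ?thesis by auto
qed

lemma scaled_perturbation:
  fixes M :: "real^'n^'n"
  assumes "e > 0"
  shows "\<exists>d>0. \<forall>t. \<bar>t\<bar> < d \<longrightarrow> norm (t *\<^sub>R M) < e"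
proof (intro exI[of _ "e / (norm M + 1)"] conjI allI impI)
  show "e / (norm M + 1) > 0" using assms by (intro divide_pos_pos) (auto intro: add_nonneg_pos)
  fix t assume "\<bar>t\<bar> < e / (norm M + 1)"
  then have "\<bar>t\<bar> * (norm M + 1) < e"
    by (simp add: pos_less_divide_eq add_nonneg_pos)
  moreover have "\<bar>t\<bar> * norm M \<le> \<bar>t\<bar> * (norm M + 1)" by (intro mult_left_mono) auto
  ultimately show "norm (t *\<^sub>R M) < e" by simp
qed

text \<open>Scaling by \<open>1 + t\<close> multiplies every modulus in the spectrum, and the
  finitely many moduli hit \<open>1\<close> for only finitely many \<open>t\<close>.\<close>

lemma hyperbolic_dense:
  fixes A :: "real^'n^'n"
  assumes "e > 0"
  shows "\<exists>A'. dist A' A < e \<and> hyperbolic A'"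
proof -
  obtain d where d: "d > 0" "\<And>t. \<bar>t\<bar> < d \<Longrightarrow> norm (t *\<^sub>R A) < e"
    using scaled_perturbation[OF assms, of A] by blast
  obtain t where t: "0 < t" "t < d" "1 / (1 + t) \<notin> cmod ` Spec A"
    using small_scale_exists[OF finite_imageI[OF finite_Spec] d(1)] by blast
  let ?A = "(1 + t) *\<^sub>R A"
  have "hyperbolic ?A"
  proof (rule ccontr)
    assume "\<not> hyperbolic ?A"
    then obtain z w where z: "cmod z = 1" and w: "w \<noteq> 0" "complexify ?A *v w = z *s w"
      by (auto simp: hyperbolic_def Spec_def)
    have "complexify ?A *v w = complex_of_real (1 + t) *s (complexify A *v w)"
      by (simp add: vec_eq_iff matrix_vector_mult_def sum_distrib_left mult.assoc
          del: of_real_add)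
    then have "complex_of_real (1 + t) *s (complexify A *v w) = z *s w" using w(2) by simp
    moreover have "complex_of_real (1 + t) \<noteq> 0" using t(1) by (simp only: of_real_eq_0_iff)
    ultimately have "complexify A *v w = (z / complex_of_real (1 + t)) *s w"
      by (simp add: vec_eq_iff field_simps del: of_real_add)
    then have "z / complex_of_real (1 + t) \<in> Spec A" using w(1) by (auto simp: Spec_def)
    moreover have "cmod (z / complex_of_real (1 + t)) = 1 / (1 + t)"
      using t(1) z by (simp add: norm_divide del: of_real_add)
    ultimately show False using t(3) by (metis image_eqI)
  qed
  moreover have "dist ?A A < e"
    using d(2)[of t] t by (simp add: dist_norm scaleR_add_left)
  ultimately show ?thesis by blast
qed

text \<open>
  \<open>A\<close> is kept on the plane spanned by \<open>x\<close> and \<open>A x\<close>, where \<open>1\<close> is not an eigenvalue, and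
  slightly expanded on a complement.
\<close>

lemma perturb_keeping_circle_eigenvalue:
  fixes A :: "real^'n^'n"
  assumes x: "x \<noteq> 0" "A *v (A *v x) = (2 * c) *\<^sub>R (A *v x) - x" "\<bar>c\<bar> \<le> 1" "c \<noteq> 1" and "e > 0"
  shows "\<exists>A'. dist A' A < e \<and> \<not> hyperbolic A' \<and> v \<in> range ((*v) (mat 1 - A'))"
proof -
  define W where "W = span {x, A *v x}"
  have sub: "subspace W" by (simp add: W_def)
  have xW: "x \<in> W" "A *v x \<in> W" by (auto simp: W_def span_base)
  have quad: "A *v (A *v y) = (2 * c) *\<^sub>R (A *v y) - y \<and> A *v y \<in> W" if "y \<in> W" for y
  proof -
    have "subspace {y. A *v (A *v y) = (2 * c) *\<^sub>R (A *v y) - y \<and> A *v y \<in> W}"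
      using sub unfolding subspace_def
      by (auto simp: matrix_vector_right_distrib matrix_vector_mult_scaleR scaleR_add_right
          scaleR_diff_right mult.commute)
    moreover have "{x, A *v x} \<subseteq> {y. A *v (A *v y) = (2 * c) *\<^sub>R (A *v y) - y \<and> A *v y \<in> W}"
      using x(2) xW sub
      by (auto simp: subspace_diff subspace_scale matrix_vector_mult_diff_distrib matrix_vector_mult_scaleR)
    ultimately show ?thesis using that span_minimal[of "{x, A *v x}"] unfolding W_def by blast
  qed
  obtain B where B: "B \<subseteq> W" "pairwise orthogonal B" "\<And>b. b \<in> B \<Longrightarrow> norm b = 1" "independent B" "span B = W"
    using orthonormal_basis_subspace[OF sub] by metis
  define pr where "pr y = (\<Sum>b\<in>B. (y \<bullet> b) *\<^sub>R b)" for y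
  have pr_W: "pr y \<in> W" for y
    unfolding pr_def using B(1) sub by (intro subspace_sum subspace_scale) auto
  have pr_id: "pr y = y" if "y \<in> W" for y
    unfolding pr_def using orthonormal_basis_expand[of B y] B that finiteI_independent[OF B(4)] by auto
  have lin: "linear pr"
    unfolding pr_def by (intro linearI) (auto simp: inner_add_left scaleR_add_left sum.distrib scaleR_sum_right)
  define P where "P = matrix pr"
  have P: "P *v y = pr y" for y unfolding P_def using matrix_vector_mul(2)[OF lin] by metis
  define Q where "Q = mat 1 - P"
  have Q: "Q *v y = y - pr y" for y by (simp add: Q_def matrix_vector_mult_diff_rdistrib P)
  have Q_W: "Q *v y = 0" if "y \<in> W" for y using pr_id[OF that] by (simp add: Q)
  define R where "R = A ** Q"
  have R: "R *v y = A *v (y - pr y)" for y by (simp add: R_def Q flip: matrix_vector_mul_assoc)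
  obtain d where d: "d > 0" "\<And>t. \<bar>t\<bar> < d \<Longrightarrow> norm (t *\<^sub>R R) < e"
    using scaled_perturbation[OF \<open>e > 0\<close>, of R] by blast
  have "finite {r. complex_of_real r \<in> Spec (Q ** A)}"
    using finite_vimageI[OF finite_Spec[of "Q ** A"], of complex_of_real] by (simp add: inj_def vimage_def)
  then obtain t where t: "0 < t" "t < d" "complex_of_real (1 / (1 + t)) \<notin> Spec (Q ** A)"
    using small_scale_exists[OF _ d(1)] by blast
  define A' where "A' = A + t *\<^sub>R R"
  have A': "A' *v y = A *v y + t *\<^sub>R (A *v (y - pr y))" for y
    by (simp add: A'_def matrix_vector_mult_add_rdistrib R scaleR_matrix_vector_assoc[symmetric])
  \<comment> \<open>For a fixed vector of \<open>A'\<close>, the component \<open>u\<close>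
    orthogonal to \<open>W\<close> satisfies the eigenvector equation of \<open>Q ** A\<close> for
    \<open>1 / (1 + t)\<close>, a value that the choice of \<open>t\<close> excludes. So
    \<open>y\<close> lies in \<open>W\<close>, where the quadratic equation gives
    \<open>(2 - 2 * c) y = 0\<close>.\<close>
  have "y = 0" if y: "(mat 1 - A') *v y = 0" for y
  proof -
    have fx: "A' *v y = y" using y by (simp add: matrix_vector_mult_diff_rdistrib)
    define u where "u = y - pr y"
    have "A' *v y = A *v pr y + (1 + t) *\<^sub>R (A *v u)"
      unfolding A' u_def by (simp add: matrix_vector_mult_diff_distrib algebra_simps)
    then have "Q *v y = Q *v (A *v pr y) + (1 + t) *\<^sub>R (Q *v (A *v u))"
      by (simp only: fx flip: matrix_vector_right_distrib matrix_vector_mult_scaleR)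
    moreover have "Q *v (A *v pr y) = 0" using quad[OF pr_W] Q_W by blast
    ultimately have "u = (1 + t) *\<^sub>R ((Q ** A) *v u)"
      by (simp add: Q u_def flip: matrix_vector_mul_assoc)
    then have "(1 / (1 + t)) *\<^sub>R u = (1 / (1 + t)) *\<^sub>R ((1 + t) *\<^sub>R ((Q ** A) *v u))" by simp
    then have "(Q ** A) *v u = (1 / (1 + t)) *\<^sub>R u" using t(1) by simp
    then have "u = 0" using real_eigenvalue_in_Spec t(3) by blast
    then have "y = pr y" by (simp add: u_def)
    then have yW: "y \<in> W" using pr_W by metis
    then have "A *v y = y" using fx \<open>y = pr y\<close> by (simp add: A')
    then have "y = (2 * c) *\<^sub>R y - y" using quad[OF yW] by simp
    then have "(2 - 2 * c) *\<^sub>R y = 0" by (simp add: algebra_simps scaleR_2)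
    then show "y = 0" using x(4) by simp
  qed
  then have "invertible (mat 1 - A')"
    by (metis matrix_left_invertible_ker invertible_left_inverse)
  then obtain Z where "(mat 1 - A') ** Z = mat 1" unfolding invertible_def by blast
  then have "v = (mat 1 - A') *v (Z *v v)" by (simp add: matrix_vector_mul_assoc)
  then have "v \<in> range ((*v) (mat 1 - A'))" by blast
  moreover have "\<not> hyperbolic A'"
    using x xW pr_id by (intro circle_eigenvalue_complex[of x A' c]) (auto simp: A')
  moreover have "dist A' A < e" using d(2)[of t] t by (simp add: dist_norm A'_def)
  ultimately show ?thesis by blast
qed

section \<open>Splitting a multiple eigenvalue 1\<close>

definition rank_one :: "real^'n \<Rightarrow> real^'n \<Rightarrow> real^'n^'n" where
  "rank_one y a = (\<chi> i j. y $ i * a $ j)"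

lemma rank_one_mult: "rank_one y a *v x = (a \<bullet> x) *\<^sub>R y"
  by (simp add: rank_one_def vec_eq_iff matrix_vector_mult_def inner_vec_def sum_distrib_left mult_ac)

lemma dual_vector_exists:
  fixes x0 x1 :: "'a::real_inner"
  assumes "x0 \<noteq> 0" "x1 \<notin> span {x0}"
  shows "\<exists>\<alpha>. \<alpha> \<bullet> x0 = a \<and> \<alpha> \<bullet> x1 = b"
proof -
  define y where "y = x1 - ((x0 \<bullet> x1) / (x0 \<bullet> x0)) *\<^sub>R x0"
  have "y \<noteq> 0" using assms(2) by (auto simp: y_def span_singleton)
  have y0: "y \<bullet> x0 = 0" using assms(1) by (simp add: y_def inner_diff_left inner_commute[of x1])
  then have "y \<bullet> y = y \<bullet> x1"
    by (subst (2) y_def) (simp add: inner_diff_right)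
  moreover from this have "y \<bullet> x1 \<noteq> 0" using \<open>y \<noteq> 0\<close> by (metis inner_eq_zero_iff)
  ultimately have y1: "y \<bullet> y = y \<bullet> x1" "y \<bullet> x1 \<noteq> 0" by auto
  define k where "k = (b - a / (x0 \<bullet> x0) * (x0 \<bullet> x1)) / (y \<bullet> y)"
  show ?thesis
    using assms(1) y0 y1
    by (intro exI[of _ "(a / (x0 \<bullet> x0)) *\<^sub>R x0 + k *\<^sub>R y"]) (simp add: inner_add_left k_def)
qed

text \<open>Since \<open>\<alpha>\<close> is \<open>1\<close> on both vectors, \<open>A1\<close>
  acts on their plane with trace \<open>2 - t\<close> and determinant \<open>1\<close>. The double
  eigenvalue thus becomes a conjugate pair on the circle with real part \<open>1 - t / 2\<close>,
  which the preceding perturbation can keep.\<close>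

lemma perturb_jordan_block:
  fixes A :: "real^'n^'n"
  assumes x: "x0 \<noteq> 0" "x1 \<notin> span {x0}" "A *v x0 = x0" "A *v x1 = x1 + x0" and "e > 0"
  shows "\<exists>A'. dist A' A < e \<and> \<not> hyperbolic A' \<and> v \<in> range ((*v) (mat 1 - A'))"
proof -
  obtain \<alpha> where \<alpha>: "\<alpha> \<bullet> x0 = 1" "\<alpha> \<bullet> x1 = 1" using dual_vector_exists[OF x(1,2)] by blast
  obtain d where d: "d > 0" "\<And>t. \<bar>t\<bar> < d \<Longrightarrow> norm (t *\<^sub>R rank_one x1 \<alpha>) < e / 2"
    using scaled_perturbation[of "e / 2" "rank_one x1 \<alpha>"] \<open>e > 0\<close> by auto
  define t where "t = min (d / 2) 1"
  have t: "0 < t" "t < d" "t \<le> 1" using d(1) by (auto simp: t_def)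
  define A1 where "A1 = A - t *\<^sub>R rank_one x1 \<alpha>"
  have A1: "A1 *v y = A *v y - (t * (\<alpha> \<bullet> y)) *\<^sub>R x1" for y
    by (simp add: A1_def matrix_vector_mult_diff_rdistrib scaleR_matrix_vector_assoc[symmetric] rank_one_mult)
  have A1x: "A1 *v x0 = x0 - t *\<^sub>R x1" "A1 *v x1 = x1 + x0 - t *\<^sub>R x1"
    by (simp_all add: A1 x \<alpha>)
  have "A1 *v (A1 *v x0) = A1 *v x0 - t *\<^sub>R (A1 *v x1)"
    by (simp only: A1x(1) matrix_vector_mult_diff_distrib matrix_vector_mult_scaleR)
  also have "\<dots> = (2 * (1 - t / 2)) *\<^sub>R (A1 *v x0) - x0"
    by (simp add: A1x vec_eq_iff algebra_simps)
  finally obtain A' where "dist A' A1 < e / 2" "\<not> hyperbolic A'" "v \<in> range ((*v) (mat 1 - A'))"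
    using perturb_keeping_circle_eigenvalue[OF x(1), of A1 "1 - t / 2" "e / 2" v] t \<open>e > 0\<close> by auto
  moreover have "dist A1 A < e / 2" using d(2)[of t] t by (simp add: A1_def dist_norm)
  ultimately show ?thesis using dist_triangle_half_r by (metis dist_commute)
qed

text \<open>Reduction to a Jordan block. If the eigenspace is more than a line, a small nilpotent
  term creates a block; if it is a line, failure of simplicity yields a Jordan chain above
  \<open>x0\<close>.\<close>

lemma perturb_multiple_eigenvalue:
  fixes A :: "real^'n^'n"
  assumes "1 \<in> Spec A" "alg_mult A 1 \<noteq> 1" "e > 0"
  shows "\<exists>A'. dist A' A < e \<and> \<not> hyperbolic A' \<and> v \<in> range ((*v) (mat 1 - A'))"
proof -
  obtain \<phi> where \<phi>: "\<phi> \<noteq> 0" "\<phi> v* A = \<phi>" using real_left_fixed_exists[OF assms(1)] by blast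
  obtain x0 where x0: "x0 \<noteq> 0" "A *v x0 = x0" "\<phi> \<bullet> x0 = 0"
    using simple_one_iff[OF \<phi>] assms(2) by blast
  show ?thesis
  proof (cases "\<exists>x1. x1 \<notin> span {x0} \<and> A *v x1 = x1")
    case True
    then obtain x1 where x1: "x1 \<notin> span {x0}" "A *v x1 = x1" by blast
    obtain \<alpha> where \<alpha>: "\<alpha> \<bullet> x0 = 0" "\<alpha> \<bullet> x1 = 1" using dual_vector_exists[OF x0(1) x1(1)] by blast
    obtain d where d: "d > 0" "\<And>t. \<bar>t\<bar> < d \<Longrightarrow> norm (t *\<^sub>R rank_one x0 \<alpha>) < e / 2"
      using scaled_perturbation[of "e / 2" "rank_one x0 \<alpha>"] \<open>e > 0\<close> by auto
    define t where "t = d / 2"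
    have t: "0 < t" "t < d" using d(1) by (auto simp: t_def)
    define A1 where "A1 = A + t *\<^sub>R rank_one x0 \<alpha>"
    have A1: "A1 *v y = A *v y + (t * (\<alpha> \<bullet> y)) *\<^sub>R x0" for y
      by (simp add: A1_def matrix_vector_mult_add_rdistrib scaleR_matrix_vector_assoc[symmetric] rank_one_mult)
    have "x1 \<notin> span {t *\<^sub>R x0}"
      using x1(1) t(1) by (auto simp: span_singleton)
    moreover have "A1 *v (t *\<^sub>R x0) = t *\<^sub>R x0" "A1 *v x1 = x1 + t *\<^sub>R x0" "t *\<^sub>R x0 \<noteq> 0"
      using x0 x1 \<alpha> t by (simp_all add: A1 matrix_vector_mult_scaleR)
    ultimately obtain A' where "dist A' A1 < e / 2" "\<not> hyperbolic A'" "v \<in> range ((*v) (mat 1 - A'))"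
      using perturb_jordan_block[of "t *\<^sub>R x0" x1 A1 "e / 2" v] \<open>e > 0\<close> by auto
    moreover have "dist A1 A < e / 2" using d(2)[of t] t by (simp add: A1_def dist_norm)
    ultimately show ?thesis using dist_triangle_half_r by (metis dist_commute)
  next
    case False
    \<comment> \<open>Otherwise a left fixed vector \<open>\<psi>\<close> with
      \<open>\<psi> \<bullet> x0 \<noteq> 0\<close> exists, and since the eigenspace is a line, the
      image of \<open>1 - A\<close> is the whole kernel of \<open>\<psi>\<close>. As
      \<open>\<phi>\<close> vanishes on this image, it is a multiple of \<open>\<psi>\<close>, and
      \<open>\<phi> \<bullet> x0 = 0\<close> forces it to be \<open>0\<close>.\<close>
    have "x0 \<in> range ((*v) (mat 1 - A))"
    proof (rule ccontr)
      assume n: "x0 \<notin> range ((*v) (mat 1 - A))"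
      have "subspace (range ((*v) (mat 1 - A)))"
        using linear_subspace_image[OF matrix_vector_mul_linear subspace_UNIV] .
      then obtain \<psi> where \<psi>: "\<And>y. y \<in> range ((*v) (mat 1 - A)) \<Longrightarrow> \<psi> \<bullet> y = 0" "\<psi> \<bullet> x0 \<noteq> 0"
        using separating_functional n by metis
      have "\<psi> \<bullet> ((mat 1 - A) *v y) = 0" for y using \<psi>(1) by blast
      then have "\<psi> v* A = \<psi>"
        by (intro vector_eq_rdot[THEN iffD1])
          (simp add: dot_lmul_matrix matrix_vector_mult_diff_rdistrib inner_diff_right)
      moreover have "x = 0" if "A *v x = x" "\<psi> \<bullet> x = 0" for x
      proof -
        have "x \<in> span {x0}" using False that(1) by blast
        then show ?thesis using that(2) \<psi>(2) by (auto simp: span_singleton)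
      qed
      ultimately have hyp: "y \<in> range ((*v) (mat 1 - A))" if "\<psi> \<bullet> y = 0" for y
        using range_eq_hyperplane that by blast
      define y where "y = \<phi> - ((\<psi> \<bullet> \<phi>) / (\<psi> \<bullet> \<psi>)) *\<^sub>R \<psi>"
      have "\<psi> \<noteq> 0" using \<psi>(2) by auto
      then have "\<psi> \<bullet> y = 0" by (simp add: y_def inner_diff_right)
      then have "\<phi> \<bullet> y = 0" using hyp left_fixed_inner[OF \<phi>(2)] by blast
      then have "y \<bullet> y = 0" using \<open>\<psi> \<bullet> y = 0\<close> by (subst (1) y_def) (simp add: inner_diff_left)
      then have "\<phi> = ((\<psi> \<bullet> \<phi>) / (\<psi> \<bullet> \<psi>)) *\<^sub>R \<psi>" by (simp add: y_def)
      then have "0 = ((\<psi> \<bullet> \<phi>) / (\<psi> \<bullet> \<psi>)) * (\<psi> \<bullet> x0)" using x0(3) by (metis inner_scaleR_left)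
      then have "(\<psi> \<bullet> \<phi>) / (\<psi> \<bullet> \<psi>) = 0" using \<psi>(2) by simp
      then show False using \<phi>(1) \<open>\<phi> = _\<close> by (metis scale_zero_left)
    qed
    then obtain y where y: "x0 = (mat 1 - A) *v y" by blast
    have "A *v (- y) = - y + x0"
      unfolding y by (simp add: matrix_vector_mult_diff_rdistrib linear_neg[OF matrix_vector_mul_linear])
    moreover have "- y \<notin> span {x0}"
    proof
      assume "- y \<in> span {x0}"
      then obtain k where "- y = k *\<^sub>R x0" by (auto simp: span_singleton)
      then have "y = (- k) *\<^sub>R x0" by (metis minus_minus scaleR_minus_left)
      then have "A *v y = y" by (simp only: matrix_vector_mult_scaleR x0(2))
      then show False using y x0(1) by (simp add: matrix_vector_mult_diff_rdistrib)
    qed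
    ultimately show ?thesis by (intro perturb_jordan_block[OF x0(1) _ x0(2) _ assms(3)])
  qed
qed

section \<open>The interior of the Anosov locus\<close>

text \<open>Projection along a compact factor preserves closedness. The index \<open>i\<close> lets
  a vector equation be given coordinate by coordinate.\<close>

lemma closed_projection_equations:
  fixes h :: "'i \<Rightarrow> 'k::euclidean_space \<times> 'a::euclidean_space \<Rightarrow> 'c::real_normed_vector"
  assumes "compact K" "\<And>i. continuous_on UNIV (h i)"
  shows "closed {a. \<exists>k\<in>K. \<forall>i. h i (k, a) = 0}"
proof -
  have "closed {z. \<forall>i. h i z = 0}"
    by (intro closed_Collect_all closed_Collect_eq continuous_on_const assms(2))
  from closed_compact_projection[OF assms(1) this] show ?thesis by (simp add: Bex_def)
qed

lemma neg_one_minus_mult: "(- mat 1 - A) *v x = - x - A *v x" for A :: "real^'n^'n"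
proof -
  have "(- mat 1 - A) *v x = (- mat 1) *v x - A *v x" by (rule matrix_vector_mult_diff_rdistrib)
  also have "(- mat 1 :: real^'n^'n) *v x = - x"
    by (simp add: vec_eq_iff matrix_vector_mult_def mat_def sum_negf if_distrib[of "\<lambda>a. a * _"] cong: if_cong)
  finally show ?thesis .
qed

text \<open>Vectors are normalised here and below so that the quantifiers range over compact sets
  and the conditions become closed.\<close>

definition "circle_eigenvectors (A::real^'n^'n) \<longleftrightarrow>
  (\<exists>z\<in>sphere 0 1. \<exists>u\<in>sphere 0 1. complexify A *v u = z *s u)"


text \<open>
  Two eigenvalues on the unit circle, counted with multiplicity: \<open>bdot \<phi> u = 0\<close> is automatic for
  \<open>x \<noteq> y\<close>, and for \<open>x = y\<close> it says that the eigenvalue is not simple.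
\<close>

definition "circle_pair (A::real^'n^'n) \<longleftrightarrow>
  (\<exists>x\<in>sphere 0 1. \<exists>y\<in>sphere 0 1. \<exists>u\<in>sphere 0 1. \<exists>\<phi>\<in>sphere 0 1.
     complexify A *v u = x *s u \<and> \<phi> v* complexify A = y *s \<phi> \<and> bdot \<phi> u = 0)"

text \<open>If \<open>1\<close> is a simple eigenvalue, the image of \<open>1 - A\<close> is the
  kernel of the left fixed vector, so this is the existence of a fixed point in closed form.\<close>

definition "left_fixed_null (A::real^'n^'n) v \<longleftrightarrow> (\<exists>\<phi>\<in>sphere 0 1. \<phi> v* A = \<phi> \<and> \<phi> \<bullet> v = 0)"

lemma hyperbolic_iff_no_circle_eigenvectors: "hyperbolic A \<longleftrightarrow> \<not> circle_eigenvectors A"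
proof -
  have "\<exists>u\<in>sphere 0 1. complexify A *v u = z *s u" if "w \<noteq> 0" "complexify A *v w = z *s w" for w z
  proof (intro bexI[of _ "complex_of_real (1 / norm w) *s w"])
    show "complexify A *v (complex_of_real (1 / norm w) *s w) = z *s (complex_of_real (1 / norm w) *s w)"
      unfolding vector_scalar_commute that(2) by (simp add: vec_eq_iff)
    show "complex_of_real (1 / norm w) *s w \<in> sphere 0 1"
      using that(1) by (simp add: norm_vector_smult norm_divide)
  qed
  then have "(\<exists>u\<in>sphere 0 1. complexify A *v u = z *s u) \<longleftrightarrow> z \<in> Spec A" for z
    unfolding Spec_def mem_Collect_eq by (metis mem_sphere_0 norm_zero zero_neq_one)
  then show ?thesis
    unfolding hyperbolic_def circle_eigenvectors_def by blast
qed

lemma circle_pairI: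
  assumes "cmod x = 1" "cmod y = 1" "u \<noteq> 0" "\<phi> \<noteq> 0"
    "complexify A *v u = x *s u" "\<phi> v* complexify A = y *s \<phi>" "bdot \<phi> u = 0"
  shows "circle_pair A"
proof -
  let ?a = "complex_of_real (1 / norm u)" and ?b = "complex_of_real (1 / norm \<phi>)"
  have "complexify A *v (?a *s u) = x *s (?a *s u)"
    unfolding vector_scalar_commute assms(5) by (simp add: vec_eq_iff)
  moreover have "(?b *s \<phi>) v* complexify A = y *s (?b *s \<phi>)"
  proof -
    have "(?b *s \<phi>) v* complexify A = ?b *s (\<phi> v* complexify A)"
      by (simp add: vec_eq_iff vector_matrix_mult_def sum_distrib_left mult_ac)
    then show ?thesis unfolding assms(6) by (simp add: vec_eq_iff)
  qed
  moreover have "bdot (?b *s \<phi>) (?a *s u) = 0" by (simp only: bdot_smult assms(7) mult_zero_right)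
  moreover have "?a *s u \<in> sphere 0 1" "?b *s \<phi> \<in> sphere 0 1"
    using assms(3,4) by (simp_all add: norm_vector_smult norm_divide)
  ultimately show ?thesis
    unfolding circle_pair_def using assms(1,2)
    by (intro bexI[of _ x] bexI[of _ y] bexI[of _ "?a *s u"] bexI[of _ "?b *s \<phi>"]) auto
qed

lemma closed_circle_eigenvectors: "closed {A :: real^'n^'n. circle_eigenvectors A}"
proof -
  define h :: "'n \<Rightarrow> (complex \<times> (complex^'n)) \<times> (real^'n^'n) \<Rightarrow> complex" where
    "h i = (\<lambda>((z, u), A). (\<Sum>j\<in>UNIV. complex_of_real (A $ i $ j) * u $ j) - z * u $ i)" for i
  have "continuous_on UNIV (h i)" for i
    unfolding h_def case_prod_unfold by (intro continuous_intros)
  from closed_projection_equations[OF compact_Times[OF compact_sphere compact_sphere] this]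
  have "closed {A. \<exists>k\<in>sphere 0 1 \<times> sphere 0 1. \<forall>i. h i (k, A) = 0}" .
  moreover have "circle_eigenvectors A \<longleftrightarrow> (\<exists>k\<in>sphere 0 1 \<times> sphere 0 1. \<forall>i. h i (k, A) = 0)" for A
    unfolding circle_eigenvectors_def h_def by (simp add: vec_eq_iff matrix_vector_mult_def)
  ultimately show ?thesis by simp
qed

lemma closed_circle_pair: "closed {A :: real^'n^'n. circle_pair A}"
proof -
  \<comment> \<open>The index enumerates the scalar equations: \<open>Inl (Some i)\<close> for the
    right eigenvector, \<open>Inr j\<close> for the left one, \<open>Inl None\<close> for their
    pairing.\<close>
  define h :: "'n option + 'n \<Rightarrow>
      (complex \<times> complex \<times> (complex^'n) \<times> (complex^'n)) \<times> (real^'n^'n) \<Rightarrow> complex" where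
    "h k = (\<lambda>((x, y, u, \<phi>), A). case k of
        Inl (Some i) \<Rightarrow> (\<Sum>j\<in>UNIV. complex_of_real (A $ i $ j) * u $ j) - x * u $ i
      | Inr j \<Rightarrow> (\<Sum>i\<in>UNIV. \<phi> $ i * complex_of_real (A $ i $ j)) - y * \<phi> $ j
      | Inl None \<Rightarrow> (\<Sum>i\<in>UNIV. \<phi> $ i * u $ i))" for k
  have "continuous_on UNIV (h k)" for k
    unfolding h_def case_prod_unfold
    by (cases k; cases "projl k"; simp) (intro continuous_intros)+
  from closed_projection_equations[OF compact_Times[OF compact_sphere
        compact_Times[OF compact_sphere compact_Times[OF compact_sphere compact_sphere]]] this]
  have "closed {A. \<exists>k\<in>sphere 0 1 \<times> sphere 0 1 \<times> sphere 0 1 \<times> sphere 0 1. \<forall>i. h i (k, A) = 0}" .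
  moreover have "(\<forall>i. h i ((x, y, u, \<phi>), A) = 0) \<longleftrightarrow>
      complexify A *v u = x *s u \<and> \<phi> v* complexify A = y *s \<phi> \<and> bdot \<phi> u = 0" for x y u \<phi> A
  proof -
    have *: "(\<forall>i. P i) \<longleftrightarrow> P (Inl None) \<and> (\<forall>i. P (Inl (Some i))) \<and> (\<forall>j. P (Inr j))"
      for P :: "'n option + 'n \<Rightarrow> bool"
      by (metis not_None_eq sum.exhaust)
    show ?thesis
      unfolding *[of "\<lambda>i. h i ((x, y, u, \<phi>), A) = 0"]
      unfolding h_def
      by (simp add: vec_eq_iff matrix_vector_mult_def vector_matrix_mult_def bdot_def conj_ac)
  qed
  ultimately show ?thesis
    unfolding circle_pair_def by simp
qed

lemma closed_left_fixed_null: "closed {(A :: real^'n^'n, v). left_fixed_null A v}"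
proof -
  define h :: "'n option \<Rightarrow> (real^'n) \<times> (real^'n^'n) \<times> (real^'n) \<Rightarrow> real" where
    "h k = (\<lambda>(\<phi>, A, v). case k of
        Some j \<Rightarrow> (\<Sum>i\<in>UNIV. \<phi> $ i * A $ i $ j) - \<phi> $ j | None \<Rightarrow> \<phi> \<bullet> v)" for k
  have "continuous_on UNIV (h k)" for k
    unfolding h_def case_prod_unfold by (cases k; simp) (intro continuous_intros)+
  from closed_projection_equations[OF compact_sphere this]
  have "closed {a. \<exists>\<phi>\<in>sphere 0 1. \<forall>i. h i (\<phi>, a) = 0}" .
  moreover have h: "(\<forall>i. h i (\<phi>, A, v) = 0) \<longleftrightarrow> \<phi> v* A = \<phi> \<and> \<phi> \<bullet> v = 0" for \<phi> A v
  proof -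
    have *: "(\<forall>i. P i) \<longleftrightarrow> P None \<and> (\<forall>i. P (Some i))" for P :: "'n option \<Rightarrow> bool"
      by (metis not_None_eq)
    show ?thesis
      unfolding *[of "\<lambda>i. h i (\<phi>, A, v) = 0"]
      unfolding h_def
      by (simp add: vec_eq_iff vector_matrix_mult_def conj_ac)
  qed
  moreover have "{(A, v). left_fixed_null A v} = {a. \<exists>\<phi>\<in>sphere 0 1. \<forall>i. h i (\<phi>, a) = 0}"
  proof (rule set_eqI)
    fix a :: "(real^'n^'n) \<times> (real^'n)"
    obtain A v where "a = (A, v)" by fastforce
    then show "a \<in> {(A, v). left_fixed_null A v} \<longleftrightarrow> a \<in> {a. \<exists>\<phi>\<in>sphere 0 1. \<forall>i. h i (\<phi>, a) = 0}"
      by (simp add: h left_fixed_null_def)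
  qed
  ultimately show ?thesis by (simp only:)
qed

text \<open>Every condition on the right is open. Nonreal eigenvalues come in conjugate pairs, so
  without a circle pair the eigenvalue on the circle is real and simple; the determinant excludes
  \<open>-1\<close>, and the last condition excludes fixed points.\<close>

lemma hyperbolic_or_drift_iff:
  fixes A :: "real^'n^'n"
  assumes "invertible A"
  shows "(A, v) \<in> hyperbolic_locus \<union> regular_drift_pairs \<longleftrightarrow>
    \<not> circle_eigenvectors A \<or> \<not> circle_pair A \<and> det (- mat 1 - A) \<noteq> 0 \<and> \<not> left_fixed_null A v"
proof
  assume L: "(A, v) \<in> hyperbolic_locus \<union> regular_drift_pairs"
  show "\<not> circle_eigenvectors A \<or> \<not> circle_pair A \<and> det (- mat 1 - A) \<noteq> 0 \<and> \<not> left_fixed_null A v"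
  proof (cases "hyperbolic A")
    case False
    with L have spec: "Spec A \<inter> sphere 0 1 = {1}" and simple: "alg_mult A 1 = 1"
      and v: "v \<notin> range ((*v) (mat 1 - A))"
      by (auto simp: hyperbolic_locus_def regular_drift_pairs_def algebraically_simple_eigenvalue_def)
    have in_Spec: "z = 1" if "z \<in> Spec A" "cmod z = 1" for z
    proof -
      have "z \<in> Spec A \<inter> sphere 0 1" using that by simp
      then show ?thesis using spec by simp
    qed
    have "\<not> circle_pair A"
    proof
      assume "circle_pair A"
      then obtain x y u \<phi> where sph: "x \<in> sphere 0 1" "y \<in> sphere 0 1" "u \<in> sphere 0 1" "\<phi> \<in> sphere 0 1"
        and eqs: "complexify A *v u = x *s u" "\<phi> v* complexify A = y *s \<phi>" "bdot \<phi> u = 0"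
        unfolding circle_pair_def by blast
      from sph have "cmod x = 1" "cmod y = 1" "u \<noteq> 0" "\<phi> \<noteq> 0" by auto
      note * = this eqs
      have "x = 1" using in_Spec[of x] * by (auto simp: Spec_def)
      have "y = 1"
      proof (rule ccontr)
        assume "y \<noteq> 1"
        then have "y \<notin> Spec A" using in_Spec *(2) by blast
        moreover have "poly (charpoly (transpose (complexify A))) y = 0"
          using *(4,6) poly_charpoly_eq_0_iff by (metis vector_transpose_matrix transpose_transpose)
        moreover have "poly (charpoly (transpose (complexify A))) y = poly (charpoly (complexify A)) y"
          by (rule poly_charpoly_transpose)
        ultimately show False by (simp add: Spec_iff)
      qed
      then show False
        using order_charpoly_eq_1_iff[OF *(4,6)] simple * \<open>x = 1\<close> by (auto simp: alg_mult_def)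
    qed
    moreover have "det (- mat 1 - A) \<noteq> 0"
    proof
      assume "det (- mat 1 - A) = 0"
      then obtain x where "x \<noteq> 0" "(- mat 1 - A) *v x = 0" by (auto simp: det_eq_0_iff_kernel)
      then have "A *v x = (- 1) *\<^sub>R x"
        by (simp add: neg_one_minus_mult eq_neg_iff_add_eq_0)
      then have "complex_of_real (- 1) \<in> Spec A" using \<open>x \<noteq> 0\<close> real_eigenvalue_in_Spec by blast
      then show False using in_Spec[of "- 1"] by simp
    qed
    moreover have "\<not> left_fixed_null A v"
    proof
      assume "left_fixed_null A v"
      then obtain \<phi> where "\<phi> \<in> sphere 0 1" and \<phi>': "\<phi> v* A = \<phi>" "\<phi> \<bullet> v = 0"
        unfolding left_fixed_null_def by blast
      then have \<phi>: "\<phi> \<noteq> 0" "\<phi> v* A = \<phi>" "\<phi> \<bullet> v = 0" by auto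
      then show False
        using range_eq_hyperplane[OF \<phi>(2) _ \<phi>(3)] simple_one_iff[OF \<phi>(1,2)] simple v by blast
    qed
    ultimately show ?thesis by blast
  qed (simp add: hyperbolic_iff_no_circle_eigenvectors)
next
  assume R: "\<not> circle_eigenvectors A \<or> \<not> circle_pair A \<and> det (- mat 1 - A) \<noteq> 0 \<and> \<not> left_fixed_null A v"
  show "(A, v) \<in> hyperbolic_locus \<union> regular_drift_pairs"
  proof (cases "hyperbolic A")
    case True
    then show ?thesis using assms by (simp add: hyperbolic_locus_def param_space_def)
  next
    case False
    with R have np: "\<not> circle_pair A" and m1: "det (- mat 1 - A) \<noteq> 0" and nf: "\<not> left_fixed_null A v"
      by (auto simp: hyperbolic_iff_no_circle_eigenvectors)
    have uniq: "x = y" if xy: "x \<in> Spec A" "y \<in> Spec A" "cmod x = 1" "cmod y = 1" for x y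
    proof (rule ccontr)
      assume "x \<noteq> y"
      obtain u where u: "u \<noteq> 0" "complexify A *v u = x *s u" using xy(1) by (auto simp: Spec_def)
      obtain w where w: "w \<noteq> 0" "complexify A *v w = y *s w" using xy(2) by (auto simp: Spec_def)
      obtain \<phi> where \<phi>: "\<phi> \<noteq> 0" "\<phi> v* complexify A = y *s \<phi>"
        using left_eigenvector_exists[OF w(2,1)] by blast
      have "x * bdot \<phi> u = y * bdot \<phi> u"
        using bdot_mult[of \<phi> "complexify A" u] by (simp add: u(2) \<phi>(2) bdot_smult)
      then have "bdot \<phi> u = 0" using \<open>x \<noteq> y\<close> by simp
      then show False using circle_pairI[OF xy(3,4) u(1) \<phi>(1) u(2) \<phi>(2)] np by blast
    qed
    obtain z where z: "z \<in> Spec A" "cmod z = 1"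
      using False unfolding hyperbolic_def by (metis Int_emptyI mem_sphere_0)
    then have "cnj z = z" using uniq[OF cnj_Spec[OF z(1)] z(1)] by simp
    then have "z \<in> \<real>" by (simp add: Reals_cnj_iff)
    then have "z = 1 \<or> z = - 1" using z(2) by (auto simp: Reals_def abs_eq_iff')
    moreover have "z \<noteq> - 1"
    proof
      assume "z = - 1"
      then obtain w where w: "w \<noteq> 0" "complexify A *v w = (- 1) *s w" using z(1) by (auto simp: Spec_def)
      have "(- mat 1 - A) *v revec w = 0" "(- mat 1 - A) *v imvec w = 0"
        using arg_cong[OF w(2), of revec] arg_cong[OF w(2), of imvec]
        unfolding revec_complexify imvec_complexify
        by (simp_all add: neg_one_minus_mult vec_eq_iff)
      moreover have "revec w \<noteq> 0 \<or> imvec w \<noteq> 0"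
        using w(1) cvec_revec_imvec[of w] by (metis cvec_eq_0_iff add_0 vector_smult_rzero)
      ultimately show False using m1 by (auto simp: det_eq_0_iff_kernel)
    qed
    ultimately have "1 \<in> Spec A" using z(1) by blast
    then have spec: "Spec A \<inter> sphere 0 1 = {1}" using uniq[of _ 1] by auto
    obtain \<phi> where \<phi>: "\<phi> \<noteq> 0" "\<phi> v* A = \<phi>" using real_left_fixed_exists[OF \<open>1 \<in> Spec A\<close>] by blast
    have "alg_mult A 1 = 1"
    proof (rule ccontr)
      assume "alg_mult A 1 \<noteq> 1"
      moreover have c\<phi>: "cvec \<phi> v* complexify A = 1 *s cvec \<phi>" by (simp add: cvec_left_mult \<phi>)
      ultimately obtain u where "u \<noteq> 0" "complexify A *v u = 1 *s u" "bdot (cvec \<phi>) u = 0"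
        using order_charpoly_eq_1_iff[OF _ c\<phi>] \<phi>(1) unfolding alg_mult_def by auto
      then show False using circle_pairI[of 1 1 u "cvec \<phi>" A] np c\<phi> \<phi>(1) by auto
    qed
    moreover have "v \<notin> range ((*v) (mat 1 - A))"
    proof
      assume "v \<in> range ((*v) (mat 1 - A))"
      then have "\<phi> \<bullet> v = 0" using left_fixed_inner[OF \<phi>(2)] by blast
      moreover have "((1 / norm \<phi>) *\<^sub>R \<phi>) v* A = (1 / norm \<phi>) *\<^sub>R \<phi>"
      proof -
        have "((1 / norm \<phi>) *\<^sub>R \<phi>) v* A = (1 / norm \<phi>) *\<^sub>R (\<phi> v* A)"
          by (simp add: vec_eq_iff vector_matrix_mult_def sum_distrib_left mult_ac)
        then show ?thesis by (simp add: \<phi>(2))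
      qed
      ultimately have "left_fixed_null A v"
        unfolding left_fixed_null_def using \<phi>(1) by (intro bexI[of _ "(1 / norm \<phi>) *\<^sub>R \<phi>"]) auto
      then show False using nf by blast
    qed
    ultimately show ?thesis
      using spec assms \<open>1 \<in> Spec A\<close>
      by (simp add: regular_drift_pairs_def param_space_def algebraically_simple_eigenvalue_def)
  qed
qed

lemma open_hyperbolic_or_drift:
  "open (hyperbolic_locus \<union> regular_drift_pairs :: 'n::finite param set)"
proof -
  have "hyperbolic_locus \<union> regular_drift_pairs
    = {A. invertible A} \<times> UNIV \<inter> ({A. \<not> circle_eigenvectors A} \<times> UNIV \<union>
        ({A. \<not> circle_pair A} \<times> UNIV \<inter> {A :: real^'n^'n. det (- mat 1 - A) \<noteq> 0} \<times> UNIV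
          \<inter> - {(A, v :: real^'n). left_fixed_null A v}))" (is "?L = ?R")
  proof -
    have "(A, v) \<in> ?L \<longleftrightarrow> (A, v) \<in> ?R" for A v
    proof (cases "invertible A")
      case True
      then show ?thesis unfolding hyperbolic_or_drift_iff[OF True] by simp
    qed (simp add: hyperbolic_locus_def regular_drift_pairs_def param_space_def)
    then show ?thesis by auto
  qed
  moreover have "open {A :: real^'n^'n. det (- mat 1 - A) \<noteq> 0}"
    unfolding det_def by (intro open_Collect_neq continuous_intros)
  moreover have "open {A :: real^'n^'n. \<not> circle_eigenvectors A}" "open {A :: real^'n^'n. \<not> circle_pair A}"
    using closed_circle_eigenvectors closed_circle_pair by (simp_all add: closed_def Collect_neg_eq)
  ultimately show ?thesis
    using closed_left_fixed_null open_invertible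
    by (auto intro!: open_Int open_Un open_Times)
qed

text \<open>Only the matrix moves. If \<open>v\<close> is already in the image, \<open>A\<close>
  itself serves; otherwise a circle eigenvalue different from \<open>1\<close> or a multiple
  eigenvalue \<open>1\<close> allows a perturbation without the eigenvalue \<open>1\<close>, and
  then every \<open>v\<close> is in the image.\<close>

lemma nearby_outside_anosov_locus:
  fixes A :: "real^'n^'n"
  assumes "(A, v) \<notin> hyperbolic_locus \<union> regular_drift_pairs" "invertible A" "e > 0"
  shows "\<exists>A'. dist A' A < e \<and> \<not> hyperbolic A' \<and> v \<in> range ((*v) (mat 1 - A'))"
proof -
  have nh: "\<not> hyperbolic A" using assms(1,2) by (simp add: hyperbolic_locus_def param_space_def)
  consider "v \<in> range ((*v) (mat 1 - A))"
    | z where "z \<in> Spec A" "cmod z = 1" "z \<noteq> 1"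
    | "v \<notin> range ((*v) (mat 1 - A))" "Spec A \<inter> sphere 0 1 = {1}"
  proof -
    assume *: "v \<in> range ((*v) (mat 1 - A)) \<Longrightarrow> thesis"
      "\<And>z. z \<in> Spec A \<Longrightarrow> cmod z = 1 \<Longrightarrow> z \<noteq> 1 \<Longrightarrow> thesis"
      "v \<notin> range ((*v) (mat 1 - A)) \<Longrightarrow> Spec A \<inter> sphere 0 1 = {1} \<Longrightarrow> thesis"
    show thesis
    proof (cases "Spec A \<inter> sphere 0 1 \<subseteq> {1}")
      case True
      then have "Spec A \<inter> sphere 0 1 = {1}"
        using subset_singletonD[OF True] nh by (simp add: hyperbolic_def)
      then show thesis using *(1,3) by blast
    next
      case False
      then obtain z where "z \<in> Spec A \<inter> sphere 0 1" "z \<notin> {1}" by (meson subsetI)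
      then show thesis using *(2)[of z] by simp
    qed
  qed
  then show ?thesis
  proof cases
    case 1
    then show ?thesis using nh assms(3) by (intro exI[of _ A]) auto
  next
    case 2
    obtain x where x: "x \<noteq> 0" "A *v (A *v x) = (2 * Re z) *\<^sub>R (A *v x) - x"
      using circle_eigenvalue_real[OF 2(1,2)] by blast
    have "\<bar>Re z\<bar> \<le> 1" using abs_Re_le_cmod[of z] 2(2) by simp
    moreover have "Re z \<noteq> 1"
    proof
      assume "Re z = 1"
      then have "Im z = 0" using 2(2) by (simp add: cmod_def)
      then show False using 2(3) \<open>Re z = 1\<close> by (simp add: complex_eq_iff)
    qed
    ultimately show ?thesis by (rule perturb_keeping_circle_eigenvalue[OF x _ _ assms(3)])
  next
    case 3
    then have "1 \<in> Spec A" by blast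
    moreover have "alg_mult A 1 \<noteq> 1"
      using 3 assms(1,2) \<open>1 \<in> Spec A\<close>
      by (auto simp: regular_drift_pairs_def param_space_def algebraically_simple_eigenvalue_def)
    ultimately show ?thesis by (rule perturb_multiple_eigenvalue[OF _ _ assms(3)])
  qed
qed

theorem theorem1p2:
  fixes P \<A> \<H> \<D> :: "'n::finite param set"
  defines "P \<equiv> param_space"
    and "\<A> \<equiv> anosov_locus"
    and "\<H> \<equiv> hyperbolic_locus"
    and "\<D> \<equiv> regular_drift_pairs"
  assumes "CARD('n) \<ge> 2"
  shows "top_of_set P closure_of \<A> = P
    \<and> top_of_set P interior_of \<A> = \<H> \<union> \<D>
    \<and> (\<forall>A v. (A, v) \<in> \<A> \<and> \<not> hyperbolic A \<longrightarrow>
          ((A, v) \<in> top_of_set P interior_of \<A> \<longleftrightarrow>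
             algebraically_simple_eigenvalue A 1 \<and> Spec A \<inter> sphere 0 1 = {1} \<and>
             (\<nexists>x. affine_map A v x = x)))
    \<and> top_of_set P frontier_of \<A> = P - (\<H> \<union> \<D>)"
proof -
  note iff = anosov_locus_iff[OF assms(5), folded \<A>_def]
  have P_iff: "(A, v) \<in> P \<longleftrightarrow> invertible A" for A v by (simp add: P_def param_space_def)
  have AP: "\<A> \<subseteq> P" by (auto simp: iff P_iff)
  have HD: "\<H> \<union> \<D> \<subseteq> \<A>"
    by (auto simp: \<H>_def \<D>_def iff hyperbolic_locus_def regular_drift_pairs_def param_space_def)
  \<comment> \<open>Both perturbations fix \<open>v\<close>, so openness is used in the matrix
    direction; it also keeps the perturbed matrix invertible.\<close>
  have near: "\<exists>e>0. \<forall>A'. dist A' A < e \<longrightarrow> (A', v) \<in> P \<inter> T" if T: "open T" "(A, v) \<in> P \<inter> T" for T A v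
  proof -
    have "open (P \<inter> T)"
      unfolding P_def param_space_def using T(1) by (intro open_Int open_Times open_invertible open_UNIV)
    then obtain e where e: "e > 0" "ball (A, v) e \<subseteq> P \<inter> T"
      using T(2) open_contains_ball by blast
    have "(A', v) \<in> ball (A, v) e" if "dist A' A < e" for A'
      using that by (simp add: dist_Pair_Pair dist_commute)
    then show ?thesis using e by blast
  qed
  have cl: "top_of_set P closure_of \<A> = P"
  proof (rule antisym)
    show "top_of_set P closure_of \<A> \<subseteq> P" using closure_of_subset_topspace[of "top_of_set P"] by simp
    show "P \<subseteq> top_of_set P closure_of \<A>"
    proof
      fix a assume "a \<in> P"
      obtain A v where a: "a = (A, v)" by fastforce
      have "\<exists>y. y \<in> \<A> \<and> y \<in> U" if U: "a \<in> U" "openin (top_of_set P) U" for U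
      proof -
        obtain T where T: "open T" "U = P \<inter> T" using U(2) by (auto simp: openin_open)
        obtain e where e: "e > 0" "\<And>A'. dist A' A < e \<Longrightarrow> (A', v) \<in> P \<inter> T"
          using near[OF T(1), of A v] U(1) a T(2) by blast
        obtain A' where "dist A' A < e" "hyperbolic A'" using hyperbolic_dense[OF e(1)] by blast
        then show ?thesis using e(2) T(2) P_iff iff by blast
      qed
      then show "a \<in> top_of_set P closure_of \<A>" using \<open>a \<in> P\<close> by (auto simp: in_closure_of)
    qed
  qed
  have int: "top_of_set P interior_of \<A> = \<H> \<union> \<D>"
  proof (rule antisym)
    have "openin (top_of_set P) (\<H> \<union> \<D>)"
      unfolding \<H>_def \<D>_def openin_open
      using open_hyperbolic_or_drift order_trans[OF HD AP, unfolded \<H>_def \<D>_def] by blast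
    then show "\<H> \<union> \<D> \<subseteq> top_of_set P interior_of \<A>" by (rule interior_of_maximal[OF HD])
    show "top_of_set P interior_of \<A> \<subseteq> \<H> \<union> \<D>"
    proof
      fix a assume "a \<in> top_of_set P interior_of \<A>"
      then obtain T where T: "open T" "a \<in> P \<inter> T" "P \<inter> T \<subseteq> \<A>"
        by (auto simp: interior_of_def openin_open)
      obtain A v where a: "a = (A, v)" by fastforce
      obtain e where e: "e > 0" "\<And>A'. dist A' A < e \<Longrightarrow> (A', v) \<in> P \<inter> T"
        using near[OF T(1), of A v] T(2) a by blast
      show "a \<in> \<H> \<union> \<D>"
      proof (rule ccontr)
        assume "a \<notin> \<H> \<union> \<D>"
        then obtain A' where "dist A' A < e" "\<not> hyperbolic A'" "v \<in> range ((*v) (mat 1 - A'))"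
          using nearby_outside_anosov_locus[of A v e] e(1) T(2) P_iff unfolding a \<H>_def \<D>_def by blast
        then show False using e(2) T(3) iff by blast
      qed
    qed
  qed
  have "(A, v) \<in> \<H> \<union> \<D> \<longleftrightarrow> algebraically_simple_eigenvalue A 1 \<and> Spec A \<inter> sphere 0 1 = {1} \<and>
      (\<nexists>x. affine_map A v x = x)" if "(A, v) \<in> \<A>" "\<not> hyperbolic A" for A v
    using that unfolding fixed_point_iff
    by (auto simp: \<H>_def \<D>_def hyperbolic_locus_def regular_drift_pairs_def param_space_def iff)
  then show ?thesis
    using cl int by (simp add: frontier_of_def)
qed

end
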